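(* Let $\eta_1,\dots,\eta_n\in L^2(K)$ be such that $|\widehat{\eta}_i|=\chi_{W_i}$ (the characteristic function of a measurable set $W_i\subset K$) for $i\in\{1,2,\dots,n\}$. Then $(\eta_1,\dots,\eta_n)$ is a super-wavelet of length $n$ if and only if the following hold: (a) for each $i\in\{1,2,\dots,n\}$, the system $\{\mathfrak p^jW_i: j\in\mathbb Z\}$ is a measurable partition of $K$; (b) for each $i\in\{1,2,\dots,n\}$, the system $\{W_i+u(k): k\in\mathbb N_0\}$ is a measurable partition of a subset of $K$; (c) the system $\{W_i+u(k): k\in\mathbb N_0,\ 1\le i\le n\}$ is a measurable partition of $K$.
   Context: Local field setup. $K$ is a local field of positive characteristic, i.e. a locally compact, non-discrete, totally disconnected field of characteristic $p>0$, with absolute value $|\cdot|$. $\mathcal O=\{x\in K:|x|\le 1\}$ is the ring of integers, $\mathfrak P=\{x\in K:|x|<1\}$ its maximal ideal, $\mathfrak p$ a fixed prime element ($\mathfrak P=\mathfrak p\mathcal O$), $\mathcal O^*=\mathcal O\setminus\mathfrak P$, and $\mathcal O/\mathfrak P\cong GF(q)$ with $q=p^c$; $|\mathfrak p|=q^{-1}$. $dx$ is the Haar measure on $(K,+)$ with $|\mathcal O|=1$, where $|E|$ denotes the Haar measure of a measurable set $E$. $\mathbb N_0=\mathbb N\cup\{0\}$. The elements $u(n)$, $n\in\mathbb N_0$: fix $\{1=\epsilon_0,\epsilon_1,\dots,\epsilon_{c-1}\}\subset\mathcal O^*$ whose images in $\mathcal O/\mathfrak P$ form a basis of $GF(q)$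 over $GF(p)$. For $0\le n<q$ write $n=\sum_{k=0}^{c-1}a_kp^k$, $0\le a_k<p$, and set $u(n)=\big(\sum_{k=0}^{c-1}a_k\epsilon_k\big)\mathfrak p^{-1}$. For general $n=\sum_{k=0}^s b_kq^k$, $0\le b_k<q$, set $u(n)=\sum_{k=0}^s u(b_k)\mathfrak p^{-k}$. The set $\{u(n)\}_{n\in\mathbb N_0}$ is a complete list of distinct coset representatives of $\mathcal O$ in $(K,+)$. Character and Fourier transform: $\chi$ is a fixed character of $(K,+)$, trivial on $\mathcal O$ and nontrivial on $\mathfrak P^{-1}=\mathfrak p^{-1}\mathcal O$; $\chi_y(x)=\chi(yx)$; the setup is such that $\chi_{u(k)}(u(l))=1$ for all $k,l\in\mathbb N_0$. $\widehat f(\xi)=\int_K f(x)\overline{\chi_\xi(x)}\,dx$ for $f\in L^1(K)$, extended to $L^2(K)$. Operators on $L^2(K)$: $D^jf(x)=q^{j/2}f(\mathfrak p^{-j}x)$ for $j\in\mathbb Z$, and $T^kf(x)=f(x-u(k))$ for $k\in\mathbb N_0$. Definitions. $\eta\in L^2(K)$ is a Parseval frame wavelet if $\|f\|^2=\sum_{(j,k)\in\mathbb Z\times\mathbb N_0}|\langle f,D^jT^k\eta\rangle|^2$ for every $f\in L^2(K)$. An $n$-tuple $(\eta_1,\dots,\eta_n)$ of Parseval frame wavelets for $L^2(K)$ is a super-wavelet of length $n$ if $\{D^jT^k\eta_1\oplus\cdots\oplus D^jT^k\eta_n: j\in\mathbb Z,\ k\in\mathbb N_0\}$ is an orthonormal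 basis for the $n$-fold direct sum Hilbert space $L^2(K)\oplus\cdots\oplus L^2(K)$. A countable indexed system of measurable sets is a measurable partition of a measurable set $E$ if sets with different indices intersect in a null set and the union equals $E$ up to a null set; it is a measurable partition of a subset of $K$ if this holds for some measurable $E\subset K$. *)

theory Defs
  imports "HOL-Analysis.Analysis" "HOL-Computational_Algebra.Computational_Algebra"
begin

section \<open>Local fields of positive characteristic\<close>

definition ring_of_integers :: "('a::field \<Rightarrow> real) \<Rightarrow> 'a set" where
  "ring_of_integers absv = {x. absv x \<le> 1}"

definition max_ideal :: "('a::field \<Rightarrow> real) \<Rightarrow> 'a set" where
  "max_ideal absv = {x. absv x < 1}"

definition residue_rel :: "('a::field \<Rightarrow> real) \<Rightarrow> ('a \<times> 'a) set" where
  "residue_rel absv = {(x, y). x \<in> ring_of_integers absv \<and> y \<in> ring_of_integers absv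
      \<and> x - y \<in> max_ideal absv}"

locale local_field =
  fixes absv :: "'a::{field, metric_space} \<Rightarrow> real"
    and p :: nat
  assumes dist_absv: "dist x y = absv (x - y)"
    and absv_eq_0_iff: "absv x = 0 \<longleftrightarrow> x = 0"
    and absv_mult: "absv (x * y) = absv x * absv y"
    and absv_ultrametric: "absv (x + y) \<le> max (absv x) (absv y)"
    and locally_compact: "locally_compact_space (euclidean :: 'a topology)"
    and nondiscrete: "\<not> open {0::'a}"
    and totally_disconnected: "\<And>S (x::'a) y. connected S \<Longrightarrow> x \<in> S \<Longrightarrow> y \<in> S \<Longrightarrow> x = y"
    and char_p: "p = CHAR('a)"
    and p_pos: "p > 0"

text \<open>
  The residue field is a field with \<open>p ^ c\<close> elements, i.e. \<open>GF(p ^ c)\<close>. Its prime field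
  \<open>GF(p)\<close> is the image of the integers, so the last two assumptions say that the residue
  classes of \<open>\<epsilon> 0, \<dots>, \<epsilon> (c - 1)\<close> are linearly independent over \<open>GF(p)\<close> and span.
\<close>

locale local_field_basis = local_field absv p
  for absv :: "'a::{field, metric_space} \<Rightarrow> real" and p :: nat +
  fixes c :: nat
    and \<pi> :: 'a
    and \<epsilon> :: "nat \<Rightarrow> 'a"
  assumes c_pos: "c > 0"
    and prime_element: "max_ideal absv = (*) \<pi> ` ring_of_integers absv"
    and residue_field_card: "card (ring_of_integers absv // residue_rel absv) = p ^ c"
    and absv_prime_element: "absv \<pi> = 1 / real (p ^ c)"
    and eps_0: "\<epsilon> 0 = 1"
    and eps_units: "k < c \<Longrightarrow> \<epsilon> k \<in> ring_of_integers absv - max_ideal absv"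
    and eps_independent:
      "\<And>a :: nat \<Rightarrow> int. (\<Sum>k<c. of_int (a k) * \<epsilon> k) \<in> max_ideal absv
         \<Longrightarrow> \<forall>k<c. int p dvd a k"
    and eps_span:
      "x \<in> ring_of_integers absv
         \<Longrightarrow> \<exists>a :: nat \<Rightarrow> int. x - (\<Sum>k<c. of_int (a k) * \<epsilon> k) \<in> max_ideal absv"

definition u_digit :: "nat \<Rightarrow> nat \<Rightarrow> 'a::field \<Rightarrow> (nat \<Rightarrow> 'a) \<Rightarrow> nat \<Rightarrow> 'a" where
  "u_digit p c \<pi> \<epsilon> n = (\<Sum>k<c. of_nat (n div p ^ k mod p) * \<epsilon> k) * inverse \<pi>"

text \<open>
  \<open>n div q ^ k mod q\<close> is the \<open>k\<close>-th base-\<open>q\<close> digit of \<open>n\<close>. It vanishes for \<open>k > n\<close>, and the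
  digit \<open>0\<close> contributes \<open>0\<close>, so summing over \<open>k \<le> n\<close> covers the whole expansion.
\<close>

definition u :: "nat \<Rightarrow> nat \<Rightarrow> 'a::field \<Rightarrow> (nat \<Rightarrow> 'a) \<Rightarrow> nat \<Rightarrow> 'a" where
  "u p c \<pi> \<epsilon> n =
     (\<Sum>k\<le>n. u_digit p c \<pi> \<epsilon> (n div (p ^ c) ^ k mod p ^ c) * inverse \<pi> ^ k)"

text \<open>
  \<open>\<mu>\<close> is the Haar measure of \<open>(K, +)\<close> on the Borel sets. Finiteness on compact sets and
  regularity follow from translation invariance and the normalisation, because \<open>K\<close> is a
  countable union of translates of its compact open ring of integers.
\<close>

locale wavelet_setting = local_field_basis absv p c \<pi> \<epsilon>
  for absv :: "'a::{field, metric_space} \<Rightarrow> real" and p c :: nat and \<pi> :: 'a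
    and \<epsilon> :: "nat \<Rightarrow> 'a" +
  fixes \<mu> :: "'a measure"
    and chi :: "'a \<Rightarrow> complex"
  assumes sets_haar: "sets \<mu> = sets borel"
    and haar_translate: "A \<in> sets borel \<Longrightarrow> emeasure \<mu> ((+) x ` A) = emeasure \<mu> A"
    and haar_normalised: "emeasure \<mu> (ring_of_integers absv) = 1"
    and char_continuous: "continuous_on UNIV chi"
    and char_unimodular: "cmod (chi x) = 1"
    and char_add: "chi (x + y) = chi x * chi y"
    and char_trivial: "x \<in> ring_of_integers absv \<Longrightarrow> chi x = 1"
    and char_nontrivial: "\<exists>x \<in> (*) (inverse \<pi>) ` ring_of_integers absv. chi x \<noteq> 1"
    and char_u: "chi (u p c \<pi> \<epsilon> k * u p c \<pi> \<epsilon> l) = 1"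


section \<open>Square-integrable functions and the Fourier transform\<close>

definition L2 :: "'a measure \<Rightarrow> ('a \<Rightarrow> complex) set" where
  "L2 \<mu> = {f. f \<in> borel_measurable \<mu> \<and> integrable \<mu> (\<lambda>x. (cmod (f x))\<^sup>2)}"

definition L2_inner :: "'a measure \<Rightarrow> ('a \<Rightarrow> complex) \<Rightarrow> ('a \<Rightarrow> complex) \<Rightarrow> complex" where
  "L2_inner \<mu> f g = (\<integral>x. f x * cnj (g x) \<partial>\<mu>)"

definition L2_norm :: "'a measure \<Rightarrow> ('a \<Rightarrow> complex) \<Rightarrow> real" where
  "L2_norm \<mu> f = sqrt (\<integral>x. (cmod (f x))\<^sup>2 \<partial>\<mu>)"

definition fourier_L1 ::
    "'a::field measure \<Rightarrow> ('a \<Rightarrow> complex) \<Rightarrow> ('a \<Rightarrow> complex) \<Rightarrow> 'a \<Rightarrow> complex" where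
  "fourier_L1 \<mu> chi f \<xi> = (\<integral>x. f x * cnj (chi (\<xi> * x)) \<partial>\<mu>)"

text \<open>
  \<open>g\<close> is a representative of the Fourier transform of \<open>f \<in> L\<^sup>2\<close>: the transform on
  \<open>L\<^sup>1 \<inter> L\<^sup>2\<close>, extended by continuity in the \<open>L\<^sup>2\<close> norm. Elements of \<open>L2\<close> are functions, not
  classes modulo null sets, so this is a relation.
\<close>

definition is_fourier_L2 ::
    "'a::field measure \<Rightarrow> ('a \<Rightarrow> complex) \<Rightarrow> ('a \<Rightarrow> complex) \<Rightarrow> ('a \<Rightarrow> complex) \<Rightarrow> bool" where
  "is_fourier_L2 \<mu> chi f g \<longleftrightarrow> f \<in> L2 \<mu> \<and> g \<in> L2 \<mu> \<and>
     (\<exists>F :: nat \<Rightarrow> 'a \<Rightarrow> complex.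
        (\<forall>m. integrable \<mu> (F m) \<and> F m \<in> L2 \<mu> \<and> fourier_L1 \<mu> chi (F m) \<in> L2 \<mu>) \<and>
        (\<lambda>m. L2_norm \<mu> (\<lambda>x. F m x - f x)) \<longlonglongrightarrow> 0 \<and>
        (\<lambda>m. L2_norm \<mu> (\<lambda>\<xi>. fourier_L1 \<mu> chi (F m) \<xi> - g \<xi>)) \<longlonglongrightarrow> 0)"


section \<open>Wavelets and super-wavelets\<close>

definition dilation ::
    "nat \<Rightarrow> nat \<Rightarrow> 'a::field \<Rightarrow> int \<Rightarrow> ('a \<Rightarrow> complex) \<Rightarrow> 'a \<Rightarrow> complex" where
  "dilation p c \<pi> j f x =
     complex_of_real (real (p ^ c) powr (real_of_int j / 2)) * f (\<pi> powi (- j) * x)"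

definition translation ::
    "nat \<Rightarrow> nat \<Rightarrow> 'a::field \<Rightarrow> (nat \<Rightarrow> 'a) \<Rightarrow> nat \<Rightarrow> ('a \<Rightarrow> complex) \<Rightarrow> 'a \<Rightarrow> complex" where
  "translation p c \<pi> \<epsilon> k f x = f (x - u p c \<pi> \<epsilon> k)"

definition parseval_frame_wavelet ::
    "nat \<Rightarrow> nat \<Rightarrow> 'a::field \<Rightarrow> (nat \<Rightarrow> 'a) \<Rightarrow> 'a measure \<Rightarrow> ('a \<Rightarrow> complex) \<Rightarrow> bool" where
  "parseval_frame_wavelet p c \<pi> \<epsilon> \<mu> \<eta> \<longleftrightarrow> \<eta> \<in> L2 \<mu> \<and>
     (\<forall>f \<in> L2 \<mu>.
        ((\<lambda>(j, k). (cmod (L2_inner \<mu> f (dilation p c \<pi> j (translation p c \<pi> \<epsilon> k \<eta>))))\<^sup>2)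
          has_sum (L2_norm \<mu> f)\<^sup>2) (UNIV :: (int \<times> nat) set))"

text \<open>
  Vectors of the \<open>n\<close>-fold direct sum of \<open>L\<^sup>2\<close> are families of functions indexed by
  \<open>{1..n}\<close>; components outside this range play no role.
\<close>

definition L2_sum :: "'a measure \<Rightarrow> nat \<Rightarrow> (nat \<Rightarrow> 'a \<Rightarrow> complex) set" where
  "L2_sum \<mu> n = {F. \<forall>i\<in>{1..n}. F i \<in> L2 \<mu>}"

definition L2_sum_inner ::
    "'a measure \<Rightarrow> nat \<Rightarrow> (nat \<Rightarrow> 'a \<Rightarrow> complex) \<Rightarrow> (nat \<Rightarrow> 'a \<Rightarrow> complex) \<Rightarrow> complex" where
  "L2_sum_inner \<mu> n F G = (\<Sum>i=1..n. L2_inner \<mu> (F i) (G i))"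

definition L2_sum_norm :: "'a measure \<Rightarrow> nat \<Rightarrow> (nat \<Rightarrow> 'a \<Rightarrow> complex) \<Rightarrow> real" where
  "L2_sum_norm \<mu> n F = sqrt (\<Sum>i=1..n. (L2_norm \<mu> (F i))\<^sup>2)"

definition orthonormal_basis_L2_sum ::
    "'a measure \<Rightarrow> nat \<Rightarrow> ('b \<Rightarrow> nat \<Rightarrow> 'a \<Rightarrow> complex) \<Rightarrow> bool" where
  "orthonormal_basis_L2_sum \<mu> n B \<longleftrightarrow>
     (\<forall>a. B a \<in> L2_sum \<mu> n) \<and>
     (\<forall>a b. L2_sum_inner \<mu> n (B a) (B b) = (if a = b then 1 else 0)) \<and>
     (\<forall>F \<in> L2_sum \<mu> n. \<forall>e>0. \<exists>A (z :: 'b \<Rightarrow> complex). finite A \<and>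
        L2_sum_norm \<mu> n (\<lambda>i x. F i x - (\<Sum>a\<in>A. z a * B a i x)) < e)"

definition super_wavelet ::
    "nat \<Rightarrow> nat \<Rightarrow> 'a::field \<Rightarrow> (nat \<Rightarrow> 'a) \<Rightarrow> 'a measure \<Rightarrow> nat \<Rightarrow> (nat \<Rightarrow> 'a \<Rightarrow> complex) \<Rightarrow> bool"
  where
  "super_wavelet p c \<pi> \<epsilon> \<mu> n \<eta> \<longleftrightarrow>
     (\<forall>i\<in>{1..n}. parseval_frame_wavelet p c \<pi> \<epsilon> \<mu> (\<eta> i)) \<and>
     orthonormal_basis_L2_sum \<mu> n
       (\<lambda>(j :: int, k :: nat) i. dilation p c \<pi> j (translation p c \<pi> \<epsilon> k (\<eta> i)))"


section \<open>Measurable partitions\<close>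

definition measurable_partition :: "'a measure \<Rightarrow> 'i set \<Rightarrow> ('i \<Rightarrow> 'a set) \<Rightarrow> 'a set \<Rightarrow> bool" where
  "measurable_partition \<mu> I A E \<longleftrightarrow> countable I \<and> E \<in> sets \<mu> \<and> (\<forall>i\<in>I. A i \<in> sets \<mu>) \<and>
     (\<forall>i\<in>I. \<forall>j\<in>I. i \<noteq> j \<longrightarrow> A i \<inter> A j \<in> null_sets \<mu>) \<and>
     ((\<Union>i\<in>I. A i) - E) \<union> (E - (\<Union>i\<in>I. A i)) \<in> null_sets \<mu>"

end

theory Submission
  imports Defs
begin

text \<open>
  Let \<open>g\<^sub>i\<close> be the Fourier transform of \<open>\<eta>\<^sub>i\<close>, of modulus \<open>1\<close> on \<open>W\<^sub>i\<close> and \<open>0\<close> elsewhere. The transform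
  of \<open>D\<^sup>j T\<^sup>k \<eta>\<^sub>i\<close> is the dilate by \<open>D\<^sup>-\<^sup>j\<close> of \<open>g\<^sub>i\<close> times the conjugate of \<open>\<xi> \<mapsto> \<chi>(u(k) \<xi>)\<close>. These
  characters are invariant under translation by every \<open>u(l)\<close>, and restricted to \<open>\<O>\<close> they are an
  orthonormal basis of \<open>L\<^sup>2(\<O>)\<close>. The coefficients of a family \<open>(h\<^sub>i)\<close> at one scale are therefore the
  Fourier coefficients on \<open>\<O>\<close> of the periodisation of \<open>\<Sum>\<^sub>i h\<^sub>i cnj(g\<^sub>i)\<close> over the \<open>u(l)\<close>. If the
  translates \<open>W\<^sub>i + u(k)\<close> are disjoint up to null sets, squaring the periodisation produces no cross
  terms, and the squared coefficients at that scale add up to \<open>\<Sum>\<^sub>i \<integral>\<^bsub>W\<^sub>i\<^esub> |h\<^sub>i|\<^sup>2\<close>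
  (\<open>parseval_single_scale\<close>). At scale \<open>j\<close> the sets \<open>W\<^sub>i\<close> are replaced by \<open>\<pi>\<^sup>-\<^sup>j W\<^sub>i\<close>.

  An orthonormal basis is the same as a system of unit vectors satisfying Parseval's identity
  (\<open>orthonormal_basis_iff_parseval\<close>). So being a super-wavelet means: Parseval's identity for each
  \<open>\<eta>\<^sub>i\<close> alone, Parseval's identity for the direct sum, and \<open>\<Sum>\<^sub>i \<mu>(W\<^sub>i) = 1\<close>. The first two are the same
  kind of statement, for the index sets \<open>{i}\<close> and \<open>{1..n}\<close>, and the lemmas are proved for any
  finite index set.

  If the tiling conditions hold, the masses \<open>\<integral> |h\<^sub>i|\<^sup>2\<close> over the \<open>\<pi>\<^sup>-\<^sup>j W\<^sub>i\<close> add up to the full norm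
  (\<open>tiling_imp_parseval\<close>). Conversely, Parseval's identity rules out overlaps of the translates: an
  overlap would support a family whose coefficients are too large for Bessel's inequality
  (\<open>overlap_in_integers_null\<close>). With the translates disjoint, the identity for indicators says that
  the dilates of \<open>W\<^sub>i\<close> tile (\<open>parseval_imp_scaled_tiling\<close>). Finally, disjoint translates cover the
  field exactly when they fill \<open>\<O>\<close>, that is, when \<open>\<Sum>\<^sub>i \<mu>(W\<^sub>i) = 1\<close> (\<open>translation_tiling_iff\<close>).

  All Fourier analysis is done on Schwartz--Bruhat functions, where the transform is elementary, and
  carried to \<open>L\<^sup>2\<close> by density (\<open>schwartz_dense\<close>, \<open>parseval_at_closure\<close>, \<open>parseval_transfer\<close>); the \<open>L\<^sup>2\<close>
  Fourier pairs \<open>(\<eta>\<^sub>i, g\<^sub>i)\<close> enter only through their pairings with such functions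
  (\<open>is_fourier_inner\<close>).
\<close>

section \<open>Finite families of square-integrable functions\<close>

lemma borel_measurable_cnj [measurable]:
  "f \<in> borel_measurable M \<Longrightarrow> (\<lambda>x. cnj (f x)) \<in> borel_measurable M"
  by (intro borel_measurable_continuous_on[where f = cnj] continuous_intros)

lemma borel_cmod_sq: "f \<in> borel_measurable M \<Longrightarrow> (\<lambda>x. (cmod (f x))\<^sup>2) \<in> borel_measurable M"
  by measurable

lemma L2_measurable: "f \<in> L2 M \<Longrightarrow> f \<in> borel_measurable M"
  by (simp add: L2_def)

lemma L2_integrable_sq: "f \<in> L2 M \<Longrightarrow> integrable M (\<lambda>x. (cmod (f x))\<^sup>2)"
  by (simp add: L2_def)

lemma L2_dominated:
  assumes "f \<in> L2 M" "g \<in> borel_measurable M" "\<And>x. cmod (g x) \<le> C * cmod (f x)"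
  shows "g \<in> L2 M"
proof -
  have "integrable M (\<lambda>x. C\<^sup>2 * (cmod (f x))\<^sup>2)"
    using L2_integrable_sq[OF assms(1)] by simp
  then have "integrable M (\<lambda>x. (cmod (g x))\<^sup>2)"
  proof (rule Bochner_Integration.integrable_bound)
    show "(\<lambda>x. (cmod (g x))\<^sup>2) \<in> borel_measurable M"
      using assms(2) by (rule borel_cmod_sq)
    have "(cmod (g x))\<^sup>2 \<le> (C * cmod (f x))\<^sup>2" for x
      using assms(3) by (intro power_mono) auto
    then show "AE x in M. norm ((cmod (g x))\<^sup>2) \<le> norm (C\<^sup>2 * (cmod (f x))\<^sup>2)"
      by (simp add: power_mult_distrib)
  qed
  then show ?thesis
    using assms(2) by (simp add: L2_def)
qed

lemma L2_mult_bounded: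
  assumes "f \<in> L2 M" "h \<in> borel_measurable M" "\<And>x. cmod (h x) \<le> C"
  shows "(\<lambda>x. h x * f x) \<in> L2 M"
  using L2_measurable[OF assms(1)] assms(2,3)
  by (intro L2_dominated[OF assms(1), where C = C]) (auto simp: norm_mult intro: mult_right_mono)

lemma L2_scale: "f \<in> L2 M \<Longrightarrow> (\<lambda>x. z * f x) \<in> L2 M"
  by (rule L2_mult_bounded[where C = "cmod z"]) auto

lemma L2_add:
  assumes "f \<in> L2 M" "g \<in> L2 M"
  shows "(\<lambda>x. f x + g x) \<in> L2 M"
proof -
  have m: "(\<lambda>x. f x + g x) \<in> borel_measurable M"
    using assms[THEN L2_measurable] by measurable
  have "integrable M (\<lambda>x. 2 * (cmod (f x))\<^sup>2 + 2 * (cmod (g x))\<^sup>2)"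
    using assms[THEN L2_integrable_sq] by simp
  then have "integrable M (\<lambda>x. (cmod (f x + g x))\<^sup>2)"
  proof (rule Bochner_Integration.integrable_bound)
    show "(\<lambda>x. (cmod (f x + g x))\<^sup>2) \<in> borel_measurable M"
      using m by (rule borel_cmod_sq)
    have "(cmod (f x + g x))\<^sup>2 \<le> (cmod (f x) + cmod (g x))\<^sup>2" for x
      by (intro power_mono norm_triangle_ineq) auto
    also have "\<dots>x \<le> 2 * (cmod (f x))\<^sup>2 + 2 * (cmod (g x))\<^sup>2" for x
      using zero_le_power2[of "cmod (f x) - cmod (g x)"]
      by (simp add: power2_sum power2_diff)
    finally show "AE x in M. norm ((cmod (f x + g x))\<^sup>2)
        \<le> norm (2 * (cmod (f x))\<^sup>2 + 2 * (cmod (g x))\<^sup>2)"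
      by simp
  qed
  then show ?thesis
    using m by (simp add: L2_def)
qed

lemma L2_zero: "(\<lambda>x. 0) \<in> L2 M"
  by (simp add: L2_def)

lemma L2_diff: "f \<in> L2 M \<Longrightarrow> g \<in> L2 M \<Longrightarrow> (\<lambda>x. f x - g x) \<in> L2 M"
  using L2_add[OF _ L2_scale[of g M "-1"]] by simp

lemma L2_sum_fun: "(\<And>a. a \<in> A \<Longrightarrow> f a \<in> L2 M) \<Longrightarrow> (\<lambda>x. \<Sum>a\<in>A. f a x) \<in> L2 M"
  by (induction A rule: infinite_finite_induct) (auto intro: L2_zero L2_add)

lemma L2_cnj: "f \<in> L2 M \<Longrightarrow> (\<lambda>x. cnj (f x)) \<in> L2 M"
proof (rule L2_dominated[where C = 1])
  assume "f \<in> L2 M"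
  from L2_measurable[OF this] show "(\<lambda>x. cnj (f x)) \<in> borel_measurable M"
    by (rule borel_measurable_cnj)
qed auto

lemma L2_integrable_mult:
  assumes "f \<in> L2 M" "g \<in> L2 M"
  shows "integrable M (\<lambda>x. f x * g x)"
proof -
  have "integrable M (\<lambda>x. (cmod (f x))\<^sup>2 + (cmod (g x))\<^sup>2)"
    using assms[THEN L2_integrable_sq] by simp
  then show ?thesis
  proof (rule Bochner_Integration.integrable_bound)
    show "(\<lambda>x. f x * g x) \<in> borel_measurable M"
      using assms[THEN L2_measurable] by measurable
    have "cmod (f x) * cmod (g x) \<le> (cmod (f x))\<^sup>2 + (cmod (g x))\<^sup>2" for x
      using sum_squares_bound[of "cmod (f x)" "cmod (g x)"]
        mult_nonneg_nonneg[OF norm_ge_zero[of "f x"] norm_ge_zero[of "g x"]] by linarith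
    then show "AE x in M. norm (f x * g x) \<le> norm ((cmod (f x))\<^sup>2 + (cmod (g x))\<^sup>2)"
      by (simp add: norm_mult)
  qed
qed

lemma L2_integrable_inner:
  "f \<in> L2 M \<Longrightarrow> g \<in> L2 M \<Longrightarrow> integrable M (\<lambda>x. f x * cnj (g x))"
  by (intro L2_integrable_mult L2_cnj)

lemma L2_norm_sq: "(L2_norm M f)\<^sup>2 = (\<integral>x. (cmod (f x))\<^sup>2 \<partial>M)"
  by (simp add: L2_norm_def)

lemma L2_norm_nonneg: "0 \<le> L2_norm M f"
  by (simp add: L2_norm_def)

lemma L2_inner_self: "L2_inner M f f = of_real ((L2_norm M f)\<^sup>2)"
  unfolding L2_inner_def L2_norm_sq
  by (subst integral_complex_of_real[symmetric]) (simp add: complex_norm_square[symmetric])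

lemma L2_inner_commute: "L2_inner M g f = cnj (L2_inner M f g)"
  unfolding L2_inner_def by (simp add: mult.commute flip: Bochner_Integration.integral_cnj)

lemma L2_inner_diff_left:
  "f \<in> L2 M \<Longrightarrow> g \<in> L2 M \<Longrightarrow> h \<in> L2 M \<Longrightarrow>
     L2_inner M (\<lambda>x. f x - g x) h = L2_inner M f h - L2_inner M g h"
  unfolding L2_inner_def
  by (simp add: left_diff_distrib Bochner_Integration.integral_diff L2_integrable_inner)

lemma L2_inner_scale_left: "L2_inner M (\<lambda>x. z * f x) h = z * L2_inner M f h"
  unfolding L2_inner_def by (simp add: mult.assoc)

lemma L2_inner_sum_left:
  assumes "\<And>a. a \<in> A \<Longrightarrow> f a \<in> L2 M" "h \<in> L2 M"
  shows "L2_inner M (\<lambda>x. \<Sum>a\<in>A. f a x) h = (\<Sum>a\<in>A. L2_inner M (f a) h)"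
  unfolding L2_inner_def
  by (simp add: sum_distrib_right Bochner_Integration.integral_sum L2_integrable_inner assms)

text \<open>
  The direct sum of copies of \<open>L\<^sup>2\<close> over an arbitrary finite index set \<open>I\<close>. A singleton \<open>I\<close>
  describes one wavelet, \<open>{1..n}\<close> the super-wavelet, so one argument serves both.
\<close>

definition L2_family :: "'i set \<Rightarrow> 'a measure \<Rightarrow> ('i \<Rightarrow> 'a \<Rightarrow> complex) set" where
  "L2_family I M = {F. \<forall>i\<in>I. F i \<in> L2 M}"

definition family_inner ::
    "'i set \<Rightarrow> 'a measure \<Rightarrow> ('i \<Rightarrow> 'a \<Rightarrow> complex) \<Rightarrow> ('i \<Rightarrow> 'a \<Rightarrow> complex) \<Rightarrow> complex" where
  "family_inner I M F G = (\<Sum>i\<in>I. L2_inner M (F i) (G i))"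

definition family_norm :: "'i set \<Rightarrow> 'a measure \<Rightarrow> ('i \<Rightarrow> 'a \<Rightarrow> complex) \<Rightarrow> real" where
  "family_norm I M F = sqrt (\<Sum>i\<in>I. (L2_norm M (F i))\<^sup>2)"

lemma family_norm_nonneg: "0 \<le> family_norm I M F"
  by (simp add: family_norm_def sum_nonneg)

lemma family_norm_sq: "(family_norm I M F)\<^sup>2 = (\<Sum>i\<in>I. (L2_norm M (F i))\<^sup>2)"
  by (simp add: family_norm_def sum_nonneg)

lemma family_inner_self: "family_inner I M F F = of_real ((family_norm I M F)\<^sup>2)"
  by (simp add: family_inner_def family_norm_sq L2_inner_self)

lemma family_inner_commute: "family_inner I M G F = cnj (family_inner I M F G)"
  unfolding family_inner_def by (subst L2_inner_commute) simp

lemma L2_family_diff: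
  "F \<in> L2_family I M \<Longrightarrow> G \<in> L2_family I M \<Longrightarrow> (\<lambda>i x. F i x - G i x) \<in> L2_family I M"
  by (auto simp: L2_family_def intro: L2_diff)

lemma L2_family_scale: "F \<in> L2_family I M \<Longrightarrow> (\<lambda>i x. z * F i x) \<in> L2_family I M"
  by (auto simp: L2_family_def intro: L2_scale)

lemma L2_family_sum:
  "(\<And>a. a \<in> A \<Longrightarrow> F a \<in> L2_family I M) \<Longrightarrow> (\<lambda>i x. \<Sum>a\<in>A. F a i x) \<in> L2_family I M"
  by (auto simp: L2_family_def intro: L2_sum_fun)

lemma family_inner_diff_left:
  "F \<in> L2_family I M \<Longrightarrow> G \<in> L2_family I M \<Longrightarrow> H \<in> L2_family I M \<Longrightarrow>
     family_inner I M (\<lambda>i x. F i x - G i x) H = family_inner I M F H - family_inner I M G H"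
  by (simp add: family_inner_def L2_family_def L2_inner_diff_left sum_subtractf)

lemma family_inner_scale_left:
  "family_inner I M (\<lambda>i x. z * F i x) H = z * family_inner I M F H"
  by (simp add: family_inner_def L2_inner_scale_left sum_distrib_left)

lemma family_inner_sum_left:
  assumes "\<And>a. a \<in> A \<Longrightarrow> F a \<in> L2_family I M" "H \<in> L2_family I M"
  shows "family_inner I M (\<lambda>i x. \<Sum>a\<in>A. F a i x) H = (\<Sum>a\<in>A. family_inner I M (F a) H)"
proof -
  have "family_inner I M (\<lambda>i x. \<Sum>a\<in>A. F a i x) H
      = (\<Sum>i\<in>I. \<Sum>a\<in>A. L2_inner M (F a i) (H i))"
    unfolding family_inner_def using assms
    by (intro sum.cong refl L2_inner_sum_left) (auto simp: L2_family_def)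
  then show ?thesis
    unfolding family_inner_def by (simp add: sum.swap[of _ A])
qed

lemma family_norm_diff_sq:
  assumes "F \<in> L2_family I M" "G \<in> L2_family I M"
  shows "(family_norm I M (\<lambda>i x. F i x - G i x))\<^sup>2
    = (family_norm I M F)\<^sup>2 - 2 * Re (family_inner I M F G) + (family_norm I M G)\<^sup>2"
proof -
  let ?D = "\<lambda>i x. F i x - G i x"
  have D: "?D \<in> L2_family I M"
    using assms by (rule L2_family_diff)
  have "complex_of_real ((family_norm I M ?D)\<^sup>2) = family_inner I M ?D ?D"
    by (simp add: family_inner_self)
  also have "\<dots> = family_inner I M F ?D - family_inner I M G ?D"
    using assms D by (intro family_inner_diff_left)
  also have "\<dots> = cnj (family_inner I M ?D F) - cnj (family_inner I M ?D G)"
    by (simp add: family_inner_commute[of I M F] family_inner_commute[of I M G])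
  also have "\<dots> = cnj (family_inner I M F F - family_inner I M G F)
      - cnj (family_inner I M F G - family_inner I M G G)"
    using assms by (simp add: family_inner_diff_left)
  also have "\<dots> = of_real ((family_norm I M F)\<^sup>2 + (family_norm I M G)\<^sup>2)
      - (family_inner I M F G + cnj (family_inner I M F G))"
    by (simp add: family_inner_self family_inner_commute[of I M G F])
  also have "family_inner I M F G + cnj (family_inner I M F G)
      = of_real (2 * Re (family_inner I M F G))"
    by (simp add: complex_add_cnj)
  finally have "complex_of_real ((family_norm I M ?D)\<^sup>2) = of_real ((family_norm I M F)\<^sup>2
      + (family_norm I M G)\<^sup>2 - 2 * Re (family_inner I M F G))"
    by simp
  then show ?thesis
    unfolding of_real_eq_iff by simp
qed

lemma family_norm_scale_sq:
  "(family_norm I M (\<lambda>i x. z * F i x))\<^sup>2 = (cmod z)\<^sup>2 * (family_norm I M F)\<^sup>2"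
proof -
  have "complex_of_real ((family_norm I M (\<lambda>i x. z * F i x))\<^sup>2)
      = z * cnj z * of_real ((family_norm I M F)\<^sup>2)"
    unfolding family_inner_self[symmetric] family_inner_scale_left
    by (subst family_inner_commute) (simp add: family_inner_scale_left family_inner_self)
  also have "\<dots> = of_real ((cmod z)\<^sup>2 * (family_norm I M F)\<^sup>2)"
    by (simp add: complex_norm_square[symmetric])
  finally show ?thesis
    unfolding of_real_eq_iff .
qed

lemma family_norm_diff_commute:
  "family_norm I M (\<lambda>i x. F i x - G i x) = family_norm I M (\<lambda>i x. G i x - F i x)"
  by (simp add: family_norm_def L2_norm_def norm_minus_commute)

lemma family_Cauchy_Schwarz:
  assumes "F \<in> L2_family I M" "G \<in> L2_family I M"
  shows "cmod (family_inner I M F G) \<le> family_norm I M F * family_norm I M G"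
proof -
  let ?c = "family_inner I M F G" and ?f = "family_norm I M F" and ?g = "family_norm I M G"
  have pos: "0 \<le> ?f\<^sup>2 - 2 * t * (cmod ?c)\<^sup>2 + t\<^sup>2 * (cmod ?c)\<^sup>2 * ?g\<^sup>2" for t :: real
  proof -
    let ?z = "of_real t * ?c"
    have "family_inner I M F (\<lambda>i x. ?z * G i x) = cnj ?z * ?c"
      by (subst family_inner_commute) (simp add: family_inner_scale_left family_inner_commute[of I M G F])
    also have "\<dots> = of_real (t * (cmod ?c)\<^sup>2)"
      using complex_norm_square[of ?c] by (simp add: mult_ac)
    finally have "Re (family_inner I M F (\<lambda>i x. ?z * G i x)) = t * (cmod ?c)\<^sup>2"
      by simp
    then have "(family_norm I M (\<lambda>i x. F i x - ?z * G i x))\<^sup>2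
        = ?f\<^sup>2 - 2 * (t * (cmod ?c)\<^sup>2) + (cmod ?z)\<^sup>2 * ?g\<^sup>2"
      using family_norm_diff_sq[OF assms(1) L2_family_scale[OF assms(2), of ?z]]
        family_norm_scale_sq[of I M ?z G] by simp
    then show ?thesis
      using zero_le_power2[of "family_norm I M (\<lambda>i x. F i x - ?z * G i x)"]
      by (simp add: norm_mult power_mult_distrib mult_ac)
  qed
  have "(cmod ?c)\<^sup>2 \<le> (?f * ?g)\<^sup>2"
  proof (cases "?g = 0")
    case True
    show ?thesis
    proof (rule ccontr)
      assume "\<not> ?thesis"
      then have "cmod ?c > 0"
        using True by auto
      then show False
        using pos[of "(?f\<^sup>2 + 1) / (cmod ?c)\<^sup>2"] True zero_le_power2[of ?f] by simp
    qed
  next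
    case False
    then have "0 < ?g\<^sup>2"
      by simp
    then have "0 \<le> ?f\<^sup>2 - (cmod ?c)\<^sup>2 / ?g\<^sup>2"
    proof -
      have "(1 / ?g\<^sup>2)\<^sup>2 * (cmod ?c)\<^sup>2 * ?g\<^sup>2 = (cmod ?c)\<^sup>2 / ?g\<^sup>2"
        using False by (simp add: power_divide field_simps)
      then show ?thesis
        using pos[of "1 / ?g\<^sup>2"] by (simp add: mult.commute)
    qed
    then show ?thesis
      using \<open>0 < ?g\<^sup>2\<close> by (simp add: field_simps power_mult_distrib)
  qed
  then show ?thesis
    by (rule power2_le_imp_le) (simp add: family_norm_nonneg)
qed

lemma family_norm_triangle_diff:
  assumes "F \<in> L2_family I M" "G \<in> L2_family I M"
  shows "family_norm I M (\<lambda>i x. F i x - G i x) \<le> family_norm I M F + family_norm I M G"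
proof (rule power2_le_imp_le)
  have "- Re (family_inner I M F G) \<le> family_norm I M F * family_norm I M G"
    using family_Cauchy_Schwarz[OF assms] abs_Re_le_cmod[of "family_inner I M F G"] by linarith
  then show "(family_norm I M (\<lambda>i x. F i x - G i x))\<^sup>2 \<le> (family_norm I M F + family_norm I M G)\<^sup>2"
    using family_norm_diff_sq[OF assms] by (simp add: power2_sum)
qed (simp add: family_norm_nonneg)

lemma family_norm_triangle:
  assumes "F \<in> L2_family I M" "G \<in> L2_family I M"
  shows "family_norm I M F \<le> family_norm I M (\<lambda>i x. F i x - G i x) + family_norm I M G"
proof -
  let ?G = "\<lambda>i x. - 1 * G i x"
  have "family_norm I M ?G = family_norm I M G"
    by (simp add: family_norm_def L2_norm_def)
  then show ?thesis
    using family_norm_triangle_diff[OF L2_family_diff[OF assms] L2_family_scale[OF assms(2), of "-1"]]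
    by simp
qed

definition parseval_at ::
    "'i set \<Rightarrow> 'a measure \<Rightarrow> ('b \<Rightarrow> 'i \<Rightarrow> 'a \<Rightarrow> complex) \<Rightarrow> ('i \<Rightarrow> 'a \<Rightarrow> complex) \<Rightarrow> bool" where
  "parseval_at I M B F \<longleftrightarrow>
     ((\<lambda>a. (cmod (family_inner I M F (B a)))\<^sup>2) has_sum (family_norm I M F)\<^sup>2) UNIV"

lemma parseval_atI:
  assumes "\<And>A. finite A \<Longrightarrow> (\<Sum>a\<in>A. (cmod (family_inner I M F (B a)))\<^sup>2) \<le> (family_norm I M F)\<^sup>2"
    "\<And>l. l < (family_norm I M F)\<^sup>2 \<Longrightarrow>
      \<exists>A. finite A \<and> l < (\<Sum>a\<in>A. (cmod (family_inner I M F (B a)))\<^sup>2)"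
  shows "parseval_at I M B F"
  unfolding parseval_at_def has_sum_def
proof (rule order_tendstoI)
  fix l assume "l < (family_norm I M F)\<^sup>2"
  then obtain A where A: "finite A" "l < (\<Sum>a\<in>A. (cmod (family_inner I M F (B a)))\<^sup>2)"
    using assms(2) by blast
  then show "\<forall>\<^sub>F A in finite_subsets_at_top UNIV. l < (\<Sum>a\<in>A. (cmod (family_inner I M F (B a)))\<^sup>2)"
    unfolding eventually_finite_subsets_at_top
    by (intro exI[of _ A]) (auto intro!: less_le_trans[OF A(2)] sum_mono2)
next
  fix l assume "(family_norm I M F)\<^sup>2 < l"
  then show "\<forall>\<^sub>F A in finite_subsets_at_top UNIV. (\<Sum>a\<in>A. (cmod (family_inner I M F (B a)))\<^sup>2) < l"
    unfolding eventually_finite_subsets_at_top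
    by (intro exI[of _ "{}"]) (auto intro: le_less_trans[OF assms(1)])
qed

lemma parseval_at_lower:
  assumes "parseval_at I M B F" "l < (family_norm I M F)\<^sup>2"
  obtains A where "finite A" "l < (\<Sum>a\<in>A. (cmod (family_inner I M F (B a)))\<^sup>2)"
proof -
  have "\<forall>\<^sub>F A in finite_subsets_at_top UNIV. l < (\<Sum>a\<in>A. (cmod (family_inner I M F (B a)))\<^sup>2)"
    using assms unfolding parseval_at_def has_sum_def by (intro order_tendstoD(1))
  then show ?thesis
    using that by (auto simp: eventually_finite_subsets_at_top)
qed

lemma parseval_at_Bessel:
  assumes "parseval_at I M B F" "finite A"
  shows "L2_set (\<lambda>a. cmod (family_inner I M F (B a))) A \<le> family_norm I M F"
proof -
  have "(\<Sum>a\<in>A. (cmod (family_inner I M F (B a)))\<^sup>2) \<le> (family_norm I M F)\<^sup>2"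
    using assms unfolding parseval_at_def by (intro finite_sum_le_has_sum) auto
  then show ?thesis
    unfolding L2_set_def by (intro real_le_lsqrt) (auto simp: family_norm_nonneg)
qed

lemma L2_set_cmod_triangle:
  "L2_set (\<lambda>a. cmod (f a)) A \<le> L2_set (\<lambda>a. cmod (f a - g a)) A + L2_set (\<lambda>a. cmod (g a)) A"
proof -
  have "L2_set (\<lambda>a. cmod (f a)) A \<le> L2_set (\<lambda>a. cmod (f a - g a) + cmod (g a)) A"
    by (intro L2_set_mono) (use norm_triangle_sub in \<open>auto simp: add.commute\<close>)
  also have "\<dots> \<le> L2_set (\<lambda>a. cmod (f a - g a)) A + L2_set (\<lambda>a. cmod (g a)) A"
    by (rule L2_set_triangle_ineq)
  finally show ?thesis .
qed

text \<open>
  The analysis map \<open>F \<mapsto> (\<langle>F, B a\<rangle>)\<^sub>a\<close> is isometric on \<open>D\<close>, hence of norm at most one on its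
  closure by Bessel's inequality, and a continuous map that is isometric on \<open>D\<close> is isometric on the
  closure. This lets Parseval's identity be checked on locally constant functions only.
\<close>

lemma parseval_at_closure:
  fixes B :: "'b \<Rightarrow> 'i \<Rightarrow> 'a \<Rightarrow> complex"
  assumes D: "D \<subseteq> L2_family I M" "\<And>F G. F \<in> D \<Longrightarrow> G \<in> D \<Longrightarrow> (\<lambda>i x. F i x - G i x) \<in> D"
    and B: "\<And>a. B a \<in> L2_family I M"
    and parseval: "\<And>F. F \<in> D \<Longrightarrow> parseval_at I M B F"
    and F: "F \<in> L2_family I M"
    and approx: "\<And>e. e > 0 \<Longrightarrow> \<exists>G\<in>D. family_norm I M (\<lambda>i x. F i x - G i x) < e"
  shows "parseval_at I M B F"
proof -
  define \<alpha> where "\<alpha> H a = cmod (family_inner I M H (B a))" for H a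
  \<comment> \<open>Bessel's inequality for everything that can be approximated from \<open>D\<close>\<close>
  have bessel: "L2_set (\<alpha> H) A \<le> family_norm I M H"
    if fin: "finite A" and H: "H \<in> L2_family I M"
      and app: "\<And>e. e > 0 \<Longrightarrow> \<exists>G\<in>D. family_norm I M (\<lambda>i x. H i x - G i x) < e" for A H
  proof (rule field_le_epsilon)
    fix e :: real assume "e > 0"
    define b where "b = L2_set (\<lambda>a. family_norm I M (B a)) A"
    have b: "b \<ge> 0"
      by (simp add: b_def)
    define d where "d = e / (b + 1)"
    have d: "d > 0" "d * b + d = e"
      using \<open>e > 0\<close> b by (simp_all add: d_def add_divide_distrib[symmetric]
          nonzero_divide_eq_eq distrib_left mult.commute add_nonneg_eq_0_iff)
    obtain G where G: "G \<in> D" "family_norm I M (\<lambda>i x. H i x - G i x) < d"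
      using app[OF d(1)] by blast
    have GL: "G \<in> L2_family I M"
      using G D by blast
    let ?K = "\<lambda>i x. H i x - G i x"
    have KL: "?K \<in> L2_family I M"
      using H GL by (rule L2_family_diff)
    have "L2_set (\<alpha> H) A \<le> L2_set (\<lambda>a. cmod (family_inner I M H (B a) - family_inner I M G (B a))) A
        + L2_set (\<alpha> G) A"
      unfolding \<alpha>_def by (rule L2_set_cmod_triangle)
    also have "L2_set (\<lambda>a. cmod (family_inner I M H (B a) - family_inner I M G (B a))) A
        \<le> L2_set (\<lambda>a. d * family_norm I M (B a)) A"
    proof (rule L2_set_mono)
      fix a
      have "cmod (family_inner I M H (B a) - family_inner I M G (B a))
          = cmod (family_inner I M ?K (B a))"
        using H GL B by (simp add: family_inner_diff_left)
      also have "\<dots> \<le> family_norm I M ?K * family_norm I M (B a)"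
        by (intro family_Cauchy_Schwarz KL B)
      also have "\<dots> \<le> d * family_norm I M (B a)"
        using G(2) by (intro mult_right_mono) (auto simp: family_norm_nonneg)
      finally show "cmod (family_inner I M H (B a) - family_inner I M G (B a))
          \<le> d * family_norm I M (B a)" .
    qed auto
    also have "\<dots> = d * b"
      unfolding b_def using d by (intro L2_set_right_distrib[symmetric]) auto
    also have "L2_set (\<alpha> G) A \<le> family_norm I M G"
      unfolding \<alpha>_def using parseval[OF G(1)] fin by (rule parseval_at_Bessel)
    also have "family_norm I M G \<le> family_norm I M H + d"
      using family_norm_triangle[OF GL H] G(2)
      by (simp add: family_norm_diff_commute[of I M G H])
    finally show "L2_set (\<alpha> H) A \<le> family_norm I M H + e"
      using d by simp
  qed
  let ?N = "family_norm I M F"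
  have upper: "(\<Sum>a\<in>A. (\<alpha> F a)\<^sup>2) \<le> ?N\<^sup>2" if "finite A" for A
    using bessel[OF that F approx] unfolding L2_set_def
    by (simp add: family_norm_nonneg sqrt_le_D)
  have "\<exists>A. finite A \<and> l < sum (\<lambda>a. (\<alpha> F a)\<^sup>2) A" if l: "l < ?N\<^sup>2" for l
  proof (cases "?N = 0")
    case True
    then show ?thesis
      using l by (intro exI[of _ "{}"]) auto
  next
    case False
    then have pos: "?N > 0"
      using family_norm_nonneg[of I M F] by simp
    define l' where "l' = sqrt (max l 0)"
    have l': "l' < ?N"
      unfolding l'_def using l pos by (intro real_less_lsqrt) auto
    define d where "d = (?N - l') / 4"
    have d: "d > 0" "l' + 4 * d = ?N"
      using l' by (simp_all add: d_def field_simps)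
    obtain G where G: "G \<in> D" "family_norm I M (\<lambda>i x. F i x - G i x) < d"
      using approx[OF d(1)] by blast
    have GL: "G \<in> L2_family I M"
      using G D by blast
    have NG: "?N \<le> d + family_norm I M G"
      using family_norm_triangle[OF F GL] G(2) by linarith
    have "l' \<ge> 0"
      by (simp add: l'_def)
    then have "(family_norm I M G - d)\<^sup>2 < (family_norm I M G)\<^sup>2"
      using d NG by (intro power_strict_mono) auto
    then obtain A where A: "finite A" "(family_norm I M G - d)\<^sup>2 < sum (\<lambda>a. (\<alpha> G a)\<^sup>2) A"
      unfolding \<alpha>_def by (rule parseval_at_lower[OF parseval[OF G(1)]])
    have "family_norm I M G - d < L2_set (\<alpha> G) A"
      unfolding L2_set_def using A(2) by (rule real_less_rsqrt)
    also have "L2_set (\<alpha> G) A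
        \<le> L2_set (\<lambda>a. cmod (family_inner I M G (B a) - family_inner I M F (B a))) A + L2_set (\<alpha> F) A"
      unfolding \<alpha>_def by (rule L2_set_cmod_triangle)
    also have "L2_set (\<lambda>a. cmod (family_inner I M G (B a) - family_inner I M F (B a))) A
        = L2_set (\<alpha> (\<lambda>i x. F i x - G i x)) A"
      unfolding \<alpha>_def using F GL B
      by (intro L2_set_cong) (auto simp: family_inner_diff_left norm_minus_commute)
    also have "\<dots> \<le> family_norm I M (\<lambda>i x. F i x - G i x)"
    proof (rule bessel[OF A(1)])
      show "(\<lambda>i x. F i x - G i x) \<in> L2_family I M"
        using F GL by (rule L2_family_diff)
      fix e :: real assume "e > 0"
      then obtain G' where G': "G' \<in> D" "family_norm I M (\<lambda>i x. F i x - G' i x) < e"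
        using approx by blast
      show "\<exists>K\<in>D. family_norm I M (\<lambda>i x. F i x - G i x - K i x) < e"
        using G' D(2)[OF G'(1) G(1)] by (intro bexI[of _ "\<lambda>i x. G' i x - G i x"]) auto
    qed
    finally have "l' < L2_set (\<alpha> F) A"
      using G(2) NG d by linarith
    then have "l'\<^sup>2 < (L2_set (\<alpha> F) A)\<^sup>2"
      using \<open>l' \<ge> 0\<close> by (intro power_strict_mono) auto
    then have "l < sum (\<lambda>a. (\<alpha> F a)\<^sup>2) A"
      by (auto simp: l'_def L2_set_def sum_nonneg split: if_splits)
    then show ?thesis
      using A(1) by blast
  qed
  then show ?thesis
    using upper unfolding \<alpha>_def by (intro parseval_atI)
qed

lemma family_inner_sum_right:
  assumes "\<And>a. a \<in> A \<Longrightarrow> B a \<in> L2_family I M" "F \<in> L2_family I M"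
  shows "family_inner I M F (\<lambda>i x. \<Sum>a\<in>A. z a * B a i x)
    = (\<Sum>a\<in>A. cnj (z a) * family_inner I M F (B a))"
proof -
  have "family_inner I M (\<lambda>i x. \<Sum>a\<in>A. z a * B a i x) F
      = (\<Sum>a\<in>A. z a * family_inner I M (B a) F)"
    using assms by (subst family_inner_sum_left) (auto intro: L2_family_scale simp: family_inner_scale_left)
  then show ?thesis
    by (subst family_inner_commute) (simp add: family_inner_commute[of I M _ F])
qed

text \<open>
  The last sum vanishes for \<open>z a = \<langle>F, B a\<rangle>\<close>, so these coefficients are the best ones. One identity
  thus yields both Bessel's inequality and, when the span is dense, Parseval's.
\<close>

lemma family_norm_orthonormal_expansion:
  assumes fin: "finite A" and B: "\<And>a. B a \<in> L2_family I M" and F: "F \<in> L2_family I M"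
    and on: "\<And>a b. family_inner I M (B a) (B b) = (if a = b then 1 else 0)"
  shows "(family_norm I M (\<lambda>i x. F i x - (\<Sum>a\<in>A. z a * B a i x)))\<^sup>2
    = (family_norm I M F)\<^sup>2 - (\<Sum>a\<in>A. (cmod (family_inner I M F (B a)))\<^sup>2)
      + (\<Sum>a\<in>A. (cmod (z a - family_inner I M F (B a)))\<^sup>2)"
proof -
  let ?G = "\<lambda>i x. \<Sum>a\<in>A. z a * B a i x"
  let ?c = "\<lambda>a. family_inner I M F (B a)"
  have G: "?G \<in> L2_family I M"
    using B by (intro L2_family_sum L2_family_scale)
  have "family_inner I M ?G ?G = (\<Sum>a\<in>A. cnj (z a) * family_inner I M ?G (B a))"
    using B G by (intro family_inner_sum_right)
  also have "\<dots> = (\<Sum>a\<in>A. cnj (z a) * (\<Sum>b\<in>A. z b * family_inner I M (B b) (B a)))"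
    using B by (subst family_inner_sum_left) (auto intro: L2_family_scale simp: family_inner_scale_left)
  also have "\<dots> = (\<Sum>a\<in>A. cnj (z a) * z a)"
    using fin by (simp add: on if_distrib sum.delta cong: if_cong)
  also have "\<dots> = of_real (\<Sum>a\<in>A. (cmod (z a))\<^sup>2)"
    using complex_norm_square by (simp add: mult.commute)
  finally have GG: "(family_norm I M ?G)\<^sup>2 = (\<Sum>a\<in>A. (cmod (z a))\<^sup>2)"
    unfolding family_inner_self of_real_eq_iff .
  have FG: "family_inner I M F ?G = (\<Sum>a\<in>A. cnj (z a) * ?c a)"
    using B F by (intro family_inner_sum_right)
  have "(cmod (z a - ?c a))\<^sup>2 = (cmod (z a))\<^sup>2 - 2 * Re (cnj (z a) * ?c a) + (cmod (?c a))\<^sup>2" for a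
    unfolding cmod_power2 by (simp add: power2_eq_square algebra_simps)
  then have "(\<Sum>a\<in>A. (cmod (z a - ?c a))\<^sup>2)
      = (\<Sum>a\<in>A. (cmod (z a))\<^sup>2) - 2 * Re (family_inner I M F ?G) + (\<Sum>a\<in>A. (cmod (?c a))\<^sup>2)"
    unfolding FG by (simp add: sum.distrib sum_subtractf sum_distrib_left)
  then show ?thesis
    using family_norm_diff_sq[OF F G] GG by simp
qed

text \<open>
  Unit vectors that satisfy Parseval's identity are orthogonal: applied to \<open>B a\<close>, the identity
  already spends the whole of \<open>1\<close> on the term of index \<open>a\<close>.
\<close>

lemma orthonormal_basis_iff_parseval:
  assumes B: "\<And>a. B a \<in> L2_family {1..n} M"
  shows "orthonormal_basis_L2_sum M n B \<longleftrightarrow>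
    (\<forall>a. family_norm {1..n} M (B a) = 1) \<and> (\<forall>F\<in>L2_family {1..n} M. parseval_at {1..n} M B F)"
    (is "_ = (?norm \<and> ?pars)")
proof
  let ?I = "{1..n}"
  have conv: "L2_sum M n = L2_family ?I M" "L2_sum_inner M n = family_inner ?I M"
      "L2_sum_norm M n = family_norm ?I M"
    by (auto simp: fun_eq_iff L2_sum_def L2_family_def L2_sum_inner_def family_inner_def
        L2_sum_norm_def family_norm_def)
  {
    assume "orthonormal_basis_L2_sum M n B"
    then have on: "\<And>a b. family_inner ?I M (B a) (B b) = (if a = b then 1 else 0)"
      and dense: "\<And>F e. F \<in> L2_family ?I M \<Longrightarrow> e > 0 \<Longrightarrow>
        \<exists>A z. finite A \<and> family_norm ?I M (\<lambda>i x. F i x - (\<Sum>a\<in>A. z a * B a i x)) < e"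
      by (auto simp: orthonormal_basis_L2_sum_def conv)
    have ?norm
    proof
      fix a
      have "complex_of_real ((family_norm ?I M (B a))\<^sup>2) = 1"
        unfolding family_inner_self[symmetric] using on[of a a] by simp
      then have "(family_norm ?I M (B a))\<^sup>2 = 1\<^sup>2"
        unfolding of_real_eq_1_iff by simp
      then show "family_norm ?I M (B a) = 1"
        by (rule power2_eq_imp_eq) (auto simp: family_norm_nonneg)
    qed
    moreover have ?pars
    proof
      fix F assume F: "F \<in> L2_family ?I M"
      let ?c = "\<lambda>a. family_inner ?I M F (B a)"
      note expand = family_norm_orthonormal_expansion[OF _ B F on]
      have upper: "(\<Sum>a\<in>A. (cmod (?c a))\<^sup>2) \<le> (family_norm ?I M F)\<^sup>2" if "finite A" for A
        using expand[OF that, of ?c]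
          zero_le_power2[of "family_norm ?I M (\<lambda>i x. F i x - (\<Sum>a\<in>A. ?c a * B a i x))"]
        by simp
      have lower: "\<exists>A. finite A \<and> l < (\<Sum>a\<in>A. (cmod (?c a))\<^sup>2)" if l: "l < (family_norm ?I M F)\<^sup>2" for l
      proof -
        define e where "e = sqrt ((family_norm ?I M F)\<^sup>2 - l)"
        have "e > 0"
          using l by (simp add: e_def)
        then obtain A z where A: "finite A"
            "family_norm ?I M (\<lambda>i x. F i x - (\<Sum>a\<in>A. z a * B a i x)) < e"
          using dense[OF F] by blast
        have "(family_norm ?I M (\<lambda>i x. F i x - (\<Sum>a\<in>A. z a * B a i x)))\<^sup>2 < e\<^sup>2"
          using A(2) by (intro power_strict_mono) (auto simp: family_norm_nonneg)
        moreover have "e\<^sup>2 = (family_norm ?I M F)\<^sup>2 - l"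
          using l by (simp add: e_def)
        moreover have "0 \<le> (\<Sum>a\<in>A. (cmod (z a - ?c a))\<^sup>2)"
          by (intro sum_nonneg) auto
        ultimately have "l < (\<Sum>a\<in>A. (cmod (?c a))\<^sup>2)"
          using expand[OF A(1), of z] by linarith
        then show ?thesis
          using A(1) by blast
      qed
      show "parseval_at ?I M B F"
        using upper lower by (rule parseval_atI)
    qed
    ultimately show "?norm \<and> ?pars" ..
  }
  {
    assume "?norm \<and> ?pars"
    then have norm1: "\<And>a. family_norm ?I M (B a) = 1"
      and pars: "\<And>F. F \<in> L2_family ?I M \<Longrightarrow> parseval_at ?I M B F"
      by auto
    have self: "family_inner ?I M (B a) (B a) = 1" for a
      unfolding family_inner_self norm1 by simp
    have orth: "family_inner ?I M (B a) (B b) = 0" if "a \<noteq> b" for a b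
    proof -
      have "(\<Sum>b\<in>{a, b}. (cmod (family_inner ?I M (B a) (B b)))\<^sup>2) \<le> (family_norm ?I M (B a))\<^sup>2"
        using pars[OF B[of a]] unfolding parseval_at_def by (intro finite_sum_le_has_sum) auto
      then show ?thesis
        using that unfolding norm1 by (simp add: self del: One_nat_def)
    qed
    have on: "family_inner ?I M (B a) (B b) = (if a = b then 1 else 0)" for a b
      using self orth by (cases "a = b") simp_all
    show "orthonormal_basis_L2_sum M n B"
      unfolding orthonormal_basis_L2_sum_def conv
    proof (intro conjI allI ballI impI)
      show "B a \<in> L2_family ?I M" for a
        by (rule B)
      show "family_inner ?I M (B a) (B b) = (if a = b then 1 else 0)" for a b
        by (rule on)
      fix F and e :: real assume F: "F \<in> L2_family ?I M" and "e > 0"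
      let ?c = "\<lambda>a. family_inner ?I M F (B a)"
      have "(family_norm ?I M F)\<^sup>2 - e\<^sup>2 < (family_norm ?I M F)\<^sup>2"
        using \<open>e > 0\<close> by simp
      then obtain A where A: "finite A" "(family_norm ?I M F)\<^sup>2 - e\<^sup>2 < (\<Sum>a\<in>A. (cmod (?c a))\<^sup>2)"
        by (rule parseval_at_lower[OF pars[OF F]])
      have "(family_norm ?I M (\<lambda>i x. F i x - (\<Sum>a\<in>A. ?c a * B a i x)))\<^sup>2 < e\<^sup>2"
        using family_norm_orthonormal_expansion[OF A(1) B F on, where z = ?c] A(2) by simp
      then have "family_norm ?I M (\<lambda>i x. F i x - (\<Sum>a\<in>A. ?c a * B a i x)) < e"
        by (rule power2_less_imp_less) (use \<open>e > 0\<close> in simp)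
      then show "\<exists>A z. finite A \<and> family_norm ?I M (\<lambda>i x. F i x - (\<Sum>a\<in>A. z a * B a i x)) < e"
        using A(1) by (intro exI[of _ A] exI[of _ ?c] conjI)
    qed
  }
qed

section \<open>The absolute value\<close>

context local_field
begin

lemma absv_nonneg: "0 \<le> absv x"
  using dist_absv[of x 0] zero_le_dist[of x 0] by simp

lemma absv_0 [simp]: "absv 0 = 0"
  by (simp add: absv_eq_0_iff)

lemma absv_pos: "x \<noteq> 0 \<Longrightarrow> 0 < absv x"
  using absv_nonneg[of x] absv_eq_0_iff[of x] by simp

lemma absv_1 [simp]: "absv 1 = 1"
  using absv_mult[of 1 1] absv_eq_0_iff[of 1] by simp

lemma absv_minus [simp]: "absv (- x) = absv x"
  using dist_absv[of 0 x] dist_absv[of x 0] by (simp add: dist_commute)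

lemma absv_diff_commute: "absv (x - y) = absv (y - x)"
  using absv_minus[of "x - y"] by simp

lemma absv_inverse: "absv (inverse x) = inverse (absv x)"
proof (cases "x = 0")
  case False
  then have "absv x * absv (inverse x) = 1"
    using absv_mult[of x "inverse x"] by simp
  then show ?thesis
    by (metis inverse_unique)
qed simp

lemma absv_powi: "absv (x powi j) = absv x powi j"
proof -
  have "absv (y ^ n) = absv y ^ n" for y n
    by (induction n) (simp_all add: absv_mult)
  then show ?thesis
    by (simp add: power_int_def absv_inverse)
qed

lemma prime_p: "prime p"
  using prime_CHAR_semidom[where 'a = 'a] p_pos char_p by simp

end

context local_field_basis
begin

abbreviation q :: nat where "q \<equiv> p ^ c"

lemma p_gt_1: "p > 1"
  using prime_p prime_gt_1_nat by blast

text \<open>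
  \<open>q\<close> as a real number. It is a constant of its own so that \<open>Q powi j\<close> is not rewritten into
  powers of \<open>p\<close>.
\<close>

definition Q :: real where "Q = real (p ^ c)"

lemma q_gt_1: "q > 1"
  using p_gt_1 c_pos by (intro one_less_power) auto

lemma q_pos: "q > 0"
  using q_gt_1 by linarith

lemma Q_gt_1: "Q > 1"
  unfolding Q_def using q_gt_1 by linarith

lemma Q_nonzero [simp]: "Q \<noteq> 0"
  using Q_gt_1 by simp

lemma pi_nonzero [simp]: "\<pi> \<noteq> 0"
  using absv_prime_element p_gt_1 by (intro notI) simp

lemma absv_pi_powi: "absv (\<pi> powi j) = Q powi (- j)"
  unfolding absv_powi absv_prime_element Q_def[symmetric]
  by (simp add: power_int_minus power_int_divide_distrib inverse_eq_divide)

text \<open>The maximal ideal is generated by \<open>\<pi>\<close>, so no absolute value lies between \<open>1 / q\<close> and \<open>1\<close>.\<close>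

lemma absv_value_group:
  assumes "x \<noteq> 0"
  obtains j :: int where "absv x = Q powi j"
proof -
  define j where "j = \<lfloor>log (Q) (absv x)\<rfloor>"
  note q1 = Q_gt_1
  have pos: "absv x > 0"
    using assms by (rule absv_pos)
  have j: "of_int j \<le> log Q (absv x)" "log Q (absv x) < of_int (j + 1)"
    unfolding j_def by linarith+
  have low: "Q powi j \<le> absv x"
    using j(1) q1 pos by (simp add: le_log_iff powr_real_of_int')
  have up: "absv x < Q powi (j + 1)"
    using j(2) q1 pos powr_real_of_int'[of Q "j + 1"] by (simp only: log_less_iff) simp
  let ?y = "x * \<pi> powi (j + 1)"
  have ay: "absv ?y = absv x / Q powi (j + 1)"
    using absv_pi_powi[of "j + 1"] by (simp only: absv_mult power_int_minus divide_inverse)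
  have qp: "Q powi k > 0" for k :: int
    using q1 by (intro zero_less_power_int) auto
  have "absv ?y < 1"
    unfolding ay using up qp[of "j + 1"] by (subst divide_less_eq_1_pos) auto
  then obtain z where z: "?y = \<pi> * z" "absv z \<le> 1"
    using prime_element by (auto simp: max_ideal_def ring_of_integers_def)
  have "absv ?y \<le> 1 / Q"
    unfolding z(1) absv_mult absv_prime_element Q_def[symmetric] using z(2) q1 by (simp add: divide_simps)
  then have "absv x \<le> Q powi (j + 1) / Q"
    unfolding ay using qp[of "j + 1"] q1 by (simp add: field_simps)
  also have "\<dots> = Q powi j"
    using q1 by (simp add: power_int_add)
  finally show ?thesis
    using low that by force
qed

lemma q_powi_pos [simp]: "Q powi k > 0"
  using Q_gt_1 by (intro zero_less_power_int) simp

lemma q_powi_less_iff: "Q powi j < Q powi k \<longleftrightarrow> j < k"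
  using power_int_strict_increasing[of j k Q] power_int_increasing[of k j Q] Q_gt_1
  by (cases "j < k") auto

lemma q_powi_le_iff: "Q powi j \<le> Q powi k \<longleftrightarrow> j \<le> k"
  using q_powi_less_iff[of k j] by linarith

text \<open>The fractional ideal \<open>\<pi>\<^sup>m \<O>\<close>, written as a ball around \<open>0\<close>.\<close>

definition frac_ideal :: "int \<Rightarrow> 'a set" where
  "frac_ideal m = {x. absv x \<le> Q powi (- m)}"

lemma frac_ideal_0: "frac_ideal 0 = ring_of_integers absv"
  by (simp add: frac_ideal_def ring_of_integers_def)

lemma zero_in_frac_ideal [simp]: "0 \<in> frac_ideal m"
  using q_powi_pos[of "- m"] by (simp add: frac_ideal_def less_imp_le)

lemma frac_ideal_add: "x \<in> frac_ideal m \<Longrightarrow> y \<in> frac_ideal m \<Longrightarrow> x + y \<in> frac_ideal m"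
  using absv_ultrametric[of x y] by (auto simp: frac_ideal_def)

lemma frac_ideal_minus_iff [simp]: "- x \<in> frac_ideal m \<longleftrightarrow> x \<in> frac_ideal m"
  by (simp add: frac_ideal_def)

lemma frac_ideal_diff: "x \<in> frac_ideal m \<Longrightarrow> y \<in> frac_ideal m \<Longrightarrow> x - y \<in> frac_ideal m"
  using frac_ideal_add[of x m "- y"] by simp

lemma frac_ideal_diff_commute: "x - y \<in> frac_ideal m \<longleftrightarrow> y - x \<in> frac_ideal m"
  using frac_ideal_minus_iff[of "x - y" m] by simp

lemma frac_ideal_sum: "(\<And>a. a \<in> A \<Longrightarrow> f a \<in> frac_ideal m) \<Longrightarrow> sum f A \<in> frac_ideal m"
  by (induction A rule: infinite_finite_induct) (auto intro: frac_ideal_add)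

lemma frac_ideal_add_iff: "y \<in> frac_ideal m \<Longrightarrow> x + y \<in> frac_ideal m \<longleftrightarrow> x \<in> frac_ideal m"
  using frac_ideal_add[of x m y] frac_ideal_diff[of "x + y" m y] by auto

lemma frac_ideal_mono: "k \<le> m \<Longrightarrow> x \<in> frac_ideal m \<Longrightarrow> x \<in> frac_ideal k"
  using q_powi_le_iff[of "- m" "- k"] by (auto simp: frac_ideal_def intro: order_trans)

lemma frac_ideal_mult: "x \<in> frac_ideal k \<Longrightarrow> y \<in> frac_ideal m \<Longrightarrow> x * y \<in> frac_ideal (k + m)"
proof -
  assume "x \<in> frac_ideal k" "y \<in> frac_ideal m"
  then have "absv x * absv y \<le> Q powi (- k) * Q powi (- m)"
    by (intro mult_mono) (auto simp: frac_ideal_def absv_nonneg less_imp_le)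
  also have "\<dots> = Q powi (- (k + m))"
    using power_int_add[of "Q" "- k" "- m"] by simp
  finally show ?thesis
    by (simp add: frac_ideal_def absv_mult)
qed

lemma pi_powi_in_frac_ideal: "\<pi> powi j \<in> frac_ideal j"
  by (simp add: frac_ideal_def absv_pi_powi)

lemma pi_powi_mult_iff: "\<pi> powi j * x \<in> frac_ideal m \<longleftrightarrow> x \<in> frac_ideal (m - j)"
proof
  assume "x \<in> frac_ideal (m - j)"
  then show "\<pi> powi j * x \<in> frac_ideal m"
    using frac_ideal_mult[OF pi_powi_in_frac_ideal[of j]] by fastforce
next
  assume "\<pi> powi j * x \<in> frac_ideal m"
  then have "\<pi> powi (- j) * (\<pi> powi j * x) \<in> frac_ideal (- j + m)"
    by (intro frac_ideal_mult pi_powi_in_frac_ideal)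
  moreover have "\<pi> powi (- j) * (\<pi> powi j * x) = x"
    by (simp add: power_int_minus)
  ultimately show "x \<in> frac_ideal (m - j)"
    by simp
qed

lemma ex_frac_ideal: "\<exists>m\<ge>m0. x \<in> frac_ideal (- m)"
proof (cases "x = 0")
  case False
  then obtain j where "absv x = Q powi j"
    by (rule absv_value_group)
  then have "x \<in> frac_ideal (- max j m0)"
    by (simp add: frac_ideal_def q_powi_le_iff)
  then show ?thesis
    by (intro exI[of _ "max j m0"]) auto
qed auto

lemma max_ideal_frac: "max_ideal absv = frac_ideal 1"
proof -
  have "x \<in> frac_ideal 1 \<longleftrightarrow> x \<in> (*) \<pi> ` frac_ideal 0" for x
  proof
    assume "x \<in> frac_ideal 1"
    then have "\<pi> powi (-1) * x \<in> frac_ideal 0"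
      by (simp only: pi_powi_mult_iff) simp
    then show "x \<in> (*) \<pi> ` frac_ideal 0"
      by (rule rev_image_eqI) (simp add: power_int_minus)
  qed (use pi_powi_mult_iff[of 1 _ 1] in auto)
  then show ?thesis
    using prime_element frac_ideal_0 by auto
qed

text \<open>
  If \<open>x\<close> lies outside \<open>\<pi>\<^sup>m \<O>\<close>, its multiples by elements of \<open>\<pi>\<^sup>k \<O>\<close> include all of
  \<open>\<pi>\<^sup>m\<^sup>+\<^sup>k\<^sup>-\<^sup>1 \<O>\<close>. For \<open>m = - k\<close> this is \<open>\<pi>\<^sup>-\<^sup>1 \<O>\<close>, where the character is nontrivial.
\<close>

lemma inverse_mult_in_frac_ideal:
  assumes "x \<notin> frac_ideal m" "z \<in> frac_ideal (m + k - 1)"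
  shows "inverse x * z \<in> frac_ideal k"
proof -
  have "x \<noteq> 0"
    using assms by auto
  then obtain j where j: "absv x = Q powi j"
    by (rule absv_value_group)
  have "- m < j"
    using assms by (simp add: frac_ideal_def j q_powi_le_iff)
  have "inverse x \<in> frac_ideal j"
    by (simp add: frac_ideal_def absv_inverse j power_int_minus)
  then have "inverse x * z \<in> frac_ideal (j + (m + k - 1))"
    using assms(2) by (rule frac_ideal_mult)
  then show ?thesis
    by (rule frac_ideal_mono[rotated]) (use \<open>- m < j\<close> in simp)
qed

lemma frac_ideal_nbhd:
  assumes "open U" "x \<in> U"
  obtains m :: nat where "\<And>y. y \<in> frac_ideal (int m) \<Longrightarrow> x + y \<in> U"
proof -
  obtain e where e: "e > 0" "ball x e \<subseteq> U"
    using assms open_contains_ball by blast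
  obtain m where m: "(1 / Q) ^ m < e"
    using real_arch_pow_inv[OF e(1), of "1 / Q"] Q_gt_1 by auto
  have "x + y \<in> U" if "y \<in> frac_ideal (int m)" for y
  proof -
    have "absv y \<le> (1 / Q) ^ m"
      using that by (simp add: frac_ideal_def power_int_minus power_one_over inverse_eq_divide)
    then have "dist x (x + y) < e"
      using m by (simp add: dist_absv)
    then show ?thesis
      using e(2) by auto
  qed
  then show ?thesis
    using that by blast
qed

lemma frac_ideal_ball: "frac_ideal m = ball 0 (Q powi (1 - m))"
proof -
  have "absv x \<le> Q powi (- m) \<longleftrightarrow> absv x < Q powi (1 - m)" for x
  proof (cases "x = 0")
    case True
    then show ?thesis
      using q_powi_pos[of "- m"] q_powi_pos[of "1 - m"] by (simp add: less_imp_le)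
  next
    case False
    then obtain j where "absv x = Q powi j"
      by (rule absv_value_group)
    then show ?thesis
      by (auto simp: q_powi_le_iff q_powi_less_iff)
  qed
  then show ?thesis
    by (auto simp: frac_ideal_def ball_def dist_absv)
qed

lemma coset_ball: "{x. x - a \<in> frac_ideal m} = ball a (Q powi (1 - m))"
  by (auto simp: frac_ideal_ball dist_absv absv_diff_commute)

lemma open_coset: "open {x. x - a \<in> frac_ideal m}"
  unfolding coset_ball by simp

end

lemma digit_below:
  fixes n b :: nat
  assumes "Z > 0" "k < m"
  shows "(n + b * Z ^ m) div Z ^ k mod Z = n div Z ^ k mod Z"
proof -
  obtain d where d: "m = Suc (k + d)"
    using less_imp_Suc_add[OF assms(2)] by blast
  have "b * Z ^ m = Z ^ k * (Z * (b * Z ^ d))"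
    by (simp add: d power_add mult_ac)
  moreover have "(n + Z ^ k * (Z * y)) div Z ^ k mod Z = n div Z ^ k mod Z" for y
    using assms(1) by simp
  ultimately show ?thesis
    by (simp only:)
qed

lemma digit_top:
  fixes n b :: nat
  assumes "n < Z ^ m" "b < Z"
  shows "(n + b * Z ^ m) div Z ^ m mod Z = b"
  using assms by simp

lemma base_p_digits:
  fixes a :: "nat \<Rightarrow> nat"
  assumes "\<And>k. k < c \<Longrightarrow> a k < p"
  shows "(\<Sum>k<c. a k * p ^ k) < p ^ c \<and> (\<forall>k<c. (\<Sum>k<c. a k * p ^ k) div p ^ k mod p = a k)"
  using assms
proof (induction c)
  case (Suc c)
  have IH: "(\<Sum>k<c. a k * p ^ k) < p ^ c" "\<And>k. k < c \<Longrightarrow> (\<Sum>k<c. a k * p ^ k) div p ^ k mod p = a k"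
    using Suc by auto
  have ac: "a c < p"
    using Suc.prems by simp
  have "(\<Sum>k<Suc c. a k * p ^ k) < p ^ c + a c * p ^ c"
    using IH(1) by simp
  also have "\<dots> = (a c + 1) * p ^ c"
    by simp
  also have "\<dots> \<le> p * p ^ c"
    using ac by (intro mult_right_mono) auto
  finally have "(\<Sum>k<Suc c. a k * p ^ k) < p ^ Suc c"
    by simp
  moreover have "(\<Sum>k<Suc c. a k * p ^ k) div p ^ k mod p = a k" if "k < Suc c" for k
  proof (cases "k = c")
    case True
    then show ?thesis
      using IH(1) ac by simp
  next
    case False
    then show ?thesis
      using that digit_below[of p k c "\<Sum>k<c. a k * p ^ k" "a c"] IH(2)[of k] ac by simp
  qed
  ultimately show ?case
    by blast
qed auto

context local_field_basis begin
section \<open>The elements \<open>u(n)\<close> represent the cosets of the ring of integers\<close>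

abbreviation \<gamma> :: "nat \<Rightarrow> 'a" where "\<gamma> \<equiv> u p c \<pi> \<epsilon>"

abbreviation dig :: "nat \<Rightarrow> 'a" where "dig \<equiv> u_digit p c \<pi> \<epsilon>"

lemma dig_0 [simp]: "dig 0 = 0"
  by (simp add: u_digit_def)

lemma eps_integral: "k < c \<Longrightarrow> \<epsilon> k \<in> frac_ideal 0"
  using eps_units[of k] by (simp add: frac_ideal_0)

lemma of_nat_integral: "of_nat n \<in> frac_ideal 0"
proof (induction n)
  case (Suc n)
  have "1 \<in> frac_ideal 0"
    by (simp add: frac_ideal_def)
  with Suc show ?case
    using frac_ideal_add by simp
qed simp

lemma dig_in: "dig n \<in> frac_ideal (-1)"
proof -
  have "(\<Sum>k<c. of_nat (n div p ^ k mod p) * \<epsilon> k) \<in> frac_ideal 0"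
    using frac_ideal_mult[OF of_nat_integral eps_integral] by (intro frac_ideal_sum) auto
  then have "inverse \<pi> * (\<Sum>k<c. of_nat (n div p ^ k mod p) * \<epsilon> k) \<in> frac_ideal (-1)"
    using pi_powi_mult_iff[of "-1" _ "-1"] by (simp add: power_int_minus)
  then show ?thesis
    unfolding u_digit_def by (subst mult.commute)
qed

lemma of_int_char: "(of_int a :: 'a) = of_nat (nat (a mod int p))"
proof -
  have "(of_int a :: 'a) = of_int (int p * (a div int p) + a mod int p)"
    by simp
  also have "\<dots> = of_nat p * of_int (a div int p) + of_int (a mod int p)"
    by (simp only: of_int_add of_int_mult of_int_of_nat_eq)
  also have "(of_nat p :: 'a) = 0"
    using char_p by (simp add: of_nat_CHAR)
  finally show ?thesis
    using p_gt_1 by (simp add: of_nat_nat)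
qed

lemma ex_dig:
  assumes "x \<in> frac_ideal (-1)"
  shows "\<exists>b<q. x - dig b \<in> frac_ideal 0"
proof -
  have "\<pi> * x \<in> frac_ideal 0"
    using assms pi_powi_mult_iff[of 1 x 0] by simp
  then obtain a :: "nat \<Rightarrow> int" where a: "\<pi> * x - (\<Sum>k<c. of_int (a k) * \<epsilon> k) \<in> frac_ideal 1"
    using eps_span[of "\<pi> * x"] by (auto simp: frac_ideal_0 max_ideal_frac)
  define d where "d k = nat (a k mod int p)" for k
  have d: "d k < p" for k
    using p_gt_1 by (simp add: d_def nat_less_iff)
  define b where "b = (\<Sum>k<c. d k * p ^ k)"
  have "dig b = (\<Sum>k<c. of_int (a k) * \<epsilon> k) * inverse \<pi>"
    unfolding u_digit_def b_def using d base_p_digits[of c d p]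
    by (intro arg_cong[where f = "\<lambda>z. z * inverse \<pi>"] sum.cong) (auto simp: of_int_char[of "a _"] d_def)
  then have "x - dig b = \<pi> powi (-1) * (\<pi> * x - (\<Sum>k<c. of_int (a k) * \<epsilon> k))"
    by (simp add: power_int_minus field_simps)
  then have "x - dig b \<in> frac_ideal 0"
    using a pi_powi_mult_iff[of "-1" _ 0] by simp
  moreover have "b < q"
    unfolding b_def using base_p_digits[of c d p] d by blast
  ultimately show ?thesis
    by blast
qed

lemma dig_inj:
  assumes "b < q" "b' < q" "dig b - dig b' \<in> frac_ideal 0"
  shows "b = b'"
proof -
  define a where "a k = int (b div p ^ k mod p) - int (b' div p ^ k mod p)" for k
  have cancel: "\<pi> * (z * inverse \<pi>) = z" for z
    by simp
  have "\<pi> * dig n = (\<Sum>k<c. of_nat (n div p ^ k mod p) * \<epsilon> k)" for n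
    unfolding u_digit_def by (rule cancel)
  then have "\<pi> * (dig b - dig b') = (\<Sum>k<c. of_int (a k) * \<epsilon> k)"
    by (simp add: a_def left_diff_distrib sum_subtractf right_diff_distrib)
  then have "(\<Sum>k<c. of_int (a k) * \<epsilon> k) \<in> max_ideal absv"
    using assms(3) pi_powi_mult_iff[of 1 "dig b - dig b'" 1] by (simp add: max_ideal_frac)
  then have dvd: "int p dvd a k" if "k < c" for k
    using eps_independent that by blast
  have digs: "b div p ^ k mod p = b' div p ^ k mod p" if "k < c" for k
  proof -
    have "int (b div p ^ k mod p) mod int p = int (b' div p ^ k mod p) mod int p"
      unfolding mod_eq_dvd_iff using dvd[OF that] by (simp only: a_def)
    then show ?thesis
      unfolding zmod_int[symmetric] of_nat_eq_iff mod_mod_trivial .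
  qed
  have "b mod p ^ k = b' mod p ^ k" if "k \<le> c" for k
    using that
  proof (induction k)
    case (Suc k)
    then show ?case
      using digs[of k] by (simp add: mod_mult2_eq power_Suc2 del: power_Suc)
  qed simp
  from this[of c] show ?thesis
    using assms by simp
qed

lemma u_eq:
  assumes "n < q ^ m"
  shows "\<gamma> n = (\<Sum>k<m. dig (n div q ^ k mod q) * inverse \<pi> ^ k)"
proof -
  let ?f = "\<lambda>k. dig (n div q ^ k mod q) * inverse \<pi> ^ k"
  have "n < q ^ Suc n"
    using power_gt_expt[OF q_gt_1[unfolded One_nat_def], of "Suc n"] by linarith
  then have "n < q ^ k" if "k > n \<or> k \<ge> m" for k
    using assms that power_increasing[of "Suc n" k q] power_increasing[of m k q] q_gt_1
    by (metis Suc_leI less_imp_le less_le_trans)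
  then have z: "?f k = 0" if "k > n \<or> k \<ge> m" for k
    using that by simp
  then have z': "\<not> k \<le> n \<Longrightarrow> ?f k = 0" "\<not> k < m \<Longrightarrow> ?f k = 0" for k
    by (simp_all only: not_le not_less simp_thms)
  have "\<gamma> n = sum ?f {..n}"
    by (simp add: u_def)
  also have "\<dots> = sum ?f ({..n} \<inter> {..<m})"
    using z' by (intro sum.mono_neutral_right) blast+
  also have "\<dots> = sum ?f {..<m}"
    using z' by (intro sum.mono_neutral_left) blast+
  finally show ?thesis .
qed

lemma u_step:
  assumes "n < q ^ m" "b < q"
  shows "n + b * q ^ m < q ^ Suc m" "\<gamma> (n + b * q ^ m) = \<gamma> n + dig b * inverse \<pi> ^ m"
proof -
  have "n + b * q ^ m < (b + 1) * q ^ m"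
    using assms by simp
  also have "\<dots> \<le> q * q ^ m"
    using assms by (intro mult_right_mono) auto
  finally show less: "n + b * q ^ m < q ^ Suc m"
    by simp
  have "(n + b * q ^ m) div q ^ k mod q = n div q ^ k mod q" if "k < m" for k
    using q_pos that by (rule digit_below)
  moreover have "(n + b * q ^ m) div q ^ m mod q = b"
    using assms by (rule digit_top)
  ultimately show "\<gamma> (n + b * q ^ m) = \<gamma> n + dig b * inverse \<pi> ^ m"
    unfolding u_eq[OF less] u_eq[OF assms(1)] by simp
qed

lemma u_0 [simp]: "\<gamma> 0 = 0"
  by (simp add: u_def)

lemma shift_dig_in: "dig b * inverse \<pi> ^ m \<in> frac_ideal (- int (Suc m))"
  using pi_powi_mult_iff[of "- int m" "dig b" "- int (Suc m)"] dig_in[of b]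
  by (simp add: power_int_minus mult.commute power_inverse)

lemma u_in: "n < q ^ m \<Longrightarrow> \<gamma> n \<in> frac_ideal (- int m)"
proof (induction m arbitrary: n)
  case (Suc m)
  let ?n = "n mod q ^ m" and ?b = "n div q ^ m"
  have b: "?b < q"
    using Suc.prems by (simp add: less_mult_imp_div_less mult.commute)
  have n: "?n < q ^ m"
    by (intro mod_less_divisor zero_less_power q_pos)
  have "\<gamma> n = \<gamma> ?n + dig ?b * inverse \<pi> ^ m"
    using u_step(2)[OF n b] unfolding mod_div_mult_eq .
  then show ?case
    using frac_ideal_add[OF frac_ideal_mono[OF _ Suc.IH[OF n]] shift_dig_in] by simp
qed simp

text \<open>Peeling off the polar part of \<open>x\<close> one digit at a time, from the highest pole down.\<close>

lemma u_complete:
  assumes "x \<in> frac_ideal (- int m)"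
  shows "\<exists>n<q ^ m. x - \<gamma> n \<in> frac_ideal 0"
  using assms
proof (induction m arbitrary: x)
  case (Suc m)
  have "\<pi> powi (int m) * x \<in> frac_ideal (-1)"
    using Suc.prems by (simp only: pi_powi_mult_iff) (simp add: algebra_simps)
  then obtain b where b: "b < q" "\<pi> powi (int m) * x - dig b \<in> frac_ideal 0"
    using ex_dig by blast
  have "x - dig b * inverse \<pi> ^ m = \<pi> powi (- int m) * (\<pi> powi (int m) * x - dig b)"
    by (simp add: power_int_minus field_simps)
  then have "x - dig b * inverse \<pi> ^ m \<in> frac_ideal (- int m)"
    using b(2) by (simp only: pi_powi_mult_iff) simp
  then obtain n where n: "n < q ^ m" "x - dig b * inverse \<pi> ^ m - \<gamma> n \<in> frac_ideal 0"
    using Suc.IH by blast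
  then show ?case
    using u_step[OF n(1) b(1)] by (intro exI[of _ "n + b * q ^ m"]) (simp add: algebra_simps)
qed (auto intro!: exI[of _ 0])

text \<open>
  If two numbers first differ, from the top, in the digit at \<open>q\<^sup>m\<close>, the difference of their images
  has absolute value \<open>q\<^sup>m\<^sup>+\<^sup>1\<close>, because distinct digits are independent modulo the maximal ideal.
\<close>

lemma u_inj:
  assumes "\<gamma> n - \<gamma> n' \<in> frac_ideal 0"
  shows "n = n'"
proof -
  have "n = n'" if "n < q ^ m" "n' < q ^ m" "\<gamma> n - \<gamma> n' \<in> frac_ideal 0" for m
    using that
  proof (induction m arbitrary: n n')
    case (Suc m)
    have decomp: "\<exists>k b. k < q ^ m \<and> b < q \<and> i = k + b * q ^ m" if "i < q ^ Suc m" for i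
    proof (intro exI conjI)
      show "i mod q ^ m < q ^ m"
        by (intro mod_less_divisor zero_less_power q_pos)
      show "i div q ^ m < q"
        using that by (simp add: less_mult_imp_div_less mult.commute)
      show "i = i mod q ^ m + i div q ^ m * q ^ m"
        by (rule mod_div_mult_eq[symmetric])
    qed
    obtain k b where kb: "k < q ^ m" "b < q" "n = k + b * q ^ m"
      using decomp[OF Suc.prems(1)] by blast
    obtain k' b' where kb': "k' < q ^ m" "b' < q" "n' = k' + b' * q ^ m"
      using decomp[OF Suc.prems(2)] by blast
    have diff: "\<gamma> n - \<gamma> n' = (\<gamma> k - \<gamma> k') + (dig b - dig b') * inverse \<pi> ^ m"
      using u_step(2)[OF kb(1,2)] u_step(2)[OF kb'(1,2)] kb(3) kb'(3) by (simp add: algebra_simps)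
    have "\<gamma> k - \<gamma> k' \<in> frac_ideal (- int m)"
      using kb kb' by (intro frac_ideal_diff u_in)
    moreover have "\<gamma> n - \<gamma> n' \<in> frac_ideal (- int m)"
      using Suc.prems(3) by (rule frac_ideal_mono[rotated]) simp
    ultimately have "(dig b - dig b') * inverse \<pi> ^ m \<in> frac_ideal (- int m)"
      using diff frac_ideal_diff by (metis add_diff_cancel_left')
    moreover have "(dig b - dig b') * inverse \<pi> ^ m = \<pi> powi (- int m) * (dig b - dig b')"
      by (simp add: power_int_minus power_inverse)
    ultimately have "dig b - dig b' \<in> frac_ideal 0"
      by (simp only: pi_powi_mult_iff) simp
    then have "b = b'"
      using kb kb' by (intro dig_inj)
    then have "k = k'"
      using diff Suc.prems(3) kb(1) kb'(1) by (intro Suc.IH) auto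
    then show ?case
      using \<open>b = b'\<close> kb kb' by simp
  qed auto
  moreover have "i < q ^ (n + n' + 1)" if "i \<le> n + n'" for i
    using power_gt_expt[OF q_gt_1[unfolded One_nat_def], of "n + n' + 1"] that by linarith
  ultimately show ?thesis
    using assms by (metis le_add1 le_add2)
qed

end

context local_field_basis begin

section \<open>Borel sets and the Haar measure\<close>

definition coset :: "'a \<Rightarrow> int \<Rightarrow> 'a set" where
  "coset a m = {x. x - a \<in> frac_ideal m}"

lemma coset_0: "coset 0 m = frac_ideal m"
  by (simp add: coset_def)

lemma self_in_coset: "a \<in> coset a m"
  by (simp add: coset_def)

lemma coset_eq:
  assumes "b \<in> coset a m"
  shows "coset b m = coset a m"
proof -
  have "x - a = (x - b) + (b - a)" for x
    by simp
  then show ?thesis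
    using assms frac_ideal_add_iff[of "b - a" m "_ - b"] by (auto simp: coset_def)
qed

lemma coset_Int:
  assumes "k \<le> m"
  shows "coset a k \<inter> coset b m = {} \<or> coset a k \<inter> coset b m = coset b m"
proof -
  have "coset b m \<subseteq> coset a k" if "x \<in> coset a k" "x \<in> coset b m" for x
  proof -
    have "coset b m = coset x m" "coset x k = coset a k"
      using that coset_eq by auto
    moreover have "coset x m \<subseteq> coset x k"
      using assms frac_ideal_mono by (auto simp: coset_def)
    ultimately show ?thesis
      by simp
  qed
  then show ?thesis
    by blast
qed

lemma borel_coset [measurable]: "coset a m \<in> sets borel"
  unfolding coset_def using open_coset by (rule borel_open)

lemma borel_frac_ideal [measurable]: "frac_ideal m \<in> sets borel"
  using borel_coset[of 0 m] by (simp add: coset_0)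

lemma ex_nat_frac_ideal: "\<exists>N. x \<in> frac_ideal (- int N)"
  using ex_frac_ideal[of 0 x] by (metis nonneg_int_cases)

text \<open>Every coset of \<open>\<pi>\<^sup>m \<O>\<close> is listed by \<open>n \<mapsto> \<pi>\<^sup>m u(n)\<close>, so there are only countably many.\<close>

lemma coset_listed: "\<exists>n. coset x m = coset (\<pi> powi m * \<gamma> n) m"
proof -
  obtain N where "\<pi> powi (- m) * x \<in> frac_ideal (- int N)"
    using ex_nat_frac_ideal by blast
  then obtain n where n: "\<pi> powi (- m) * x - \<gamma> n \<in> frac_ideal 0"
    using u_complete by blast
  have "x - \<pi> powi m * \<gamma> n = \<pi> powi m * (\<pi> powi (- m) * x - \<gamma> n)"
    by (simp add: power_int_minus field_simps)
  then have "x \<in> coset (\<pi> powi m * \<gamma> n) m"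
    using n unfolding coset_def mem_Collect_eq by (simp only: pi_powi_mult_iff) simp
  then show ?thesis
    using coset_eq by blast
qed

lemma open_nbhd_coset:
  assumes "open U" "x \<in> U"
  obtains m :: nat where "coset x (int m) \<subseteq> U"
proof -
  obtain m where m: "\<And>y. y \<in> frac_ideal (int m) \<Longrightarrow> x + y \<in> U"
    using frac_ideal_nbhd[OF assms] by blast
  have "coset x (int m) \<subseteq> U"
    using m[of "_ - x"] by (auto simp: coset_def)
  then show ?thesis
    by (rule that)
qed

lemma sets_borel_cosets: "sets borel = sigma_sets UNIV (insert {} (range (case_prod coset)))"
proof
  let ?G = "insert {} (range (case_prod coset))"
  show "sigma_sets UNIV ?G \<subseteq> sets borel"
    by (intro sets.sigma_sets_subset[of _ borel, simplified]) auto
  have "U \<in> sigma_sets UNIV ?G" if opn: "open U" for U :: "'a set"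
  proof -
    define I where "I = {(m, n). coset (\<pi> powi m * \<gamma> n) m \<subseteq> U}"
    have "U \<subseteq> (\<Union>(m, n)\<in>I. coset (\<pi> powi m * \<gamma> n) m)"
    proof
      fix x assume "x \<in> U"
      then obtain m where m: "coset x (int m) \<subseteq> U"
        using open_nbhd_coset[OF opn] by blast
      obtain n where "coset x (int m) = coset (\<pi> powi (int m) * \<gamma> n) (int m)"
        using coset_listed by blast
      then show "x \<in> (\<Union>(m, n)\<in>I. coset (\<pi> powi m * \<gamma> n) m)"
        using m self_in_coset[of x "int m"] by (intro UN_I[of "(int m, n)"]) (auto simp: I_def)
    qed
    then have "U = (\<Union>(m, n)\<in>I. coset (\<pi> powi m * \<gamma> n) m)"
      by (auto simp: I_def)
    moreover have "(\<Union>(m, n)\<in>I. coset (\<pi> powi m * \<gamma> n) m) \<in> sigma_sets UNIV ?G"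
      by (rule sigma_sets_UNION) (auto intro!: countable_image sigma_sets.Basic)
    ultimately show ?thesis
      by (simp only:)
  qed
  then show "sets borel \<subseteq> sigma_sets UNIV ?G"
    unfolding borel_def by (subst sets_measure_of) (auto intro!: sigma_sets_mono)
qed

lemma Int_stable_cosets: "Int_stable (insert {} (range (case_prod coset)))"
proof -
  have "coset a k \<inter> coset b m \<in> insert {} (range (case_prod coset))" for a b k m
  proof (cases "k \<le> m")
    case True
    then show ?thesis
      using coset_Int[of k m a b] by auto
  next
    case False
    then show ?thesis
      using coset_Int[of m k b a] by (auto simp: Int_commute)
  qed
  then show ?thesis
    by (auto simp: Int_stable_def)
qed

lemma measurable_add [measurable]: "(\<lambda>x. x + a) \<in> borel \<rightarrow>\<^sub>M (borel :: 'a measure)"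
  by (intro borel_measurable_continuous_onI) (auto simp: continuous_on_iff dist_absv)

lemma measurable_mult_const [measurable]: "(\<lambda>x. b * x) \<in> borel \<rightarrow>\<^sub>M (borel :: 'a measure)"
proof (intro borel_measurable_continuous_onI)
  show "continuous_on UNIV ((*) b)"
    unfolding continuous_on_iff
  proof (intro ballI allI impI)
    fix x :: 'a and e :: real assume "e > 0"
    have "dist (b * y) (b * x) < e" if "dist y x < e / (absv b + 1)" for y
    proof -
      have "dist (b * y) (b * x) = absv b * dist y x"
        by (simp add: dist_absv absv_mult flip: right_diff_distrib)
      also have "\<dots> \<le> (absv b + 1) * dist y x"
        by (intro mult_right_mono) auto
      also have "\<dots> < e"
        using that absv_nonneg[of b] by (simp add: field_simps)
      finally show ?thesis .
    qed
    then show "\<exists>d>0. \<forall>x'\<in>UNIV. dist x' x < d \<longrightarrow> dist (b * x') (b * x) < e"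
      using \<open>e > 0\<close> absv_nonneg[of b] by (intro exI[of _ "e / (absv b + 1)"]) auto
  qed
qed

text \<open>
  Multiplication is jointly measurable for the product \<open>\<sigma>\<close>-algebra: the preimage of an open set
  is a union of products of cosets, and countably many suffice.
\<close>

lemma measurable_mult [measurable]:
  "(\<lambda>z. fst z * snd z) \<in> borel \<Otimes>\<^sub>M borel \<rightarrow>\<^sub>M (borel :: 'a measure)"
proof (rule borel_measurableI)
  fix U :: "'a set" assume U: "open U"
  define C where "C m n = coset (\<pi> powi m * \<gamma> n) m" for m n
  define P where "P = {z :: 'a \<times> 'a. fst z * snd z \<in> U}"
  define I where "I = {(m, n, n'). C m n \<times> C m n' \<subseteq> P}"
  have "P \<subseteq> (\<Union>(m, n, n')\<in>I. C m n \<times> C m n')"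
  proof
    fix z assume z: "z \<in> P"
    obtain x y where xy: "z = (x, y)"
      by fastforce
    obtain m where m: "coset (x * y) (int m) \<subseteq> U"
      using open_nbhd_coset[OF U] z xy by (auto simp: P_def)
    obtain r where r: "r \<ge> 0" "x \<in> frac_ideal (- r)"
      using ex_frac_ideal by blast
    obtain s where s: "s \<ge> r" "y \<in> frac_ideal (- s)"
      using ex_frac_ideal by blast
    have xs: "x \<in> frac_ideal (- s)"
      using r s frac_ideal_mono[of "- s" "- r" x] by simp
    obtain n n' where n: "coset x (int m + s) = C (int m + s) n" "coset y (int m + s) = C (int m + s) n'"
      unfolding C_def using coset_listed by metis
    have "x' * y' \<in> U" if "x' \<in> coset x (int m + s)" "y' \<in> coset y (int m + s)" for x' y'
    proof -
      have d: "x' - x \<in> frac_ideal (int m + s)" "y' - y \<in> frac_ideal (int m + s)"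
        using that by (auto simp: coset_def)
      have "y + (y' - y) \<in> frac_ideal (- s)"
        using s r d(2) frac_ideal_mono[of "- s" "int m + s"] by (intro frac_ideal_add) auto
      then have "(x' - x) * y' \<in> frac_ideal (int m)"
        using frac_ideal_mult[OF d(1)] by fastforce
      moreover have "x * (y' - y) \<in> frac_ideal (int m)"
        using frac_ideal_mult[OF xs d(2)] by simp
      ultimately have "(x' - x) * y' + x * (y' - y) \<in> frac_ideal (int m)"
        by (rule frac_ideal_add)
      then show ?thesis
        using m by (auto simp: coset_def algebra_simps)
    qed
    then have "C (int m + s) n \<times> C (int m + s) n' \<subseteq> P"
      unfolding n[symmetric] by (auto simp: P_def)
    moreover have "z \<in> C (int m + s) n \<times> C (int m + s) n'"
      unfolding n[symmetric] xy by (simp add: self_in_coset)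
    ultimately show "z \<in> (\<Union>(m, n, n')\<in>I. C m n \<times> C m n')"
      by (intro UN_I[of "(int m + s, n, n')"]) (simp_all add: I_def)
  qed
  then have "P = (\<Union>(m, n, n')\<in>I. C m n \<times> C m n')"
    by (auto simp: I_def)
  also have "\<dots> \<in> sets (borel \<Otimes>\<^sub>M borel)"
    unfolding C_def by (intro sets.countable_UN') (auto intro!: pair_measureI)
  finally show "(\<lambda>z. fst z * snd z) -` U \<inter> space (borel \<Otimes>\<^sub>M borel) \<in> sets (borel \<Otimes>\<^sub>M borel)"
    by (simp add: P_def vimage_def space_pair_measure)
qed

end

context wavelet_setting begin

lemma space_haar [simp]: "space \<mu> = UNIV"
  using sets_eq_imp_space_eq[OF sets_haar] by simp

declare sets_haar [measurable_cong]

lemma measurable_chi [measurable]: "chi \<in> borel_measurable borel"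
  using char_continuous by (rule borel_measurable_continuous_onI)

lemma haar_coset: "emeasure \<mu> (coset a m) = emeasure \<mu> (frac_ideal m)"
proof -
  have "coset a m = (+) a ` frac_ideal m"
    by (auto simp: coset_def image_iff) (metis add.commute diff_add_cancel)
  then show ?thesis
    by (simp add: haar_translate)
qed

lemma frac_ideal_subcosets:
  "frac_ideal m = (\<Union>n<q ^ r. coset (\<pi> powi (m + int r) * \<gamma> n) (m + int r))" (is ?eq)
  "disjoint_family_on (\<lambda>n. coset (\<pi> powi (m + int r) * \<gamma> n) (m + int r)) UNIV" (is ?disj)
proof -
  let ?k = "m + int r"
  have scale: "x - \<pi> powi k * \<gamma> n = \<pi> powi k * (\<pi> powi (- k) * x - \<gamma> n)" for x n k
    by (simp add: power_int_minus field_simps)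
  have iff: "x \<in> coset (\<pi> powi ?k * \<gamma> n) ?k \<longleftrightarrow> \<pi> powi (- ?k) * x - \<gamma> n \<in> frac_ideal 0" for x n
    unfolding coset_def mem_Collect_eq scale[of x ?k n] pi_powi_mult_iff by simp
  have "x \<in> frac_ideal m \<longleftrightarrow> \<pi> powi (- ?k) * x \<in> frac_ideal (- int r)" for x
    by (subst pi_powi_mult_iff) simp
  moreover have "y \<in> frac_ideal (- int r) \<longleftrightarrow> (\<exists>n<q ^ r. y - \<gamma> n \<in> frac_ideal 0)" for y
  proof
    assume "\<exists>n<q ^ r. y - \<gamma> n \<in> frac_ideal 0"
    then obtain n where n: "n < q ^ r" "y - \<gamma> n \<in> frac_ideal 0"
      by blast
    then have "(y - \<gamma> n) + \<gamma> n \<in> frac_ideal (- int r)"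
      using frac_ideal_mono[of "- int r" 0] u_in by (intro frac_ideal_add) auto
    then show "y \<in> frac_ideal (- int r)"
      by simp
  qed (rule u_complete)
  ultimately show ?eq
    by (auto simp: iff)
  show ?disj
    unfolding disjoint_family_on_def
  proof (intro ballI impI)
    fix n n' :: nat assume "n \<noteq> n'"
    have False if "x - \<gamma> n \<in> frac_ideal 0" "x - \<gamma> n' \<in> frac_ideal 0" for x
    proof -
      have "\<gamma> n - \<gamma> n' \<in> frac_ideal 0"
        using frac_ideal_diff[OF that(2,1)] by simp
      then show False
        using u_inj \<open>n \<noteq> n'\<close> by blast
    qed
    then show "coset (\<pi> powi ?k * \<gamma> n) ?k \<inter> coset (\<pi> powi ?k * \<gamma> n') ?k = {}"
      using iff by blast
  qed
qed

text \<open>Each \<open>\<pi>\<^sup>m \<O>\<close> splits into \<open>q\<^sup>r\<close> translates of \<open>\<pi>\<^sup>m\<^sup>+\<^sup>r \<O>\<close>, and \<open>\<O>\<close> has measure one.\<close>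

lemma haar_frac_ideal: "emeasure \<mu> (frac_ideal m) = ennreal (Q powi (- m))"
proof -
  have step: "emeasure \<mu> (frac_ideal m) = ennreal (Q ^ r) * emeasure \<mu> (frac_ideal (m + int r))" for m r
  proof -
    have "emeasure \<mu> (frac_ideal m) = (\<Sum>n<q ^ r. emeasure \<mu> (coset (\<pi> powi (m + int r) * \<gamma> n) (m + int r)))"
      unfolding frac_ideal_subcosets(1)[of m r]
      by (rule sum_emeasure[symmetric])
        (auto intro: disjoint_family_on_mono[OF _ frac_ideal_subcosets(2)])
    also have "\<dots> = of_nat (q ^ r) * emeasure \<mu> (frac_ideal (m + int r))"
      by (simp add: haar_coset)
    also have "of_nat (q ^ r) = ennreal (Q ^ r)"
      unfolding Q_def by (simp add: ennreal_of_nat_eq_real_of_nat)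
    finally show ?thesis .
  qed
  have unit: "emeasure \<mu> (frac_ideal 0) = 1"
    using haar_normalised by (simp add: frac_ideal_0)
  show ?thesis
  proof (cases "m \<ge> 0")
    case True
    define r where "r = nat m"
    have m: "m = int r"
      using True by (simp add: r_def)
    have "1 = ennreal (Q ^ r) * emeasure \<mu> (frac_ideal m)"
      using step[of 0 r] unit by (simp add: m)
    then have "ennreal (Q powi (- m)) = ennreal (Q powi (- m)) * ennreal (Q ^ r) * emeasure \<mu> (frac_ideal m)"
      by (simp add: mult.assoc flip: \<open>1 = _\<close>)
    also have "ennreal (Q powi (- m)) * ennreal (Q ^ r) = 1"
      using Q_gt_1 by (simp add: m power_int_minus flip: ennreal_mult)
    finally show ?thesis
      by simp
  next
    case False
    define r where "r = nat (- m)"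
    have m: "m = - int r"
      using False by (simp add: r_def)
    show ?thesis
      using step[of m r] unit by (simp add: m)
  qed
qed

lemma haar_frac_ideal_finite: "emeasure \<mu> (frac_ideal m) < \<infinity>"
  by (simp add: haar_frac_ideal)

lemma Union_frac_ideal: "(\<Union>i::nat. frac_ideal (- int i)) = UNIV"
  using ex_nat_frac_ideal by auto

text \<open>
  The cosets form an intersection-stable generator of the Borel sets. Images of \<open>\<mu>\<close> under
  translations and under multiplication by \<open>\<pi>\<^sup>j\<close> are therefore known once they are computed on
  cosets.
\<close>

lemma haar_unique:
  assumes "sets \<nu> = sets borel" "\<And>a m. emeasure \<nu> (coset a m) = s * emeasure \<mu> (frac_ideal m)"
    "s < \<infinity>"
  shows "\<nu> = density \<mu> (\<lambda>_. s)"
proof (rule measure_eqI_generator_eq[OF Int_stable_cosets, where A = "\<lambda>i. frac_ideal (- int i)"])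
  have dens: "emeasure (density \<mu> (\<lambda>_. s)) (coset a m) = s * emeasure \<mu> (frac_ideal m)" for a m
    by (simp add: emeasure_density_const sets_haar haar_coset)
  show "emeasure \<nu> X = emeasure (density \<mu> (\<lambda>_. s)) X" if "X \<in> insert {} (range (case_prod coset))" for X
    using that assms(2) dens by auto
  show "range (\<lambda>i. frac_ideal (- int i)) \<subseteq> insert {} (range (case_prod coset))"
    by (auto simp: image_iff intro!: exI[of _ 0] simp flip: coset_0)
  show "emeasure \<nu> (frac_ideal (- int i)) \<noteq> \<infinity>" for i
    using assms(2)[of 0 "- int i"] assms(3) haar_frac_ideal_finite[of "- int i"]
    by (simp add: coset_0 ennreal_mult_eq_top_iff top.not_eq_extremum)
qed (use assms(1) Union_frac_ideal in \<open>simp_all add: sets_haar sets_borel_cosets\<close>)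

lemma distr_translate: "distr \<mu> borel (\<lambda>x. x + a) = \<mu>"
proof -
  have "(\<lambda>x. x + a) -` coset b m = coset (b - a) m" for b m
    by (auto simp: coset_def algebra_simps)
  then have "distr \<mu> borel (\<lambda>x. x + a) = density \<mu> (\<lambda>_. 1)"
    by (intro haar_unique) (simp_all add: emeasure_distr haar_coset)
  then show ?thesis
    by (simp add: density_1)
qed

lemma distr_scale: "distr \<mu> borel (\<lambda>x. \<pi> powi j * x) = density \<mu> (\<lambda>_. ennreal (Q powi j))"
proof (rule haar_unique)
  fix b m
  have "\<pi> powi j * x - b = \<pi> powi j * (x - \<pi> powi (- j) * b)" for x
    by (simp add: power_int_minus field_simps)
  then have "(\<lambda>x. \<pi> powi j * x) -` coset b m = coset (\<pi> powi (- j) * b) (m - j)"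
    unfolding coset_def by (auto simp: pi_powi_mult_iff)
  then have "emeasure (distr \<mu> borel (\<lambda>x. \<pi> powi j * x)) (coset b m) = ennreal (Q powi (j - m))"
    by (simp add: emeasure_distr haar_coset haar_frac_ideal)
  also have "\<dots> = ennreal (Q powi j) * emeasure \<mu> (frac_ideal m)"
    using power_int_add[of Q j "- m"] by (simp add: haar_frac_ideal less_imp_le flip: ennreal_mult)
  finally show "emeasure (distr \<mu> borel (\<lambda>x. \<pi> powi j * x)) (coset b m)
      = ennreal (Q powi j) * emeasure \<mu> (frac_ideal m)" .
qed auto

lemma integral_translate:
  fixes f :: "'a \<Rightarrow> 'c::{banach, second_countable_topology}"
  assumes "f \<in> borel_measurable borel"
  shows "(\<integral>x. f (x + a) \<partial>\<mu>) = (\<integral>x. f x \<partial>\<mu>)"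
  using integral_distr[of "\<lambda>x. x + a" \<mu> borel f] assms by (simp add: distr_translate)

lemma integrable_translate:
  fixes f :: "'a \<Rightarrow> 'c::{banach, second_countable_topology}"
  assumes "f \<in> borel_measurable borel"
  shows "integrable \<mu> (\<lambda>x. f (x + a)) \<longleftrightarrow> integrable \<mu> f"
  using integrable_distr_eq[of "\<lambda>x. x + a" \<mu> borel f] assms by (simp add: distr_translate)

lemma integral_scale:
  fixes f :: "'a \<Rightarrow> 'c::{banach, second_countable_topology}"
  assumes "f \<in> borel_measurable borel"
  shows "(\<integral>x. f (\<pi> powi j * x) \<partial>\<mu>) = Q powi j *\<^sub>R (\<integral>x. f x \<partial>\<mu>)"
proof -
  have "(\<integral>x. f (\<pi> powi j * x) \<partial>\<mu>) = (\<integral>x. f x \<partial>density \<mu> (\<lambda>_. ennreal (Q powi j)))"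
    using integral_distr[of "\<lambda>x. \<pi> powi j * x" \<mu> borel f] assms by (simp add: distr_scale)
  also have "\<dots> = (\<integral>x. Q powi j *\<^sub>R f x \<partial>\<mu>)"
    using assms by (intro integral_density) (auto simp: less_imp_le)
  finally show ?thesis
    by simp
qed

lemma integrable_scale:
  fixes f :: "'a \<Rightarrow> 'c::{banach, second_countable_topology}"
  assumes "f \<in> borel_measurable borel"
  shows "integrable \<mu> (\<lambda>x. f (\<pi> powi j * x)) \<longleftrightarrow> integrable \<mu> f"
proof -
  have "integrable \<mu> (\<lambda>x. f (\<pi> powi j * x)) \<longleftrightarrow> integrable (density \<mu> (\<lambda>_. ennreal (Q powi j))) f"
    using integrable_distr_eq[of "\<lambda>x. \<pi> powi j * x" \<mu> borel f] assms by (simp add: distr_scale)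
  also have "\<dots> \<longleftrightarrow> integrable \<mu> (\<lambda>x. Q powi j *\<^sub>R f x)"
    using assms by (intro integrable_density) (auto simp: less_imp_le)
  also have "\<dots> \<longleftrightarrow> integrable \<mu> f"
    using integrable_scaleR_right[of "inverse (Q powi j)" \<mu> "\<lambda>x. Q powi j *\<^sub>R f x"]
    by (auto simp: power_int_eq_0_iff)
  finally show ?thesis .
qed

lemma sigma_finite_haar: "sigma_finite_measure \<mu>"
proof
  show "\<exists>A. countable A \<and> A \<subseteq> sets \<mu> \<and> \<Union> A = space \<mu> \<and> (\<forall>a\<in>A. emeasure \<mu> a \<noteq> \<infinity>)"
    using Union_frac_ideal
    by (intro exI[of _ "range (\<lambda>i::nat. frac_ideal (- int i))"]) (auto simp: haar_frac_ideal)
qed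

end

section \<open>Approximation by locally constant functions\<close>

lemma L2_norm_family: "L2_norm M f = family_norm {()} M (\<lambda>_. f)"
  by (simp add: family_norm_def L2_norm_nonneg)

lemma L2_Cauchy_Schwarz:
  "f \<in> L2 M \<Longrightarrow> g \<in> L2 M \<Longrightarrow> cmod (L2_inner M f g) \<le> L2_norm M f * L2_norm M g"
  using family_Cauchy_Schwarz[of "\<lambda>_. f" "{()}" M "\<lambda>_. g"]
  by (simp add: L2_norm_family L2_family_def family_inner_def)

lemma L2_norm_triangle_via:
  assumes "f \<in> L2 M" "g \<in> L2 M" "h \<in> L2 M"
  shows "L2_norm M (\<lambda>x. f x - g x) \<le> L2_norm M (\<lambda>x. f x - h x) + L2_norm M (\<lambda>x. h x - g x)"
proof -
  have "L2_norm M (\<lambda>x. (f x - h x) - (g x - h x))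
      \<le> L2_norm M (\<lambda>x. f x - h x) + L2_norm M (\<lambda>x. g x - h x)"
    using family_norm_triangle_diff[of "\<lambda>_ x. f x - h x" "{()}" M "\<lambda>_ x. g x - h x"] assms
    by (simp add: L2_norm_family L2_family_def L2_diff)
  also have "L2_norm M (\<lambda>x. g x - h x) = L2_norm M (\<lambda>x. h x - g x)"
    by (simp add: L2_norm_def norm_minus_commute)
  finally show ?thesis
    by simp
qed

lemma L2_norm_scale: "L2_norm M (\<lambda>x. z * f x) = cmod z * L2_norm M f"
  by (simp add: L2_norm_def norm_mult power_mult_distrib real_sqrt_mult)

lemma L2_dominated_convergence:
  fixes f :: "nat \<Rightarrow> 'a \<Rightarrow> complex"
  assumes g: "g \<in> L2 M" and F: "F \<in> borel_measurable M" and f: "\<And>n. f n \<in> borel_measurable M"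
    and le: "\<And>n x. x \<in> space M \<Longrightarrow> cmod (f n x) \<le> C * cmod (g x)"
    and lim: "\<And>x. x \<in> space M \<Longrightarrow> (\<lambda>n. f n x) \<longlonglongrightarrow> F x"
  shows "(\<lambda>n. L2_norm M (\<lambda>x. F x - f n x)) \<longlonglongrightarrow> 0"
proof -
  have "(\<lambda>n. \<integral>x. (cmod (F x - f n x))\<^sup>2 \<partial>M) \<longlonglongrightarrow> (\<integral>x. 0 \<partial>M)"
  proof (rule integral_dominated_convergence)
    show "integrable M (\<lambda>x. (2 * C)\<^sup>2 * (cmod (g x))\<^sup>2)"
      using L2_integrable_sq[OF g] by simp
    show "(\<lambda>x. (cmod (F x - f n x))\<^sup>2) \<in> borel_measurable M" for n
      using F f[of n] by measurable
    show "AE x in M. (\<lambda>n. (cmod (F x - f n x))\<^sup>2) \<longlonglongrightarrow> 0"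
    proof (rule AE_I2)
      fix x assume "x \<in> space M"
      then have "(\<lambda>n. (cmod (F x - f n x))\<^sup>2) \<longlonglongrightarrow> (cmod (F x - F x))\<^sup>2"
        by (intro tendsto_intros lim)
      then show "(\<lambda>n. (cmod (F x - f n x))\<^sup>2) \<longlonglongrightarrow> 0"
        by simp
    qed
    show "AE x in M. norm ((cmod (F x - f n x))\<^sup>2) \<le> (2 * C)\<^sup>2 * (cmod (g x))\<^sup>2" for n
    proof (rule AE_I2)
      fix x assume x: "x \<in> space M"
      have "cmod (F x) \<le> C * cmod (g x)"
        using le[OF x] by (intro LIMSEQ_le_const2[OF tendsto_norm[OF lim[OF x]]]) auto
      then have "cmod (F x - f n x) \<le> 2 * C * cmod (g x)"
        using le[OF x, of n] norm_triangle_ineq4[of "F x" "f n x"] by linarith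
      then have "(cmod (F x - f n x))\<^sup>2 \<le> (2 * C * cmod (g x))\<^sup>2"
        by (intro power_mono) auto
      then show "norm ((cmod (F x - f n x))\<^sup>2) \<le> (2 * C)\<^sup>2 * (cmod (g x))\<^sup>2"
        by (simp add: power_mult_distrib)
    qed
  qed auto
  then have "(\<lambda>n. sqrt (\<integral>x. (cmod (F x - f n x))\<^sup>2 \<partial>M)) \<longlonglongrightarrow> sqrt 0"
    by (intro tendsto_real_sqrt) simp
  then show ?thesis
    by (simp add: L2_norm_def)
qed

context wavelet_setting begin

text \<open>
  The Schwartz--Bruhat functions, with the support \<open>\<pi>\<^sup>N \<O>\<close> and the period \<open>\<pi>\<^sup>m \<O>\<close> made explicit
  because the Fourier transform exchanges them: it maps this class to support \<open>\<pi>\<^sup>-\<^sup>m \<O>\<close> and period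
  \<open>\<pi>\<^sup>-\<^sup>N \<O>\<close>.
\<close>

definition schwartz_at :: "int \<Rightarrow> int \<Rightarrow> ('a \<Rightarrow> complex) \<Rightarrow> bool" where
  "schwartz_at N m f \<longleftrightarrow> (\<forall>x. x \<notin> frac_ideal N \<longrightarrow> f x = 0) \<and>
    (\<forall>x. \<forall>y\<in>frac_ideal m. f (x + y) = f x)"

definition schwartz :: "('a \<Rightarrow> complex) set" where
  "schwartz = {f. \<exists>N m. schwartz_at N m f}"

lemma schwartzI:
  assumes "\<And>x. x \<notin> frac_ideal N \<Longrightarrow> f x = 0" "\<And>x y. y \<in> frac_ideal m \<Longrightarrow> f (x + y) = f x"
  shows "f \<in> schwartz"
  unfolding schwartz_def schwartz_at_def using assms by blast

lemma schwartzE: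
  assumes "f \<in> schwartz"
  obtains N m where "schwartz_at N m f"
  using assms unfolding schwartz_def by blast

lemma schwartz_atD:
  assumes "schwartz_at N m f"
  shows "\<And>x. x \<notin> frac_ideal N \<Longrightarrow> f x = 0" "\<And>x y. y \<in> frac_ideal m \<Longrightarrow> f (x + y) = f x"
  using assms unfolding schwartz_at_def by blast+

lemma schwartz_zero: "(\<lambda>x. 0) \<in> schwartz"
  by (rule schwartzI[of 0 _ 0]) auto

lemma schwartz_binop:
  assumes "f \<in> schwartz" "g \<in> schwartz" "h 0 0 = 0"
  shows "(\<lambda>x. h (f x) (g x)) \<in> schwartz"
proof -
  obtain N m where "schwartz_at N m f"
    using assms(1) by (rule schwartzE)
  note f = schwartz_atD[OF this]
  obtain N' m' where "schwartz_at N' m' g"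
    using assms(2) by (rule schwartzE)
  note g = schwartz_atD[OF this]
  show ?thesis
  proof (rule schwartzI[of "min N N'" _ "max m m'"])
    fix x assume "x \<notin> frac_ideal (min N N')"
    then have "x \<notin> frac_ideal N" "x \<notin> frac_ideal N'"
      using frac_ideal_mono[of "min N N'" N x] frac_ideal_mono[of "min N N'" N' x] by auto
    then show "h (f x) (g x) = 0"
      using f g assms(3) by simp
  next
    fix x y assume "y \<in> frac_ideal (max m m')"
    then have "y \<in> frac_ideal m" "y \<in> frac_ideal m'"
      using frac_ideal_mono[of _ "max m m'" y] by auto
    then show "h (f (x + y)) (g (x + y)) = h (f x) (g x)"
      using f g by simp
  qed
qed

lemma schwartz_diff: "f \<in> schwartz \<Longrightarrow> g \<in> schwartz \<Longrightarrow> (\<lambda>x. f x - g x) \<in> schwartz"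
  by (rule schwartz_binop[where h = "(-)"]) auto

lemma schwartz_mult: "f \<in> schwartz \<Longrightarrow> g \<in> schwartz \<Longrightarrow> (\<lambda>x. f x * g x) \<in> schwartz"
  by (rule schwartz_binop[where h = "(*)"]) auto

lemma schwartz_scale: "f \<in> schwartz \<Longrightarrow> (\<lambda>x. z * f x) \<in> schwartz"
  using schwartz_binop[of f f "\<lambda>x y. z * x"] by simp

lemma schwartz_cnj: "f \<in> schwartz \<Longrightarrow> (\<lambda>x. cnj (f x)) \<in> schwartz"
  using schwartz_binop[of f f "\<lambda>x y. cnj x"] by simp

lemma schwartz_indicator: "(\<lambda>x. indicator (coset a m) x) \<in> schwartz"
proof -
  obtain N where N: "a \<in> frac_ideal (- int N)"
    using ex_nat_frac_ideal by blast
  show ?thesis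
  proof (rule schwartzI[of "min (- int N) m" _ m])
    fix x assume x: "x \<notin> frac_ideal (min (- int N) m)"
    have "x \<notin> coset a m"
    proof
      assume "x \<in> coset a m"
      then have "(x - a) + a \<in> frac_ideal (min (- int N) m)"
        using N by (intro frac_ideal_add) (auto simp: coset_def intro: frac_ideal_mono[rotated])
      then show False
        using x by simp
    qed
    then show "indicator (coset a m) x = (0 :: complex)"
      by simp
  next
    fix x y assume "y \<in> frac_ideal m"
    then have "x + y \<in> coset a m \<longleftrightarrow> x \<in> coset a m"
      using frac_ideal_add_iff[of y m "x - a"] by (simp add: coset_def algebra_simps)
    then show "indicator (coset a m) (x + y) = (indicator (coset a m) x :: complex)"
      by (simp add: indicator_def)
  qed
qed

lemma schwartz_measurable: "f \<in> schwartz \<Longrightarrow> f \<in> borel_measurable borel"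
proof (rule borel_measurableI)
  fix U :: "complex set"
  assume "f \<in> schwartz"
  then obtain N m where "schwartz_at N m f"
    by (rule schwartzE)
  note f = schwartz_atD(2)[OF this]
  have "y \<in> f -` U" if "x \<in> f -` U" "y \<in> coset x m" for x y
    using f[of "y - x" x] that by (simp add: coset_def)
  then have "f -` U = (\<Union>x\<in>f -` U. coset x m)"
    using self_in_coset by blast
  also have "open \<dots>"
    unfolding coset_def using open_coset by blast
  finally show "f -` U \<inter> space borel \<in> sets borel"
    by simp
qed

lemma schwartz_bounded:
  assumes "f \<in> schwartz"
  obtains C where "\<And>x. cmod (f x) \<le> C"
proof -
  obtain N m where "schwartz_at N m f"
    using assms by (rule schwartzE)
  note f = schwartz_atD[OF this]
  define r where "r = nat (max N m - N)"
  define k where "k = N + int r"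
  have "m \<le> k"
    by (simp add: k_def r_def)
  define C where "C = (\<Sum>n<q ^ r. cmod (f (\<pi> powi k * \<gamma> n)))"
  have "cmod (f x) \<le> C" for x
  proof (cases "x \<in> frac_ideal N")
    case True
    then obtain n where n: "n < q ^ r" "x \<in> coset (\<pi> powi k * \<gamma> n) k"
      using frac_ideal_subcosets(1)[of N r] by (auto simp: k_def)
    then have "f x = f (\<pi> powi k * \<gamma> n)"
      using f(2)[of "x - \<pi> powi k * \<gamma> n" "\<pi> powi k * \<gamma> n"] frac_ideal_mono[OF \<open>m \<le> k\<close>]
      by (simp add: coset_def)
    then show ?thesis
      unfolding C_def using n(1) member_le_sum[of n "{..<q ^ r}" "\<lambda>n. cmod (f (\<pi> powi k * \<gamma> n))"] by simp
  next
    case False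
    then show ?thesis
      by (simp add: f(1) C_def sum_nonneg)
  qed
  then show ?thesis
    by (rule that)
qed

lemma bounded_support_integrable:
  fixes f :: "'a \<Rightarrow> 'c::{banach, second_countable_topology}"
  assumes "f \<in> borel_measurable borel" "\<And>x. norm (f x) \<le> C" "\<And>x. x \<notin> frac_ideal N \<Longrightarrow> f x = 0"
  shows "integrable \<mu> f"
proof (rule Bochner_Integration.integrable_bound)
  show "integrable \<mu> (\<lambda>x. C * indicator (frac_ideal N) x)"
    by (intro integrable_mult_right integrable_real_indicator) (auto simp: haar_frac_ideal)
  show "f \<in> borel_measurable \<mu>"
    using assms(1) by measurable
  have "norm (f x) \<le> norm (C * indicator (frac_ideal N) x)" for x
    using assms(2)[of x] assms(3)[of x] by (auto simp: indicator_def)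
  then show "AE x in \<mu>. norm (f x) \<le> norm (C * indicator (frac_ideal N) x)"
    by simp
qed

lemma bounded_support_L2:
  assumes "f \<in> borel_measurable borel" "\<And>x. cmod (f x) \<le> C" "\<And>x. x \<notin> frac_ideal N \<Longrightarrow> f x = 0"
  shows "f \<in> L2 \<mu>"
proof -
  have "integrable \<mu> (\<lambda>x. (cmod (f x))\<^sup>2)"
  proof (rule bounded_support_integrable)
    show "norm ((cmod (f x))\<^sup>2) \<le> C\<^sup>2" for x
      using assms(2)[of x] by (simp add: power_mono)
  qed (use assms in auto)
  then show ?thesis
    using assms(1) unfolding L2_def by simp
qed

lemma schwartz_integrable: "f \<in> schwartz \<Longrightarrow> integrable \<mu> f"
  using schwartz_measurable schwartz_bounded schwartzE schwartz_atD(1) bounded_support_integrable by metis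

lemma schwartz_L2: "f \<in> schwartz \<Longrightarrow> f \<in> L2 \<mu>"
  using schwartz_measurable schwartz_bounded schwartzE schwartz_atD(1) bounded_support_L2 by metis

definition approximable :: "('a \<Rightarrow> complex) \<Rightarrow> bool" where
  "approximable f \<longleftrightarrow> f \<in> L2 \<mu> \<and> (\<forall>e>0. \<exists>g\<in>schwartz. L2_norm \<mu> (\<lambda>x. f x - g x) < e)"

lemma approximable_schwartz: "f \<in> schwartz \<Longrightarrow> approximable f"
  unfolding approximable_def by (auto intro!: schwartz_L2 bexI[of _ f] simp: L2_norm_def)

lemma approximable_limit:
  assumes "f \<in> L2 \<mu>" "\<And>n. approximable (g n)" "(\<lambda>n. L2_norm \<mu> (\<lambda>x. f x - g n x)) \<longlonglongrightarrow> 0"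
  shows "approximable f"
  unfolding approximable_def
proof (intro conjI allI impI assms(1))
  fix e :: real assume "e > 0"
  then have "\<forall>\<^sub>F n in sequentially. L2_norm \<mu> (\<lambda>x. f x - g n x) < e / 2"
    using assms(3) by (intro order_tendstoD) auto
  then obtain n where n: "L2_norm \<mu> (\<lambda>x. f x - g n x) < e / 2"
    by (auto simp: eventually_sequentially)
  obtain h where h: "h \<in> schwartz" "L2_norm \<mu> (\<lambda>x. g n x - h x) < e / 2"
    using assms(2)[of n] \<open>e > 0\<close> unfolding approximable_def by (meson half_gt_zero)
  have "L2_norm \<mu> (\<lambda>x. f x - h x) < e"
    using L2_norm_triangle_via[of f \<mu> h "g n"] n h assms(1,2) schwartz_L2[of h]
    by (simp add: approximable_def)
  then show "\<exists>h\<in>schwartz. L2_norm \<mu> (\<lambda>x. f x - h x) < e"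
    using h(1) by blast
qed

lemma approximable_diff:
  assumes "approximable f" "approximable g"
  shows "approximable (\<lambda>x. f x - g x)"
  unfolding approximable_def
proof (intro conjI allI impI)
  show "(\<lambda>x. f x - g x) \<in> L2 \<mu>"
    using assms by (auto simp: approximable_def intro: L2_diff)
  fix e :: real assume "e > 0"
  then obtain h k where h: "h \<in> schwartz" "L2_norm \<mu> (\<lambda>x. f x - h x) < e / 2"
      and k: "k \<in> schwartz" "L2_norm \<mu> (\<lambda>x. g x - k x) < e / 2"
    using assms unfolding approximable_def by (meson half_gt_zero)
  have "L2_norm \<mu> (\<lambda>x. (f x - h x) - (g x - k x)) \<le> L2_norm \<mu> (\<lambda>x. f x - h x - 0)
      + L2_norm \<mu> (\<lambda>x. 0 - (g x - k x))"
    using assms h(1) k(1) schwartz_L2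
    by (intro L2_norm_triangle_via L2_diff L2_zero) (auto simp: approximable_def)
  also have "\<dots> < e"
    using h k by (simp add: L2_norm_def norm_minus_commute)
  finally have "L2_norm \<mu> (\<lambda>x. (f x - g x) - (h x - k x)) < e"
    by (simp add: algebra_simps)
  then show "\<exists>h\<in>schwartz. L2_norm \<mu> (\<lambda>x. f x - g x - h x) < e"
    by (intro bexI[of _ "\<lambda>x. h x - k x"] schwartz_diff h(1) k(1))
qed

lemma approximable_scale:
  assumes "approximable f"
  shows "approximable (\<lambda>x. z * f x)"
  unfolding approximable_def
proof (intro conjI allI impI)
  show "(\<lambda>x. z * f x) \<in> L2 \<mu>"
    using assms by (auto simp: approximable_def intro: L2_scale)
  fix e :: real assume "e > 0"
  then have "e / (cmod z + 1) > 0"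
    by (intro divide_pos_pos) (auto intro: add_nonneg_pos)
  then obtain h where h: "h \<in> schwartz" "L2_norm \<mu> (\<lambda>x. f x - h x) < e / (cmod z + 1)"
    using assms unfolding approximable_def by blast
  have "L2_norm \<mu> (\<lambda>x. z * f x - z * h x) = cmod z * L2_norm \<mu> (\<lambda>x. f x - h x)"
    using L2_norm_scale[of \<mu> z "\<lambda>x. f x - h x"] by (simp add: right_diff_distrib)
  also have "\<dots> \<le> (cmod z + 1) * L2_norm \<mu> (\<lambda>x. f x - h x)"
    by (intro mult_right_mono) (auto simp: L2_norm_nonneg)
  also have "\<dots> < e"
    using h(2) by (simp add: pos_less_divide_eq mult.commute add_nonneg_pos)
  finally show "\<exists>h\<in>schwartz. L2_norm \<mu> (\<lambda>x. z * f x - h x) < e"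
    by (intro bexI[of _ "\<lambda>x. z * h x"] schwartz_scale h(1))
qed

lemma approximable_add: "approximable f \<Longrightarrow> approximable g \<Longrightarrow> approximable (\<lambda>x. f x + g x)"
  using approximable_diff[of f "\<lambda>x. - 1 * g x"] approximable_scale[of g "-1"] by simp

lemma approximable_sum:
  "(\<And>a. a \<in> A \<Longrightarrow> approximable (f a)) \<Longrightarrow> approximable (\<lambda>x. \<Sum>a\<in>A. f a x)"
  by (induction A rule: infinite_finite_induct)
    (auto intro: approximable_add approximable_schwartz schwartz_zero)

text \<open>
  The sets \<open>A\<close> with this property form a Dynkin system that contains the cosets, an
  intersection-stable generator. The fixed ball keeps all measures finite.
\<close>

lemma approximable_indicator:
  assumes "A \<in> sets borel"
  shows "approximable (\<lambda>x. indicator A x * indicator (frac_ideal N) x)"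
proof -
  have "insert {} (range (case_prod coset)) \<subseteq> Pow (UNIV :: 'a set)"
    by simp
  from Int_stable_cosets this assms[unfolded sets_borel_cosets] show ?thesis
proof (induction A rule: sigma_sets_induct_disjoint)
  case (basic A)
  then show ?case
    using approximable_schwartz[OF schwartz_mult[OF schwartz_indicator schwartz_indicator[of 0 N]]]
      approximable_schwartz[OF schwartz_zero]
    by (auto simp: coset_0)
next
  case empty
  then show ?case
    using approximable_schwartz[OF schwartz_zero] by simp
next
  case (compl A)
  have "(\<lambda>x. indicator (UNIV - A) x * indicator (frac_ideal N) x :: complex)
      = (\<lambda>x. indicator (coset 0 N) x - indicator A x * indicator (frac_ideal N) x)"
    by (auto simp: indicator_def coset_0)
  then show ?case
    using approximable_diff[OF approximable_schwartz[OF schwartz_indicator] compl.IH] by simp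
next
  case (union A)
  let ?g = "\<lambda>n x. \<Sum>i<n. indicator (A i) x * indicator (frac_ideal N) x :: complex"
  let ?f = "\<lambda>x. indicator (\<Union>i. A i) x * indicator (frac_ideal N) x :: complex"
  have A: "A i \<in> sets borel" for i
    using union by (auto simp: sets_borel_cosets)
  have g: "?g n x = indicator (\<Union>i<n. A i) x * indicator (frac_ideal N) x" for n x
    unfolding sum_distrib_right[symmetric]
    using disjoint_family_on_mono[OF subset_UNIV union(1)]
    by (subst indicator_UN_disjoint) auto
  show ?case
  proof (rule approximable_limit)
    show "?f \<in> L2 \<mu>"
      using A by (intro bounded_support_L2[where C = 1 and N = N]) (auto simp: indicator_def)
    show "approximable (?g n)" for n
      using union by (intro approximable_sum)
    show "(\<lambda>n. L2_norm \<mu> (\<lambda>x. ?f x - ?g n x)) \<longlonglongrightarrow> 0"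
    proof (rule L2_dominated_convergence[where C = 1])
      show "(\<lambda>x. indicator (coset 0 N) x) \<in> L2 \<mu>"
        by (intro schwartz_L2 schwartz_indicator)
      show "cmod (?g n x) \<le> 1 * cmod (indicator (coset 0 N) x)" for n x
        unfolding g by (auto simp: indicator_def coset_0)
      show "(\<lambda>n. ?g n x) \<longlonglongrightarrow> ?f x" for x
        unfolding g by (intro tendsto_mult LIMSEQ_indicator_UN tendsto_const)
    qed (use A in measurable)
  qed
qed
qed

text \<open>
  Pointwise approximation by simple functions, cut off to growing balls, reduces the claim by
  dominated convergence to indicators of bounded Borel sets.
\<close>

lemma schwartz_dense:
  assumes "f \<in> L2 \<mu>"
  shows "approximable f"
proof -
  have "f \<in> borel_measurable \<mu>"
    using assms by (rule L2_measurable)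
  then obtain F where F: "\<And>i. simple_function \<mu> (F i)"
      "\<And>x. (\<lambda>i. F i x) \<longlonglongrightarrow> f x" "\<And>i x. cmod (F i x) \<le> 2 * cmod (f x)"
    using borel_measurable_implies_sequence_metric[of f \<mu> 0] by auto
  let ?g = "\<lambda>n x. F n x * indicator (frac_ideal (- int n)) x"
  have meas: "F n \<in> borel_measurable borel" for n
    using F(1)[of n] borel_measurable_simple_function[of \<mu> "F n"] by (simp add: sets_haar cong: measurable_cong_sets)
  have g: "?g n = (\<lambda>x. \<Sum>v\<in>range (F n). v * (indicator (F n -` {v}) x * indicator (frac_ideal (- int n)) x))" for n
  proof
    fix x
    have fin: "finite (range (F n))"
      using F(1)[of n] by (simp add: simple_function_def)
    have "(\<Sum>v\<in>range (F n). v * (indicator (F n -` {v}) x * indicator (frac_ideal (- int n)) x))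
        = (\<Sum>v\<in>range (F n). if F n x = v then v * indicator (frac_ideal (- int n)) x else 0)"
      by (intro sum.cong) auto
    also have "\<dots> = ?g n x"
      using fin by (subst sum.delta') auto
    finally show "?g n x = (\<Sum>v\<in>range (F n). v * (indicator (F n -` {v}) x * indicator (frac_ideal (- int n)) x))"
      by simp
  qed
  show ?thesis
  proof (rule approximable_limit[OF assms])
    show "approximable (?g n)" for n
      unfolding g using measurable_sets[OF meas[of n], of "{_}"]
      by (intro approximable_sum approximable_scale approximable_indicator) auto
    show "(\<lambda>n. L2_norm \<mu> (\<lambda>x. f x - ?g n x)) \<longlonglongrightarrow> 0"
    proof (rule L2_dominated_convergence[OF assms, where C = 2])
      show "f \<in> borel_measurable \<mu>" by fact
      show "?g n \<in> borel_measurable \<mu>" for n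
        using meas[of n] by measurable
      show "cmod (?g n x) \<le> 2 * cmod (f x)" for n x
        using F(3)[of n x] by (auto simp: indicator_def)
      fix x
      obtain N where N: "x \<in> frac_ideal (- int N)"
        using ex_nat_frac_ideal by blast
      have "\<forall>\<^sub>F n in sequentially. F n x = ?g n x"
        unfolding eventually_sequentially
        using frac_ideal_mono[OF _ N] by (intro exI[of _ N]) auto
      then show "(\<lambda>n. ?g n x) \<longlonglongrightarrow> f x"
        using F(2)[of x] by (rule Lim_transform_eventually[rotated])
    qed
  qed
qed

end

context wavelet_setting begin

section \<open>The Fourier transform\<close>

lemma chi_0 [simp]: "chi 0 = 1"
  by (rule char_trivial) (simp add: ring_of_integers_def)

lemma measurable_chi_mult [measurable]:
  "(\<lambda>x. chi (b * x)) \<in> borel_measurable borel" "(\<lambda>x. chi (x * b)) \<in> borel_measurable borel"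
  using measurable_compose[OF measurable_mult_const measurable_chi, of b] by (simp_all add: mult.commute)

lemma chi_one: "x \<in> frac_ideal 0 \<Longrightarrow> chi x = 1"
  by (rule char_trivial) (simp add: frac_ideal_0)

lemma chi_nonzero [simp]: "chi x \<noteq> 0"
  using char_unimodular[of x] by auto

lemma chi_cnj: "chi x * cnj (chi x) = 1"
  using complex_norm_square[of "chi x"] by (simp add: char_unimodular)

lemma chi_minus: "chi (- x) = cnj (chi x)"
proof -
  have "chi x * chi (- x) = chi x * cnj (chi x)"
    using char_add[of x "- x"] by (simp add: chi_cnj)
  then show ?thesis
    by simp
qed

lemma chi_diff: "chi (x - y) = chi x * cnj (chi y)"
  using char_add[of x "- y"] by (simp add: chi_minus)

lemma chi_nontrivial_on:
  assumes "y \<notin> frac_ideal (- m)"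
  obtains b where "b \<in> frac_ideal m" "chi (y * b) \<noteq> 1"
proof -
  obtain x where x: "x \<in> ring_of_integers absv" "chi (inverse \<pi> * x) \<noteq> 1"
    using char_nontrivial by blast
  have "inverse \<pi> * x \<in> frac_ideal (-1)"
    using x(1) pi_powi_mult_iff[of "-1" x "-1"] by (simp add: frac_ideal_0 power_int_minus)
  then have "inverse y * (inverse \<pi> * x) \<in> frac_ideal m"
    using inverse_mult_in_frac_ideal[OF assms, of _ m] by simp
  moreover have "y \<noteq> 0"
    using assms by auto
  then have "chi (y * (inverse y * (inverse \<pi> * x))) \<noteq> 1"
    using x(2) by (simp flip: mult.assoc)
  ultimately show ?thesis
    by (rule that)
qed

lemma chi_trivial_on: "y \<in> frac_ideal (- m) \<Longrightarrow> b \<in> frac_ideal m \<Longrightarrow> chi (y * b) = 1"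
  using frac_ideal_mult[of y "- m" b m] by (intro chi_one) simp

text \<open>
  Translating the variable by \<open>b \<in> \<pi>\<^sup>-\<^sup>m \<O>\<close> multiplies the integral by \<open>\<chi>(y b)\<close>. Unless \<open>y \<in> \<pi>\<^sup>m \<O>\<close>,
  some such value differs from one and the integral vanishes.
\<close>

lemma integral_char:
  "(\<integral>\<xi>. indicator (frac_ideal (- m)) \<xi> * chi (\<xi> * y) \<partial>\<mu>)
    = of_real (Q powi m) * indicator (frac_ideal m) y"
proof (cases "y \<in> frac_ideal m")
  case True
  have "(\<integral>\<xi>. indicator (frac_ideal (- m)) \<xi> * chi (\<xi> * y) \<partial>\<mu>)
      = (\<integral>\<xi>. complex_of_real (indicator (frac_ideal (- m)) \<xi>) \<partial>\<mu>)"
    using True chi_trivial_on[of _ m y]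
    by (intro Bochner_Integration.integral_cong) (auto simp: indicator_def)
  also have "\<dots> = of_real (measure \<mu> (frac_ideal (- m)))"
    by (subst integral_complex_of_real) simp
  also have "measure \<mu> (frac_ideal (- m)) = Q powi m"
    by (simp add: measure_def haar_frac_ideal less_imp_le)
  finally show ?thesis
    using True by simp
next
  case False
  then obtain b where b: "b \<in> frac_ideal (- m)" "chi (y * b) \<noteq> 1"
    using chi_nontrivial_on[of y "- m"] by auto
  let ?f = "\<lambda>\<xi>. indicator (frac_ideal (- m)) \<xi> * chi (\<xi> * y)"
  have "?f (\<xi> + b) = chi (y * b) * ?f \<xi>" for \<xi>
    using frac_ideal_add_iff[OF b(1), of \<xi>] by (simp add: indicator_def distrib_right char_add mult.commute[of b y])
  then have "(\<integral>\<xi>. ?f (\<xi> + b) \<partial>\<mu>) = chi (y * b) * (\<integral>\<xi>. ?f \<xi> \<partial>\<mu>)"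
    by simp
  moreover have "?f \<in> borel_measurable borel"
    using measurable_mult_const[of y] by (simp add: mult.commute[of _ y])
  then have "(\<integral>\<xi>. ?f (\<xi> + b) \<partial>\<mu>) = (\<integral>\<xi>. ?f \<xi> \<partial>\<mu>)"
    by (rule integral_translate)
  ultimately show ?thesis
    using b(2) False by auto
qed

abbreviation ft :: "('a \<Rightarrow> complex) \<Rightarrow> 'a \<Rightarrow> complex" where
  "ft \<equiv> fourier_L1 \<mu> chi"

lemma measurable_kernel [measurable]:
  "(\<lambda>(\<xi>, x). cnj (chi (\<xi> * x))) \<in> borel_measurable (\<mu> \<Otimes>\<^sub>M \<mu>)"
proof -
  have "(\<lambda>z. cnj (chi (fst z * snd z))) \<in> borel_measurable (borel \<Otimes>\<^sub>M borel)"
    by measurable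
  then show ?thesis
    by (simp add: case_prod_beta sets_haar cong: measurable_cong_sets sets_pair_measure_cong)
qed

text \<open>
  Fubini's theorem applies because the kernel has modulus one. The formula serves twice: for the
  inversion formula, and to pair an integrable function with a Schwartz--Bruhat function.
\<close>

lemma ft_multiplication:
  assumes f: "integrable \<mu> f" and g: "integrable \<mu> g"
  shows "(\<integral>\<xi>. ft f \<xi> * g \<xi> \<partial>\<mu>) = (\<integral>x. f x * ft g x \<partial>\<mu>)"
proof -
  interpret sigma_finite_measure \<mu>
    by (rule sigma_finite_haar)
  interpret pair_sigma_finite \<mu> \<mu> ..
  have [measurable]: "f \<in> borel_measurable \<mu>" "g \<in> borel_measurable \<mu>"
    using f g by auto
  define K where "K = (\<lambda>(\<xi>, x). f x * g \<xi> * cnj (chi (\<xi> * x)))"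
  have Km: "K \<in> borel_measurable (\<mu> \<Otimes>\<^sub>M \<mu>)"
    unfolding K_def using measurable_kernel by (simp add: case_prod_beta)
  have normK: "norm (K (\<xi>, x)) = cmod (g \<xi>) * cmod (f x)" for \<xi> x
    by (simp add: K_def norm_mult char_unimodular)
  have K: "integrable (\<mu> \<Otimes>\<^sub>M \<mu>) K"
  proof (rule Fubini_integrable[OF Km])
    show "integrable \<mu> (\<lambda>\<xi>. LINT x|\<mu>. norm (K (\<xi>, x)))"
      unfolding normK using f g by simp
    show "AE \<xi> in \<mu>. integrable \<mu> (\<lambda>x. K (\<xi>, x))"
    proof (rule AE_I2)
      fix \<xi>
      have meas: "(\<lambda>x. K (\<xi>, x)) \<in> borel_measurable \<mu>"
        using measurable_compose[OF measurable_Pair1' Km, of \<xi>] by simp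
      have bound: "integrable \<mu> (\<lambda>x. cmod (g \<xi>) * cmod (f x))"
        using f by simp
      show "integrable \<mu> (\<lambda>x. K (\<xi>, x))"
      proof (rule Bochner_Integration.integrable_bound[OF bound meas], rule AE_I2)
        show "norm (K (\<xi>, x)) \<le> norm (cmod (g \<xi>) * cmod (f x))" for x
          unfolding normK by simp
      qed
    qed
  qed
  have "(\<integral>x. K (\<xi>, x) \<partial>\<mu>) = (\<integral>x. g \<xi> * (f x * cnj (chi (\<xi> * x))) \<partial>\<mu>)" for \<xi>
    by (simp add: K_def mult_ac)
  then have inner1: "(\<integral>x. K (\<xi>, x) \<partial>\<mu>) = g \<xi> * ft f \<xi>" for \<xi>
    unfolding fourier_L1_def by (simp only: integral_mult_right_zero)
  have "(\<integral>\<xi>. K (\<xi>, x) \<partial>\<mu>) = (\<integral>\<xi>. f x * (g \<xi> * cnj (chi (x * \<xi>))) \<partial>\<mu>)" for x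
    by (simp add: K_def mult_ac)
  then have inner2: "(\<integral>\<xi>. K (\<xi>, x) \<partial>\<mu>) = f x * ft g x" for x
    unfolding fourier_L1_def by (simp only: integral_mult_right_zero)
  have "(\<integral>\<xi>. ft f \<xi> * g \<xi> \<partial>\<mu>) = (\<integral>\<xi>. \<integral>x. K (\<xi>, x) \<partial>\<mu> \<partial>\<mu>)"
    unfolding inner1 by (simp only: mult.commute)
  also have "\<dots> = (\<integral>x. \<integral>\<xi>. K (\<xi>, x) \<partial>\<mu> \<partial>\<mu>)"
    using Fubini_integral[of "\<lambda>\<xi> x. K (\<xi>, x)"] K by (simp add: case_prod_eta)
  also have "\<dots> = (\<integral>x. f x * ft g x \<partial>\<mu>)"
    unfolding inner2 ..
  finally show ?thesis .
qed

lemma ft_translate: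
  assumes "f \<in> borel_measurable borel"
  shows "ft (\<lambda>x. f (x + b)) \<xi> = chi (\<xi> * b) * ft f \<xi>"
proof -
  have "f (x + b) * cnj (chi (\<xi> * x)) = chi (\<xi> * b) * (f (x + b) * cnj (chi (\<xi> * (x + b))))" for x
    using chi_cnj[of "\<xi> * b"] by (simp add: distrib_left char_add mult_ac)
  then have "ft (\<lambda>x. f (x + b)) \<xi> = (\<integral>x. chi (\<xi> * b) * (f (x + b) * cnj (chi (\<xi> * (x + b)))) \<partial>\<mu>)"
    unfolding fourier_L1_def by (intro Bochner_Integration.integral_cong refl)
  then have "ft (\<lambda>x. f (x + b)) \<xi> = chi (\<xi> * b) * (\<integral>x. f (x + b) * cnj (chi (\<xi> * (x + b))) \<partial>\<mu>)"
    by simp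
  also have "(\<integral>x. f (x + b) * cnj (chi (\<xi> * (x + b))) \<partial>\<mu>) = ft f \<xi>"
    unfolding fourier_L1_def using assms
    by (intro integral_translate[of "\<lambda>x. f x * cnj (chi (\<xi> * x))"] borel_measurable_times
        borel_measurable_cnj measurable_chi_mult)
  finally show ?thesis .
qed

lemma ft_support:
  assumes "f \<in> borel_measurable borel" "\<And>x y. y \<in> frac_ideal m \<Longrightarrow> f (x + y) = f x"
    "\<xi> \<notin> frac_ideal (- m)"
  shows "ft f \<xi> = 0"
proof -
  obtain b where b: "b \<in> frac_ideal m" "chi (\<xi> * b) \<noteq> 1"
    using chi_nontrivial_on[OF assms(3)] by blast
  then have "ft f \<xi> = chi (\<xi> * b) * ft f \<xi>"
    using ft_translate[OF assms(1), of b \<xi>] assms(2) by simp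
  then show ?thesis
    using b(2) by simp
qed

lemma ft_locally_constant:
  assumes "\<And>x. x \<notin> frac_ideal N \<Longrightarrow> f x = 0" "\<eta> \<in> frac_ideal (- N)"
  shows "ft f (\<xi> + \<eta>) = ft f \<xi>"
proof -
  have "f x * cnj (chi ((\<xi> + \<eta>) * x)) = f x * cnj (chi (\<xi> * x))" for x
    using assms(1)[of x] chi_trivial_on[OF assms(2), of x]
    by (cases "x \<in> frac_ideal N") (simp_all add: distrib_right char_add)
  then show ?thesis
    unfolding fourier_L1_def by (intro Bochner_Integration.integral_cong refl)
qed

lemma ft_schwartz:
  assumes "f \<in> schwartz"
  shows "ft f \<in> schwartz"
proof -
  obtain N m where "schwartz_at N m f"
    using assms by (rule schwartzE)
  note f = schwartz_atD[OF this]
  show ?thesis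
    using ft_support[OF schwartz_measurable[OF assms] f(2)] ft_locally_constant[of N f, OF f(1)]
    by (intro schwartzI[of "- m" _ "- N"]) auto
qed

text \<open>
  If \<open>f\<close> has period \<open>\<pi>\<^sup>m \<O>\<close>, its transform lives on \<open>\<pi>\<^sup>-\<^sup>m \<O>\<close>, and cutting \<open>\<chi>(\<cdot> x)\<close> off to that ball turns the integral into
  the average of \<open>f\<close> over \<open>x + \<pi>\<^sup>m \<O>\<close>, where \<open>f\<close> is constant.
\<close>

lemma ft_inversion:
  assumes "f \<in> schwartz"
  shows "(\<integral>\<xi>. ft f \<xi> * chi (\<xi> * x) \<partial>\<mu>) = f x"
proof -
  obtain N m where "schwartz_at N m f"
    using assms by (rule schwartzE)
  note f = schwartz_atD[OF this]
  let ?g = "\<lambda>\<xi>. indicator (frac_ideal (- m)) \<xi> * chi (\<xi> * x)"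
  have meas: "?g \<in> borel_measurable borel"
    using measurable_mult_const[of x] by (simp add: mult.commute[of _ x])
  have g: "integrable \<mu> ?g"
    by (rule bounded_support_integrable[OF meas, of 1 "- m"])
      (auto simp: indicator_def char_unimodular)
  have "ft f \<xi> * chi (\<xi> * x) = ft f \<xi> * ?g \<xi>" for \<xi>
    using ft_support[of f m \<xi>, OF schwartz_measurable[OF assms] f(2)]
    by (cases "\<xi> \<in> frac_ideal (- m)") simp_all
  then have "(\<integral>\<xi>. ft f \<xi> * chi (\<xi> * x) \<partial>\<mu>) = (\<integral>y. f y * ft ?g y \<partial>\<mu>)"
    using ft_multiplication[OF schwartz_integrable[OF assms] g] by (simp only:)
  also have "\<dots> = (\<integral>y. f x * of_real (Q powi m) * complex_of_real (indicator (coset x m) y) \<partial>\<mu>)"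
  proof -
  have "ft ?g y = of_real (Q powi m) * indicator (frac_ideal m) (x - y)" for y
    using integral_char[of m "x - y"]
    by (simp add: fourier_L1_def right_diff_distrib chi_diff mult_ac)
  moreover have "f y * (of_real (Q powi m) * indicator (frac_ideal m) (x - y))
      = f x * of_real (Q powi m) * complex_of_real (indicator (coset x m) y)" for y
  proof (cases "y \<in> coset x m")
    case True
    then have "x - y \<in> frac_ideal m" "f y = f x"
      using f(2)[of "y - x" x] frac_ideal_diff_commute[of x y m] by (simp_all add: coset_def)
    then show ?thesis
      using True by simp
  next
    case False
    then have "x - y \<notin> frac_ideal m"
      using frac_ideal_diff_commute[of x y m] by (simp add: coset_def)
    then show ?thesis
      using False by simp
  qed
  ultimately show ?thesis
    by (simp only:)
  qed
  also have "\<dots> = f x * of_real (Q powi m) * of_real (measure \<mu> (coset x m))"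
    by (subst integral_mult_right_zero, subst integral_complex_of_real) simp
  also have "measure \<mu> (coset x m) = Q powi (- m)"
    by (simp add: measure_def haar_coset haar_frac_ideal less_imp_le)
  also have "f x * of_real (Q powi m) * of_real (Q powi (- m)) = f x"
    by (simp add: power_int_minus power_int_eq_0_iff)
  finally show ?thesis .
qed

lemma ft_cnj_ft:
  assumes "f \<in> schwartz"
  shows "ft (\<lambda>\<xi>. cnj (ft f \<xi>)) x = cnj (f x)"
proof -
  have "ft (\<lambda>\<xi>. cnj (ft f \<xi>)) x = (\<integral>\<xi>. cnj (ft f \<xi> * chi (\<xi> * x)) \<partial>\<mu>)"
    by (simp add: fourier_L1_def mult.commute)
  then show ?thesis
    using ft_inversion[OF assms, of x] by (simp only: Bochner_Integration.integral_cnj)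
qed

lemma ft_surj:
  assumes "h \<in> schwartz"
  obtains f where "f \<in> schwartz" "ft f = h"
proof
  show "(\<lambda>\<xi>. cnj (ft (\<lambda>x. cnj (h x)) \<xi>)) \<in> schwartz"
    using assms by (intro schwartz_cnj ft_schwartz)
  show "ft (\<lambda>\<xi>. cnj (ft (\<lambda>x. cnj (h x)) \<xi>)) = h"
    using ft_cnj_ft[OF schwartz_cnj[OF assms]] by auto
qed

text \<open>
  Parseval's relation against a Schwartz--Bruhat function needs only integrability of the other
  one, which is what the approximating sequences of an \<open>L\<^sup>2\<close> Fourier transform provide.
\<close>

lemma L2_inner_ft:
  assumes "integrable \<mu> F" "f \<in> schwartz"
  shows "L2_inner \<mu> (ft F) (ft f) = L2_inner \<mu> F f"
proof -
  have "integrable \<mu> (\<lambda>\<xi>. cnj (ft f \<xi>))"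
    using assms(2) by (intro schwartz_integrable schwartz_cnj ft_schwartz)
  from ft_multiplication[OF assms(1) this] show ?thesis
    unfolding L2_inner_def ft_cnj_ft[OF assms(2)] .
qed

lemma L2_norm_ft:
  assumes "f \<in> schwartz"
  shows "L2_norm \<mu> (ft f) = L2_norm \<mu> f"
proof (rule power2_eq_imp_eq)
  have "complex_of_real ((L2_norm \<mu> (ft f))\<^sup>2) = of_real ((L2_norm \<mu> f)\<^sup>2)"
    using L2_inner_ft[OF schwartz_integrable[OF assms] assms] unfolding L2_inner_self .
  then show "(L2_norm \<mu> (ft f))\<^sup>2 = (L2_norm \<mu> f)\<^sup>2"
    unfolding of_real_eq_iff .
qed (auto simp: L2_norm_nonneg)

lemma L2_inner_tendsto:
  assumes "\<And>m. F m \<in> L2 M" "f \<in> L2 M" "g \<in> L2 M" "(\<lambda>m. L2_norm M (\<lambda>x. F m x - f x)) \<longlonglongrightarrow> 0"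
  shows "(\<lambda>m. L2_inner M (F m) g) \<longlonglongrightarrow> L2_inner M f g"
proof (rule LIM_zero_cancel, rule tendsto_norm_zero_cancel, rule tendsto_sandwich[OF _ _ tendsto_const])
  show "\<forall>\<^sub>F m in sequentially. 0 \<le> cmod (L2_inner M (F m) g - L2_inner M f g)"
    by simp
  have "cmod (L2_inner M (F m) g - L2_inner M f g) \<le> L2_norm M (\<lambda>x. F m x - f x) * L2_norm M g" for m
    using L2_Cauchy_Schwarz[OF L2_diff[OF assms(1)[of m] assms(2)] assms(3)] assms(1-3)
    by (simp add: L2_inner_diff_left)
  then show "\<forall>\<^sub>F m in sequentially. cmod (L2_inner M (F m) g - L2_inner M f g)
      \<le> L2_norm M (\<lambda>x. F m x - f x) * L2_norm M g"
    by simp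
  show "(\<lambda>m. L2_norm M (\<lambda>x. F m x - f x) * L2_norm M g) \<longlonglongrightarrow> 0"
    using tendsto_mult_right[OF assms(4), of "L2_norm M g"] by simp
qed

text \<open>Both sides are limits along the sequence that defines the transform of \<open>\<eta>\<close>.\<close>

lemma is_fourier_inner:
  assumes "is_fourier_L2 \<mu> chi \<eta> g" "f \<in> schwartz"
  shows "L2_inner \<mu> g (ft f) = L2_inner \<mu> \<eta> f"
proof -
  obtain F :: "nat \<Rightarrow> 'a \<Rightarrow> complex" where F: "\<And>m. integrable \<mu> (F m)" "\<And>m. F m \<in> L2 \<mu>" "\<And>m. ft (F m) \<in> L2 \<mu>"
      "(\<lambda>m. L2_norm \<mu> (\<lambda>x. F m x - \<eta> x)) \<longlonglongrightarrow> 0"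
      "(\<lambda>m. L2_norm \<mu> (\<lambda>\<xi>. ft (F m) \<xi> - g \<xi>)) \<longlonglongrightarrow> 0"
    and L: "\<eta> \<in> L2 \<mu>" "g \<in> L2 \<mu>"
    using assms(1) unfolding is_fourier_L2_def by blast
  have f: "f \<in> L2 \<mu>" "ft f \<in> L2 \<mu>"
    using assms(2) by (auto intro: schwartz_L2 ft_schwartz)
  have "(\<lambda>m. L2_inner \<mu> (F m) f) \<longlonglongrightarrow> L2_inner \<mu> \<eta> f"
    using F L f by (intro L2_inner_tendsto)
  moreover have "(\<lambda>m. L2_inner \<mu> (ft (F m)) (ft f)) \<longlonglongrightarrow> L2_inner \<mu> g (ft f)"
    using F L f by (intro L2_inner_tendsto)
  ultimately show ?thesis
    using L2_inner_ft[OF F(1) assms(2)] LIMSEQ_unique by simp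
qed

text \<open>
  Along Schwartz--Bruhat functions \<open>f\<close> tending to \<open>g\<close>, the left-hand side of the hypothesis tends to
  the squared norm of \<open>g\<close>, while the right-hand side is at most the product of the norms of \<open>h\<close> and
  \<open>f\<close>. Applied in both directions it makes an \<open>L\<^sup>2\<close> Fourier pair isometric.
\<close>

lemma L2_norm_le_by_duality:
  assumes g: "g \<in> L2 \<mu>" and h: "h \<in> L2 \<mu>"
    and \<phi>: "\<And>f. f \<in> schwartz \<Longrightarrow> \<phi> f \<in> L2 \<mu>" "\<And>f. f \<in> schwartz \<Longrightarrow> L2_norm \<mu> (\<phi> f) = L2_norm \<mu> f"
    and eq: "\<And>f. f \<in> schwartz \<Longrightarrow> L2_inner \<mu> g f = L2_inner \<mu> h (\<phi> f)"
  shows "L2_norm \<mu> g \<le> L2_norm \<mu> h"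
proof -
  let ?G = "L2_norm \<mu> g" and ?H = "L2_norm \<mu> h"
  have "\<exists>f\<in>schwartz. L2_norm \<mu> (\<lambda>x. g x - f x) < inverse (real (Suc n))" for n
    using schwartz_dense[OF g] unfolding approximable_def by simp
  then obtain f where f: "\<And>n. f n \<in> schwartz" "\<And>n. L2_norm \<mu> (\<lambda>x. g x - f n x) < inverse (real (Suc n))"
    by metis
  have fL: "f n \<in> L2 \<mu>" for n
    using f(1) by (rule schwartz_L2)
  have sym: "L2_norm \<mu> (\<lambda>x. f n x - g x) = L2_norm \<mu> (\<lambda>x. g x - f n x)" for n
    by (simp add: L2_norm_def norm_minus_commute)
  have lim: "(\<lambda>n. L2_norm \<mu> (\<lambda>x. f n x - g x)) \<longlonglongrightarrow> 0"
    by (rule tendsto_sandwich[OF _ _ tendsto_const LIMSEQ_inverse_real_of_nat])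
      (use f(2) in \<open>auto simp: sym L2_norm_nonneg less_imp_le\<close>)
  have "cmod (L2_inner \<mu> (f n) g) \<le> ?H * (?G + L2_norm \<mu> (\<lambda>x. f n x - g x))" for n
  proof -
    have "L2_norm \<mu> (f n) \<le> ?G + L2_norm \<mu> (\<lambda>x. f n x - g x)"
      using L2_norm_triangle_via[OF fL L2_zero g, of n] by simp
    then have "?H * L2_norm \<mu> (f n) \<le> ?H * (?G + L2_norm \<mu> (\<lambda>x. f n x - g x))"
      by (intro mult_left_mono) (auto simp: L2_norm_nonneg)
    moreover have "cmod (L2_inner \<mu> (f n) g) = cmod (L2_inner \<mu> h (\<phi> (f n)))"
      using eq[OF f(1)] by (subst L2_inner_commute) simp
    ultimately show ?thesis
      using L2_Cauchy_Schwarz[OF h \<phi>(1)[OF f(1)], of n] by (simp add: \<phi>(2) f(1))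
  qed
  moreover have "(\<lambda>n. cmod (L2_inner \<mu> (f n) g)) \<longlonglongrightarrow> cmod (L2_inner \<mu> g g)"
    by (intro tendsto_norm L2_inner_tendsto fL g lim)
  moreover have "(\<lambda>n. ?H * (?G + L2_norm \<mu> (\<lambda>x. f n x - g x))) \<longlonglongrightarrow> ?H * (?G + 0)"
    by (intro tendsto_intros lim)
  ultimately have "cmod (L2_inner \<mu> g g) \<le> ?H * (?G + 0)"
    by (intro LIMSEQ_le) auto
  then have "?G * ?G \<le> ?H * ?G"
    unfolding L2_inner_self norm_of_real by (simp add: power2_eq_square)
  then show ?thesis
    using L2_norm_nonneg[of \<mu> g] L2_norm_nonneg[of \<mu> h] by (cases "?G = 0") auto
qed

lemma is_fourier_norm:
  assumes "is_fourier_L2 \<mu> chi \<eta> g"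
  shows "L2_norm \<mu> \<eta> = L2_norm \<mu> g"
proof (rule antisym)
  have L: "\<eta> \<in> L2 \<mu>" "g \<in> L2 \<mu>"
    using assms by (auto simp: is_fourier_L2_def)
  show "L2_norm \<mu> \<eta> \<le> L2_norm \<mu> g"
    using L is_fourier_inner[OF assms]
    by (intro L2_norm_le_by_duality[where \<phi> = ft]) (auto intro: schwartz_L2 ft_schwartz simp: L2_norm_ft)
  define \<phi> where "\<phi> f = (SOME h. h \<in> schwartz \<and> ft h = f)" for f
  have \<phi>: "\<phi> f \<in> schwartz \<and> ft (\<phi> f) = f" if "f \<in> schwartz" for f
  proof -
    have "\<exists>h. h \<in> schwartz \<and> ft h = f"
      using ft_surj[OF that] by metis
    then show ?thesis
      unfolding \<phi>_def by (rule someI_ex)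
  qed
  show "L2_norm \<mu> g \<le> L2_norm \<mu> \<eta>"
  proof (rule L2_norm_le_by_duality[where \<phi> = \<phi>])
    fix f assume f: "f \<in> schwartz"
    show "\<phi> f \<in> L2 \<mu>"
      using \<phi>[OF f] by (auto intro: schwartz_L2)
    show "L2_norm \<mu> (\<phi> f) = L2_norm \<mu> f"
      using \<phi>[OF f] L2_norm_ft by force
    show "L2_inner \<mu> g f = L2_inner \<mu> \<eta> (\<phi> f)"
      using \<phi>[OF f] is_fourier_inner[OF assms, of "\<phi> f"] by simp
  qed (use L in auto)
qed

end

context wavelet_setting begin

section \<open>The group of all \<open>u(k)\<close> and Fourier series on the ring of integers\<close>

lemma u_decompose: "\<exists>m. z - \<gamma> m \<in> frac_ideal 0"
  using ex_nat_frac_ideal u_complete by blast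

text \<open>
  The \<open>u(k)\<close> form a group, because they are exactly the annihilator of themselves under the
  pairing \<open>(x, y) \<mapsto> \<chi>(x y)\<close>: if \<open>z = u(m) + w\<close> annihilates them all, with \<open>w\<close> an integer, then
  \<open>w\<close> annihilates both the \<open>u(k)\<close> and \<open>\<O>\<close>, hence the whole field, so \<open>w = 0\<close>.
\<close>

lemma u_annihilator:
  assumes "\<And>k. chi (z * \<gamma> k) = 1"
  shows "\<exists>m. z = \<gamma> m"
proof -
  obtain m where m: "z - \<gamma> m \<in> frac_ideal 0"
    using u_decompose by blast
  let ?w = "z - \<gamma> m"
  have ann: "chi (?w * y) = 1" for y
  proof -
    obtain k where k: "y - \<gamma> k \<in> frac_ideal 0"
      using u_decompose by blast
    have "?w * y = (z * \<gamma> k - \<gamma> m * \<gamma> k) + ?w * (y - \<gamma> k)"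
      by (simp add: algebra_simps)
    then have "chi (?w * y) = chi (z * \<gamma> k - \<gamma> m * \<gamma> k) * chi (?w * (y - \<gamma> k))"
      by (simp only: char_add)
    also have "chi (?w * (y - \<gamma> k)) = 1"
      using frac_ideal_mult[OF m k] by (intro chi_one) simp
    finally show ?thesis
      by (simp add: chi_diff assms char_u)
  qed
  have "?w = 0"
  proof (rule ccontr)
    assume w: "?w \<noteq> 0"
    obtain x where "chi x \<noteq> 1"
      using char_nontrivial by blast
    moreover have "?w * (inverse ?w * x) = x"
      using w by (simp only: mult.assoc[symmetric]) simp
    ultimately show False
      using ann[of "inverse ?w * x"] by (simp only:)
  qed
  then show ?thesis
    by (intro exI[of _ m]) simp
qed

lemma u_diff: "\<exists>m. \<gamma> k - \<gamma> l = \<gamma> m"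
  by (rule u_annihilator) (simp add: left_diff_distrib chi_diff char_u)

lemma coset_u_disjoint: "k \<noteq> l \<Longrightarrow> coset (\<gamma> k) 0 \<inter> coset (\<gamma> l) 0 = {}"
  using frac_ideal_diff[of "_ - \<gamma> l" 0 "_ - \<gamma> k"] u_inj[of k l] by (force simp: coset_def)

lemma in_coset_u_bound:
  assumes "x \<in> coset (\<gamma> k) 0" "x \<in> frac_ideal (- int M)"
  shows "k < q ^ M"
proof -
  obtain n where n: "n < q ^ M" "x - \<gamma> n \<in> frac_ideal 0"
    using u_complete[OF assms(2)] by blast
  then have "n = k"
    using coset_u_disjoint[of n k] assms(1) by (auto simp: coset_def)
  then show ?thesis
    using n by simp
qed

lemma indicator_frac_ideal_u:
  "(\<Sum>k<q ^ M. indicator (coset (\<gamma> k) 0) x) = (indicator (frac_ideal (- int M)) x :: 'c::semiring_1)"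
proof -
  have "frac_ideal (- int M) = (\<Union>k<q ^ M. coset (\<gamma> k) 0)"
    using frac_ideal_subcosets(1)[of "- int M" M] by simp
  moreover have "disjoint_family_on (\<lambda>k. coset (\<gamma> k) 0) {..<q ^ M}"
    using coset_u_disjoint by (auto simp: disjoint_family_on_def)
  ultimately show ?thesis
    by (simp add: indicator_UN_disjoint)
qed

lemma haar_coset_0: "measure \<mu> (coset a 0) = 1"
  by (simp add: measure_def haar_coset haar_frac_ideal)

text \<open>
  For \<open>h\<close> supported in \<open>\<O>\<close> the transform is constant on the cosets of \<open>\<O>\<close>, with the Fourier
  coefficients as values; Plancherel's identity thus becomes Parseval's.
\<close>

lemma parseval_integers_schwartz:
  assumes h: "h \<in> schwartz" and supp: "\<And>x. x \<notin> frac_ideal 0 \<Longrightarrow> h x = 0"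
  shows "((\<lambda>k. (cmod (ft h (\<gamma> k)))\<^sup>2) has_sum (L2_norm \<mu> h)\<^sup>2) UNIV"
proof -
  have "ft h \<in> schwartz"
    using h by (rule ft_schwartz)
  then obtain N m where "schwartz_at N m (ft h)"
    by (rule schwartzE)
  note N = schwartz_atD(1)[OF this]
  define M where "M = nat (- N)"
  have MN: "- int M \<le> N"
    by (simp add: M_def)
  have M: "ft h x = 0" if "x \<notin> frac_ideal (- int M)" for x
    using N[of x] frac_ideal_mono[OF MN, of x] that by blast
  have const: "ft h x = ft h (\<gamma> k)" if "x \<in> coset (\<gamma> k) 0" for x k
    using ft_locally_constant[of 0 h "x - \<gamma> k" "\<gamma> k"] supp that by (simp add: coset_def)
  have "(cmod (ft h x))\<^sup>2 = (\<Sum>k<q ^ M. (cmod (ft h (\<gamma> k)))\<^sup>2 * indicator (coset (\<gamma> k) 0) x)" for x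
  proof -
    have "(\<Sum>k<q ^ M. (cmod (ft h (\<gamma> k)))\<^sup>2 * indicator (coset (\<gamma> k) 0) x)
        = (\<Sum>k<q ^ M. (cmod (ft h x))\<^sup>2 * indicator (coset (\<gamma> k) 0) x)"
      using const[of x] by (intro sum.cong) (auto simp: indicator_def)
    also have "\<dots> = (cmod (ft h x))\<^sup>2 * indicator (frac_ideal (- int M)) x"
      unfolding sum_distrib_left[symmetric] indicator_frac_ideal_u ..
    also have "\<dots> = (cmod (ft h x))\<^sup>2"
      using M[of x] by (auto simp: indicator_def)
    finally show ?thesis
      by simp
  qed
  then have "(L2_norm \<mu> (ft h))\<^sup>2
      = (\<integral>x. (\<Sum>k<q ^ M. (cmod (ft h (\<gamma> k)))\<^sup>2 * indicator (coset (\<gamma> k) 0) x) \<partial>\<mu>)"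
    unfolding L2_norm_sq by (intro Bochner_Integration.integral_cong refl)
  also have "\<dots> = (\<Sum>k<q ^ M. (cmod (ft h (\<gamma> k)))\<^sup>2 * measure \<mu> (coset (\<gamma> k) 0))"
    by (subst Bochner_Integration.integral_sum) (simp_all add: haar_coset haar_frac_ideal)
  finally have eq: "(L2_norm \<mu> h)\<^sup>2 = (\<Sum>k<q ^ M. (cmod (ft h (\<gamma> k)))\<^sup>2)"
    by (simp add: haar_coset_0 L2_norm_ft[OF h])
  have "ft h (\<gamma> k) = 0" if "\<not> k < q ^ M" for k
    using M[of "\<gamma> k"] in_coset_u_bound[OF self_in_coset, of k M] that by blast
  then have "((\<lambda>k. (cmod (ft h (\<gamma> k)))\<^sup>2) has_sum (\<Sum>k<q ^ M. (cmod (ft h (\<gamma> k)))\<^sup>2)) UNIV"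
    by (intro has_sum_finite_neutralI) auto
  then show ?thesis
    unfolding eq .
qed

lemma L2_mult_indicator:
  assumes "f \<in> L2 \<mu>" "A \<in> sets borel"
  shows "(\<lambda>x. indicator A x * f x) \<in> L2 \<mu>"
  using assms by (intro L2_mult_bounded[where C = 1]) (auto simp: indicator_def sets_haar)

lemma L2_chi_mult:
  assumes "f \<in> L2 \<mu>"
  shows "(\<lambda>x. chi (b * x) * f x) \<in> L2 \<mu>" "(\<lambda>x. cnj (chi (b * x)) * f x) \<in> L2 \<mu>"
  using assms by (intro L2_mult_bounded[where C = 1]; simp add: char_unimodular)+

text \<open>
  Extends the previous lemma to \<open>L\<^sup>2(\<O>)\<close> by density. Cutting an approximation of \<open>h\<close> off to \<open>\<O>\<close>
  brings it closer to \<open>h\<close> and keeps it Schwartz--Bruhat. The conjugate turns the kernel of the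
  Fourier transform into the one that occurs in wavelet coefficients.
\<close>

lemma parseval_integers:
  assumes h: "h \<in> L2 \<mu>" and supp: "\<And>x. x \<notin> frac_ideal 0 \<Longrightarrow> h x = 0"
  shows "((\<lambda>k. (cmod (\<integral>x. h x * chi (\<gamma> k * x) \<partial>\<mu>))\<^sup>2) has_sum (L2_norm \<mu> h)\<^sup>2) UNIV"
proof -
  define B where "B k (i :: unit) x = indicator (frac_ideal 0) x * chi (\<gamma> k * x)" for k i x
  define D where "D = {F :: unit \<Rightarrow> 'a \<Rightarrow> complex. F () \<in> schwartz \<and> (\<forall>x. x \<notin> frac_ideal 0 \<longrightarrow> F () x = 0)}"
  have unit_L2: "(\<lambda>x. indicator (frac_ideal 0) x) \<in> L2 \<mu>"
    using schwartz_L2[OF schwartz_indicator[of 0 0]] by (simp add: coset_0)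
  have ip: "family_inner {()} \<mu> (\<lambda>_. f) (B k) = ft f (\<gamma> k)" if "\<And>x. x \<notin> frac_ideal 0 \<Longrightarrow> f x = 0" for f k
  proof -
    have "f x * cnj (B k () x) = f x * cnj (chi (\<gamma> k * x))" for x
      using that[of x] by (auto simp: B_def indicator_def)
    then have "(\<integral>x. f x * cnj (B k () x) \<partial>\<mu>) = (\<integral>x. f x * cnj (chi (\<gamma> k * x)) \<partial>\<mu>)"
      by (simp only:)
    then show ?thesis
      by (simp add: family_inner_def L2_inner_def fourier_L1_def)
  qed
  have par: "parseval_at {()} \<mu> B (\<lambda>_. cnj \<circ> h)"
  proof (rule parseval_at_closure[where D = D])
    show "D \<subseteq> L2_family {()} \<mu>"
      by (auto simp: D_def L2_family_def intro: schwartz_L2)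
    show "(\<lambda>i x. F i x - G i x) \<in> D" if "F \<in> D" "G \<in> D" for F G
      using that by (auto simp: D_def intro: schwartz_diff)
    show "B a \<in> L2_family {()} \<mu>" for a
      using L2_chi_mult(1)[OF unit_L2, of "\<gamma> a"] by (simp add: L2_family_def B_def[abs_def] mult.commute)
    show "parseval_at {()} \<mu> B F" if "F \<in> D" for F
    proof -
      have F: "F = (\<lambda>_. F ())"
        by auto
      show ?thesis
        using that parseval_integers_schwartz[of "F ()"] ip[of "F ()"]
        by (subst F) (simp add: D_def parseval_at_def family_norm_def L2_norm_nonneg)
    qed
    have hL: "(\<lambda>x. cnj (h x)) \<in> L2 \<mu>"
      using h by (rule L2_cnj)
    then show "(\<lambda>_. cnj \<circ> h) \<in> L2_family {()} \<mu>"
      by (simp add: L2_family_def comp_def)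
    fix e :: real assume "e > 0"
    then obtain g where g: "g \<in> schwartz" "L2_norm \<mu> (\<lambda>x. cnj (h x) - g x) < e"
      using schwartz_dense[OF hL] by (auto simp: approximable_def)
    let ?G = "\<lambda>(_ :: unit) x. indicator (coset 0 0) x * g x"
    have "?G \<in> D"
      using schwartz_mult[OF schwartz_indicator[of 0 0] g(1)] by (simp add: D_def coset_0)
    moreover have "(L2_norm \<mu> (\<lambda>x. cnj (h x) - ?G () x))\<^sup>2 \<le> (L2_norm \<mu> (\<lambda>x. cnj (h x) - g x))\<^sup>2"
      unfolding L2_norm_sq
    proof (rule integral_mono)
      have "(\<lambda>x. cnj (h x) - ?G () x) \<in> L2 \<mu>"
        using hL schwartz_L2[OF g(1)] by (intro L2_diff L2_mult_indicator) auto
      then show "integrable \<mu> (\<lambda>x. (cmod (cnj (h x) - ?G () x))\<^sup>2)"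
        by (rule L2_integrable_sq)
      show "integrable \<mu> (\<lambda>x. (cmod (cnj (h x) - g x))\<^sup>2)"
        using hL schwartz_L2[OF g(1)] by (intro L2_integrable_sq L2_diff)
      show "(cmod (cnj (h x) - ?G () x))\<^sup>2 \<le> (cmod (cnj (h x) - g x))\<^sup>2" for x
        using supp[of x] by (auto simp: indicator_def coset_0)
    qed
    then have "L2_norm \<mu> (\<lambda>x. cnj (h x) - ?G () x) < e"
      using g(2) power2_le_imp_le[OF _ L2_norm_nonneg] by (meson le_less_trans)
    ultimately show "\<exists>G\<in>D. family_norm {()} \<mu> (\<lambda>i x. (cnj \<circ> h) x - G i x) < e"
      by (intro bexI[of _ ?G]) (simp_all add: L2_norm_family)
  qed
  have "cmod (family_inner {()} \<mu> (\<lambda>_. cnj \<circ> h) (B k)) = cmod (\<integral>x. h x * chi (\<gamma> k * x) \<partial>\<mu>)" for k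
  proof -
    have "ft (cnj \<circ> h) (\<gamma> k) = cnj (\<integral>x. h x * chi (\<gamma> k * x) \<partial>\<mu>)"
      by (simp add: fourier_L1_def flip: Bochner_Integration.integral_cnj)
    then show ?thesis
      using supp by (subst ip) auto
  qed
  moreover have "family_norm {()} \<mu> (\<lambda>_. cnj \<circ> h) = L2_norm \<mu> h"
    by (simp add: family_norm_def L2_norm_def)
  ultimately show ?thesis
    using par by (simp add: parseval_at_def)
qed

section \<open>Dilation, translation and their Fourier transforms\<close>

abbreviation dil :: "int \<Rightarrow> ('a \<Rightarrow> complex) \<Rightarrow> 'a \<Rightarrow> complex" where
  "dil \<equiv> dilation p c \<pi>"

abbreviation trn :: "nat \<Rightarrow> ('a \<Rightarrow> complex) \<Rightarrow> 'a \<Rightarrow> complex" where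
  "trn \<equiv> translation p c \<pi> \<epsilon>"

definition modulate :: "nat \<Rightarrow> ('a \<Rightarrow> complex) \<Rightarrow> 'a \<Rightarrow> complex" where
  "modulate k g \<xi> = cnj (chi (\<gamma> k * \<xi>)) * g \<xi>"

definition scaled :: "int \<Rightarrow> 'a set \<Rightarrow> 'a set" where
  "scaled j A = (\<lambda>x. \<pi> powi j * x) ` A"

lemma pi_powi_cancel [simp]: "\<pi> powi (- j) * (\<pi> powi j * x) = x" "\<pi> powi j * (\<pi> powi (- j) * x) = x"
  by (simp_all add: power_int_minus)

lemma in_scaled: "x \<in> scaled j A \<longleftrightarrow> \<pi> powi (- j) * x \<in> A"
  unfolding scaled_def by (metis (no_types, lifting) imageE image_eqI pi_powi_cancel)

lemma scaled_measurable:
  assumes "A \<in> sets borel"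
  shows "scaled j A \<in> sets borel"
proof -
  have "scaled j A = (\<lambda>x. \<pi> powi (- j) * x) -` A \<inter> space borel"
    by (auto simp: in_scaled)
  then show ?thesis
    using measurable_sets[OF measurable_mult_const assms] by (simp only:)
qed

lemma dilation_eq: "dil j f x = of_real (Q powr (of_int j / 2)) * f (\<pi> powi (- j) * x)"
  by (simp add: dilation_def Q_def)

lemma dil_factor_sq: "(Q powr (of_int j / 2))\<^sup>2 = Q powi j"
proof -
  have "(Q powr (of_int j / 2))\<^sup>2 = Q powr (of_int j)"
    unfolding power2_eq_square powr_add[symmetric] by simp
  then show ?thesis
    using Q_gt_1 powr_real_of_int'[of Q j] by simp
qed

lemma dilation_measurable: "f \<in> borel_measurable borel \<Longrightarrow> dil j f \<in> borel_measurable borel"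
  unfolding dilation_def[abs_def]
  by (intro borel_measurable_times borel_measurable_const measurable_compose[OF measurable_mult_const])

lemma L2_borel: "f \<in> L2 \<mu> \<Longrightarrow> f \<in> borel_measurable borel"
  using L2_measurable[of f \<mu>] by (simp add: sets_haar cong: measurable_cong_sets)

lemma dilation_L2:
  assumes "f \<in> L2 \<mu>"
  shows "dil j f \<in> L2 \<mu>"
proof -
  have f: "f \<in> borel_measurable borel"
    using assms by (rule L2_borel)
  have "integrable \<mu> (\<lambda>x. (cmod (f (\<pi> powi (- j) * x)))\<^sup>2)"
    using integrable_scale[of "\<lambda>x. (cmod (f x))\<^sup>2" "- j"] f L2_integrable_sq[OF assms] by simp
  then have "integrable \<mu> (\<lambda>x. Q powi j * (cmod (f (\<pi> powi (- j) * x)))\<^sup>2)"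
    by simp
  then show ?thesis
    using dilation_measurable[OF f] unfolding L2_def
    by (simp add: dilation_eq norm_mult power_mult_distrib dil_factor_sq)
qed

lemma dilation_restricted_norm:
  assumes f: "f \<in> L2 \<mu>" and A: "A \<in> sets borel"
  shows "(\<integral>x. indicator A x * (cmod (dil j f x))\<^sup>2 \<partial>\<mu>)
    = (\<integral>x. indicator (scaled (- j) A) x * (cmod (f x))\<^sup>2 \<partial>\<mu>)"
proof -
  let ?G = "\<lambda>y. indicator (scaled (- j) A) y * (cmod (f y))\<^sup>2"
  have "indicator A x * (cmod (dil j f x))\<^sup>2 = Q powi j * ?G (\<pi> powi (- j) * x)" for x
    by (simp add: dilation_eq norm_mult power_mult_distrib dil_factor_sq in_scaled indicator_def)
  then have "(\<integral>x. indicator A x * (cmod (dil j f x))\<^sup>2 \<partial>\<mu>) = Q powi j * (\<integral>x. ?G (\<pi> powi (- j) * x) \<partial>\<mu>)"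
    by simp
  also have "(\<integral>x. ?G (\<pi> powi (- j) * x) \<partial>\<mu>) = Q powi (- j) *\<^sub>R (\<integral>x. ?G x \<partial>\<mu>)"
    using L2_borel[OF f] scaled_measurable[OF A] by (intro integral_scale) simp
  finally show ?thesis
    by (simp add: power_int_minus power_int_eq_0_iff)
qed

lemma dilation_norm:
  assumes "f \<in> L2 \<mu>"
  shows "L2_norm \<mu> (dil j f) = L2_norm \<mu> f"
proof -
  have "scaled (- j) UNIV = UNIV"
    by (auto simp: in_scaled)
  then show ?thesis
    using dilation_restricted_norm[OF assms, of UNIV j] by (simp add: L2_norm_def)
qed

lemma dilation_adjoint:
  assumes "f \<in> borel_measurable borel" "g \<in> borel_measurable borel"
  shows "L2_inner \<mu> (dil j f) g = L2_inner \<mu> f (dil (- j) g)"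
proof -
  let ?c = "complex_of_real (Q powr (of_int j / 2))" and ?c' = "complex_of_real (Q powr (of_int (- j) / 2))"
  let ?h = "\<lambda>x. f x * cnj (g (\<pi> powi j * x))"
  have "Q powr (of_int j / 2) * Q powr (of_int (- j)) = Q powr (of_int (- j) / 2)"
    by (simp add: field_simps flip: powr_add)
  then have "Q powr (of_int j / 2) * Q powi (- j) = Q powr (of_int (- j) / 2)"
    using Q_gt_1 powr_real_of_int'[of Q "- j"] by simp
  then have c: "?c * of_real (Q powi (- j)) = ?c'"
    by (simp only: of_real_mult[symmetric])
  have "dil j f x * cnj (g x) = ?c * ?h (\<pi> powi (- j) * x)" for x
    unfolding dilation_eq pi_powi_cancel by (simp only: mult.assoc)
  then have "L2_inner \<mu> (dil j f) g = (\<integral>x. ?c * ?h (\<pi> powi (- j) * x) \<partial>\<mu>)"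
    unfolding L2_inner_def by (simp only:)
  also have "\<dots> = ?c * (\<integral>x. ?h (\<pi> powi (- j) * x) \<partial>\<mu>)"
    by (rule integral_mult_right_zero)
  also have "(\<integral>x. ?h (\<pi> powi (- j) * x) \<partial>\<mu>) = Q powi (- j) *\<^sub>R (\<integral>x. ?h x \<partial>\<mu>)"
    using assms(1) measurable_compose[OF measurable_mult_const assms(2)]
    by (intro integral_scale borel_measurable_times borel_measurable_cnj)
  also have "?c * (Q powi (- j) *\<^sub>R (\<integral>x. ?h x \<partial>\<mu>)) = ?c' * (\<integral>x. ?h x \<partial>\<mu>)"
    unfolding scaleR_conv_of_real c[symmetric] by (simp only: mult.assoc)
  also have "\<dots> = (\<integral>x. ?c' * ?h x \<partial>\<mu>)"
    by (rule integral_mult_right_zero[symmetric])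
  also have "\<dots> = L2_inner \<mu> f (dil (- j) g)"
    by (simp add: L2_inner_def dilation_eq mult_ac)
  finally show ?thesis .
qed

lemma dilation_schwartz:
  assumes "f \<in> schwartz"
  shows "dil j f \<in> schwartz"
proof -
  obtain N m where "schwartz_at N m f"
    using assms by (rule schwartzE)
  note f = schwartz_atD[OF this]
  show ?thesis
  proof (rule schwartzI[of "N + j" _ "m + j"])
    show "dil j f x = 0" if "x \<notin> frac_ideal (N + j)" for x
      using that f(1)[of "\<pi> powi (- j) * x"] unfolding dilation_eq pi_powi_mult_iff by simp
    show "dil j f (x + y) = dil j f x" if "y \<in> frac_ideal (m + j)" for x y
      using that f(2)[of "\<pi> powi (- j) * y" "\<pi> powi (- j) * x"] unfolding dilation_eq pi_powi_mult_iff
      by (simp add: distrib_left)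
  qed
qed

lemma ft_dilation:
  assumes "f \<in> borel_measurable borel"
  shows "ft (dil j f) \<xi> = dil (- j) (ft f) \<xi>"
proof -
  let ?c = "complex_of_real (Q powr (of_int (- j) / 2))"
  have "f x * cnj (dil (- j) (\<lambda>x. chi (\<xi> * x)) x) = ?c * (f x * cnj (chi (\<pi> powi j * \<xi> * x)))" for x
    by (simp add: dilation_eq mult_ac)
  then have "L2_inner \<mu> f (dil (- j) (\<lambda>x. chi (\<xi> * x))) = ?c * ft f (\<pi> powi j * \<xi>)"
    unfolding L2_inner_def fourier_L1_def by (simp only: integral_mult_right_zero)
  moreover have "ft (dil j f) \<xi> = L2_inner \<mu> (dil j f) (\<lambda>x. chi (\<xi> * x))"
    by (simp add: fourier_L1_def L2_inner_def)
  ultimately show ?thesis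
    using dilation_adjoint[OF assms measurable_chi_mult(1)] by (simp add: dilation_eq)
qed

lemma translation_L2:
  assumes "f \<in> L2 \<mu>"
  shows "trn k f \<in> L2 \<mu>"
proof -
  have f: "f \<in> borel_measurable borel"
    using assms by (rule L2_borel)
  have "integrable \<mu> (\<lambda>x. (cmod (f (x + - \<gamma> k)))\<^sup>2)"
    using integrable_translate[of "\<lambda>x. (cmod (f x))\<^sup>2" "- \<gamma> k"] f L2_integrable_sq[OF assms] by simp
  moreover have "(\<lambda>x. f (x + - \<gamma> k)) \<in> borel_measurable borel"
    using measurable_compose[OF measurable_add f] .
  ultimately show ?thesis
    unfolding L2_def translation_def[abs_def] by simp
qed

lemma translation_norm:
  assumes "f \<in> L2 \<mu>"
  shows "L2_norm \<mu> (trn k f) = L2_norm \<mu> f"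
  using integral_translate[of "\<lambda>x. (cmod (f x))\<^sup>2" "- \<gamma> k"] L2_borel[OF assms]
  by (simp add: L2_norm_def translation_def)

lemma translation_adjoint:
  assumes "f \<in> L2 \<mu>" "g \<in> L2 \<mu>"
  shows "L2_inner \<mu> f (trn k g) = L2_inner \<mu> (\<lambda>x. f (x + \<gamma> k)) g"
proof -
  have "(\<lambda>x. f x * cnj (g (x + - \<gamma> k))) \<in> borel_measurable borel"
    using L2_borel[OF assms(1)] measurable_compose[OF measurable_add L2_borel[OF assms(2)]]
    by (intro borel_measurable_times borel_measurable_cnj)
  from integral_translate[OF this, of "\<gamma> k"] show ?thesis
    by (simp add: L2_inner_def translation_def)
qed

lemma translate_schwartz:
  assumes "f \<in> schwartz"
  shows "(\<lambda>x. f (x + b)) \<in> schwartz"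
proof -
  obtain N m where "schwartz_at N m f"
    using assms by (rule schwartzE)
  note f = schwartz_atD[OF this]
  obtain r where r: "r \<ge> - N" "b \<in> frac_ideal (- r)"
    using ex_frac_ideal by blast
  show ?thesis
  proof (rule schwartzI[of "- r" _ m])
    fix x assume x: "x \<notin> frac_ideal (- r)"
    then have "x + b \<notin> frac_ideal (- r)"
      using frac_ideal_add_iff[OF r(2)] by simp
    then show "f (x + b) = 0"
      using r(1) frac_ideal_mono[of "- r" N "x + b"] f(1)[of "x + b"] by auto
  next
    show "f (x + y + b) = f (x + b)" if "y \<in> frac_ideal m" for x y
      using f(2)[OF that, of "x + b"] by (simp add: ac_simps)
  qed
qed

lemma modulate_L2: "g \<in> L2 \<mu> \<Longrightarrow> modulate k g \<in> L2 \<mu>"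
  using L2_chi_mult(2)[of g "\<gamma> k"] by (simp add: modulate_def[abs_def])

text \<open>
  Dilation and translation are moved over to \<open>f\<close>, which remains a Schwartz--Bruhat function, so that
  only the pairing of \<open>\<eta>\<close> with such functions enters. The transform then turns the translation into
  a modulation and reverses the dilation.
\<close>

lemma wavelet_coefficient:
  assumes fourier: "is_fourier_L2 \<mu> chi \<eta> g" and f: "f \<in> schwartz"
  shows "L2_inner \<mu> f (dil j (trn k \<eta>)) = L2_inner \<mu> (ft f) (dil (- j) (modulate k g))"
proof -
  have L: "\<eta> \<in> L2 \<mu>" "g \<in> L2 \<mu>"
    using fourier by (auto simp: is_fourier_L2_def)
  let ?f1 = "dil (- j) f" and ?f2 = "\<lambda>x. dil (- j) f (x + \<gamma> k)"
  have f1: "?f1 \<in> schwartz"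
    using f by (rule dilation_schwartz)
  have f2: "?f2 \<in> schwartz"
    using f1 by (rule translate_schwartz)
  have ft2: "ft ?f2 \<xi> = chi (\<gamma> k * \<xi>) * dil j (ft f) \<xi>" for \<xi>
    using ft_translate[OF schwartz_measurable[OF f1], of "\<gamma> k" \<xi>]
      ft_dilation[OF schwartz_measurable[OF f], of "- j" \<xi>] by (simp add: mult.commute)
  have "L2_inner \<mu> f (dil j (trn k \<eta>)) = L2_inner \<mu> ?f1 (trn k \<eta>)"
    using dilation_adjoint[OF schwartz_measurable[OF f] L2_borel[OF translation_L2[OF L(1)]], of "- j" k] by simp
  also have "\<dots> = L2_inner \<mu> ?f2 \<eta>"
    using translation_adjoint[OF schwartz_L2[OF f1] L(1)] .
  also have "\<dots> = cnj (L2_inner \<mu> \<eta> ?f2)"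
    by (rule L2_inner_commute)
  also have "\<dots> = cnj (L2_inner \<mu> g (ft ?f2))"
    using is_fourier_inner[OF fourier f2] by simp
  also have "\<dots> = L2_inner \<mu> (ft ?f2) g"
    by (rule L2_inner_commute[symmetric])
  also have "\<dots> = L2_inner \<mu> (dil j (ft f)) (modulate k g)"
    by (simp add: L2_inner_def ft2 modulate_def mult_ac)
  also have "\<dots> = L2_inner \<mu> (ft f) (dil (- j) (modulate k g))"
    by (intro dilation_adjoint schwartz_measurable ft_schwartz f L2_borel modulate_L2 L(2))
  finally show ?thesis .
qed

lemma schwartz_family_dense:
  assumes "finite I" "F \<in> L2_family I \<mu>" "e > 0"
  shows "\<exists>G. (\<forall>i\<in>I. G i \<in> schwartz) \<and> family_norm I \<mu> (\<lambda>i x. F i x - G i x) < e"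
proof -
  define d where "d = e / (card I + 1)"
  have d: "d > 0"
    using assms(3) by (simp add: d_def)
  have "\<forall>i\<in>I. \<exists>g. g \<in> schwartz \<and> L2_norm \<mu> (\<lambda>x. F i x - g x) < d"
    using assms(2) schwartz_dense d unfolding L2_family_def approximable_def Bex_def by blast
  then obtain G where G: "\<And>i. i \<in> I \<Longrightarrow> G i \<in> schwartz \<and> L2_norm \<mu> (\<lambda>x. F i x - G i x) < d"
    using bchoice[of I] by metis
  have "family_norm I \<mu> (\<lambda>i x. F i x - G i x) = L2_set (\<lambda>i. L2_norm \<mu> (\<lambda>x. F i x - G i x)) I"
    by (simp add: family_norm_def L2_set_def)
  also have "\<dots> \<le> (\<Sum>i\<in>I. L2_norm \<mu> (\<lambda>x. F i x - G i x))"
    by (rule L2_set_le_sum) (rule L2_norm_nonneg)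
  also have "\<dots> \<le> (\<Sum>i\<in>I. d)"
    using G by (intro sum_mono) (auto simp: less_imp_le)
  also have "\<dots> = card I * d"
    by simp
  also have "\<dots> < e"
    using assms(3) by (simp add: d_def field_simps)
  finally show ?thesis
    using G by blast
qed

lemma parseval_schwartz_imp_all:
  assumes "finite I" "\<And>a. B a \<in> L2_family I \<mu>"
    "\<And>F. (\<And>i. i \<in> I \<Longrightarrow> F i \<in> schwartz) \<Longrightarrow> parseval_at I \<mu> B F" "F \<in> L2_family I \<mu>"
  shows "parseval_at I \<mu> B F"
proof (rule parseval_at_closure[where D = "{F. \<forall>i\<in>I. F i \<in> schwartz}"])
  show "\<exists>G\<in>{F. \<forall>i\<in>I. F i \<in> schwartz}. family_norm I \<mu> (\<lambda>i x. F i x - G i x) < e" if "e > 0" for e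
    using schwartz_family_dense[OF assms(1,4) that] by blast
qed (use assms in \<open>auto simp: L2_family_def intro: schwartz_L2 schwartz_diff\<close>)

text \<open>
  The transform maps Schwartz--Bruhat families onto themselves and preserves norms and wavelet
  coefficients; on both sides these families are dense, so they decide Parseval's identity.
\<close>

lemma parseval_transfer:
  assumes fin: "finite I" and fourier: "\<And>i. i \<in> I \<Longrightarrow> is_fourier_L2 \<mu> chi (\<eta> i) (g i)"
  shows "(\<forall>F\<in>L2_family I \<mu>. parseval_at I \<mu> (\<lambda>(j, k) i. dil j (trn k (\<eta> i))) F)
    \<longleftrightarrow> (\<forall>H\<in>L2_family I \<mu>. parseval_at I \<mu> (\<lambda>(j, k) i. dil (- j) (modulate k (g i))) H)"
    (is "(\<forall>F\<in>_. parseval_at I \<mu> ?B F) \<longleftrightarrow> (\<forall>H\<in>_. parseval_at I \<mu> ?E H)")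
proof -
  have L: "\<eta> i \<in> L2 \<mu>" "g i \<in> L2 \<mu>" if "i \<in> I" for i
    using fourier[OF that] by (auto simp: is_fourier_L2_def)
  have B: "?B a \<in> L2_family I \<mu>" and E: "?E a \<in> L2_family I \<mu>" for a
    using L by (auto simp: L2_family_def split: prod.split intro: dilation_L2 translation_L2 modulate_L2)
  have eq: "parseval_at I \<mu> ?B F \<longleftrightarrow> parseval_at I \<mu> ?E (\<lambda>i. ft (F i))"
    if F: "\<And>i. i \<in> I \<Longrightarrow> F i \<in> schwartz" for F
  proof -
    have "family_inner I \<mu> F (?B a) = family_inner I \<mu> (\<lambda>i. ft (F i)) (?E a)" for a
      unfolding family_inner_def using wavelet_coefficient[OF fourier F]
      by (intro sum.cong) (auto split: prod.split)
    moreover have "family_norm I \<mu> (\<lambda>i. ft (F i)) = family_norm I \<mu> F"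
      using F by (simp add: family_norm_def L2_norm_ft)
    ultimately show ?thesis
      by (simp add: parseval_at_def)
  qed
  show ?thesis
  proof (intro iffI ballI)
    fix F assume *: "\<forall>H\<in>L2_family I \<mu>. parseval_at I \<mu> ?E H" and F: "F \<in> L2_family I \<mu>"
    show "parseval_at I \<mu> ?B F"
    proof (rule parseval_schwartz_imp_all[OF fin B _ F])
      fix G assume G: "\<And>i. i \<in> I \<Longrightarrow> G i \<in> schwartz"
      then have "(\<lambda>i. ft (G i)) \<in> L2_family I \<mu>"
        by (auto simp: L2_family_def intro: schwartz_L2 ft_schwartz)
      then show "parseval_at I \<mu> ?B G"
        using * eq[of G, OF G] by blast
    qed
  next
    fix F assume *: "\<forall>F\<in>L2_family I \<mu>. parseval_at I \<mu> ?B F" and F: "F \<in> L2_family I \<mu>"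
    show "parseval_at I \<mu> ?E F"
    proof (rule parseval_schwartz_imp_all[OF fin E _ F])
      fix H assume "\<And>i. i \<in> I \<Longrightarrow> H i \<in> schwartz"
      then have "\<forall>i\<in>I. \<exists>f. f \<in> schwartz \<and> ft f = H i"
        using ft_surj by metis
      then obtain G where G: "\<And>i. i \<in> I \<Longrightarrow> G i \<in> schwartz \<and> ft (G i) = H i"
        using bchoice[of I] by metis
      then have "G \<in> L2_family I \<mu>"
        by (auto simp: L2_family_def intro: schwartz_L2)
      then have "parseval_at I \<mu> ?E (\<lambda>i. ft (G i))"
        using * eq[of G] G by blast
      then show "parseval_at I \<mu> ?E H"
        using G by (simp add: parseval_at_def family_inner_def family_norm_def)
    qed
  qed
qed

end

section \<open>Sums over almost disjoint sets\<close>

lemma has_sum_Sigma_nonneg: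
  fixes f :: "'b \<times> 'c \<Rightarrow> real"
  assumes "\<And>z. f z \<ge> 0" "\<And>x. x \<in> A \<Longrightarrow> ((\<lambda>y. f (x, y)) has_sum b x) B" "(b has_sum s) A"
  shows "(f has_sum s) (A \<times> B)"
proof (rule has_sum_SigmaI)
  have inf: "infsum (\<lambda>y. norm (f (x, y))) B = b x" if "x \<in> A" for x
    using infsumI[OF assms(2)[OF that]] assms(1) by simp
  have "(b has_sum s) A \<longleftrightarrow> ((\<lambda>x. infsum (\<lambda>y. norm (f (x, y))) B) has_sum s) A"
    by (rule has_sum_cong) (simp only: inf)
  then have "(\<lambda>x. infsum (\<lambda>y. norm (f (x, y))) B) summable_on A"
    using assms(3) unfolding summable_on_def by blast
  then have "(\<lambda>x. norm (infsum (\<lambda>y. norm (f (x, y))) B)) summable_on A"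
    using assms(1) by (simp add: infsum_nonneg)
  moreover have "(\<lambda>y. norm (f (x, y))) summable_on B" if "x \<in> A" for x
    using assms(2)[OF that] assms(1) unfolding summable_on_def by auto
  ultimately have "(\<lambda>z. norm (f z)) summable_on A \<times> B"
    unfolding Infinite_Sum.abs_summable_on_Sigma_iff by blast
  then show "f summable_on A \<times> B"
    using assms(1) by simp
qed (use assms in auto)

lemma AE_almost_disjoint:
  assumes "countable J" "\<And>a b. a \<in> J \<Longrightarrow> b \<in> J \<Longrightarrow> a \<noteq> b \<Longrightarrow> A a \<inter> A b \<in> null_sets M"
  shows "AE x in M. \<forall>a\<in>J. \<forall>b\<in>J. x \<in> A a \<and> x \<in> A b \<longrightarrow> a = b"
proof -
  have "AE x in M. x \<in> A a \<and> x \<in> A b \<longrightarrow> a = b" if "a \<in> J" "b \<in> J" for a b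
  proof (cases "a = b")
    case False
    then show ?thesis
      using AE_not_in[OF assms(2)[OF that]] by auto
  qed simp
  then show ?thesis
    using assms(1) by (simp add: AE_ball_countable)
qed

text \<open>
  In an enumeration of \<open>J\<close> the partial sums are dominated by \<open>f\<close> and eventually constant at almost
  every point.
\<close>

lemma has_sum_integral_almost_disjoint:
  fixes f :: "'a \<Rightarrow> real"
  assumes J: "countable J" and S: "\<And>j. j \<in> J \<Longrightarrow> S j \<in> sets M"
    and f: "integrable M f" "\<And>x. f x \<ge> 0"
    and disj: "AE x in M. \<forall>i\<in>J. \<forall>j\<in>J. x \<in> S i \<and> x \<in> S j \<longrightarrow> i = j"
  shows "((\<lambda>j. \<integral>x. indicator (S j) x * f x \<partial>M) has_sum
    (\<integral>x. indicator (\<Union>j\<in>J. S j) x * f x \<partial>M)) J"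
proof -
  define h where "h = to_nat_on J"
  have inj: "inj_on h J"
    unfolding h_def using J by (rule inj_on_to_nat_on)
  define S' where "S' m = (if m \<in> h ` J then S (the_inv_into J h m) else {})" for m
  have S'h: "S' (h j) = S j" if "j \<in> J" for j
    using that inj by (simp add: S'_def the_inv_into_f_f)
  have S'_off: "S' m = {}" if "m \<notin> h ` J" for m
    using that by (simp add: S'_def)
  have S'M: "S' m \<in> sets M" for m
    using S S'h S'_off by (cases "m \<in> h ` J") auto
  let ?U = "\<Union>j\<in>J. S j"
  have UM: "?U \<in> sets M"
    using J S by (intro sets.countable_UN') auto
  have partial: "(\<Sum>m<n. indicator (S' m) x * f x) = (if h j < n then f x else 0)"
    if "x \<in> S j" "j \<in> J" "\<forall>i\<in>J. \<forall>j\<in>J. x \<in> S i \<and> x \<in> S j \<longrightarrow> i = j" for x j n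
  proof -
    have ind: "indicator (S' m) x = (if m = h j then 1 else 0 :: real)" for m
    proof (cases "m \<in> h ` J")
      case True
      then obtain i where "i \<in> J" "m = h i"
        by blast
      then show ?thesis
        using that inj by (auto simp: S'h indicator_def inj_on_def)
    next
      case False
      then show ?thesis
        using that(2) by (auto simp: S'_off)
    qed
    have "(\<Sum>m<n. indicator (S' m) x * f x) = (\<Sum>m<n. if m = h j then f x else 0)"
      unfolding ind by (intro sum.cong) auto
    then show ?thesis
      by simp
  qed
  have zero: "indicator (S' m) x * f x = 0" if "x \<notin> ?U" for x m
    using that S'h S'_off by (cases "m \<in> h ` J") (auto simp: indicator_def)
  have "(\<lambda>n. \<integral>x. (\<Sum>m<n. indicator (S' m) x * f x) \<partial>M) \<longlonglongrightarrow> (\<integral>x. indicator ?U x * f x \<partial>M)"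
  proof (rule integral_dominated_convergence[where w = f])
    show "(\<lambda>x. indicator ?U x * f x) \<in> borel_measurable M"
      using UM f(1) by (intro borel_measurable_times) auto
    show "(\<lambda>x. \<Sum>m<n. indicator (S' m) x * f x) \<in> borel_measurable M" for n
      using S'M f(1) by (intro borel_measurable_sum borel_measurable_times) auto
    show "integrable M f" by fact
    show "AE x in M. (\<lambda>n. \<Sum>m<n. indicator (S' m) x * f x) \<longlonglongrightarrow> indicator ?U x * f x"
      using disj
    proof eventually_elim
      fix x assume good: "\<forall>i\<in>J. \<forall>j\<in>J. x \<in> S i \<and> x \<in> S j \<longrightarrow> i = j"
      show "(\<lambda>n. \<Sum>m<n. indicator (S' m) x * f x) \<longlonglongrightarrow> indicator ?U x * f x"
      proof (cases "x \<in> ?U")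
        case True
        then obtain j where j: "j \<in> J" "x \<in> S j"
          by blast
        have "\<forall>\<^sub>F n in sequentially. f x = (\<Sum>m<n. indicator (S' m) x * f x)"
          unfolding partial[OF j(2,1) good] eventually_sequentially
          by (intro exI[of _ "Suc (h j)"]) auto
        then have "(\<lambda>n. \<Sum>m<n. indicator (S' m) x * f x) \<longlonglongrightarrow> f x"
          by (rule Lim_transform_eventually[OF tendsto_const])
        then show ?thesis
          using True by simp
      next
        case False
        then have "indicator ?U x * f x = 0"
          by simp
        moreover have "(\<Sum>m<n. indicator (S' m) x * f x) = 0" for n
          using zero[OF False] by (intro sum.neutral) blast
        ultimately show ?thesis
          by (simp only: tendsto_const)
      qed
    qed
    show "AE x in M. norm (\<Sum>m<n. indicator (S' m) x * f x) \<le> f x" for n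
      using disj
    proof eventually_elim
      fix x assume good: "\<forall>i\<in>J. \<forall>j\<in>J. x \<in> S i \<and> x \<in> S j \<longrightarrow> i = j"
      show "norm (\<Sum>m<n. indicator (S' m) x * f x) \<le> f x"
      proof (cases "x \<in> ?U")
        case True
        then obtain j where j: "j \<in> J" "x \<in> S j"
          by blast
        show ?thesis
          unfolding partial[OF j(2,1) good] using f(2)[of x] by simp
      next
        case False
        have "(\<Sum>m<n. indicator (S' m) x * f x) = 0"
          using zero[OF False] by (intro sum.neutral) blast
        then show ?thesis
          using f(2)[of x] by (simp only: norm_zero)
      qed
    qed
  qed
  moreover have int: "integrable M (\<lambda>x. indicator (S' m) x * f x)" for m
    using integrable_mult_indicator[OF S'M f(1)] by simp
  then have "(\<integral>x. (\<Sum>m<n. indicator (S' m) x * f x) \<partial>M) = (\<Sum>m<n. \<integral>x. indicator (S' m) x * f x \<partial>M)" for n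
    by (intro Bochner_Integration.integral_sum)
  ultimately have "(\<lambda>m. \<integral>x. indicator (S' m) x * f x \<partial>M) sums (\<integral>x. indicator ?U x * f x \<partial>M)"
    by (simp add: sums_def)
  then have "((\<lambda>m. \<integral>x. indicator (S' m) x * f x \<partial>M) has_sum (\<integral>x. indicator ?U x * f x \<partial>M)) UNIV"
    using f(2) by (intro sums_nonneg_imp_has_sum) (auto intro!: integral_nonneg_AE)
  also have "?this \<longleftrightarrow> ((\<lambda>m. \<integral>x. indicator (S' m) x * f x \<partial>M) has_sum (\<integral>x. indicator ?U x * f x \<partial>M)) (h ` J)"
    by (intro has_sum_cong_neutral) (auto simp: S'_off)
  also have "\<dots> \<longleftrightarrow> (((\<lambda>m. \<integral>x. indicator (S' m) x * f x \<partial>M) \<circ> h) has_sum (\<integral>x. indicator ?U x * f x \<partial>M)) J"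
    using inj by (rule has_sum_reindex)
  also have "\<dots> \<longleftrightarrow> ((\<lambda>j. \<integral>x. indicator (S j) x * f x \<partial>M) has_sum (\<integral>x. indicator ?U x * f x \<partial>M)) J"
    by (intro has_sum_cong) (simp add: S'h)
  finally show ?thesis .
qed

lemma cmod_sum_sq_single:
  assumes "finite S" "\<And>a b. a \<in> S \<Longrightarrow> b \<in> S \<Longrightarrow> f a \<noteq> 0 \<Longrightarrow> f b \<noteq> 0 \<Longrightarrow> a = b"
  shows "(cmod (sum f S))\<^sup>2 = (\<Sum>a\<in>S. (cmod (f a))\<^sup>2)"
proof (cases "\<exists>a\<in>S. f a \<noteq> 0")
  case True
  then obtain a where a: "a \<in> S" "f a \<noteq> 0"
    by blast
  have z: "f b = 0" if "b \<in> S - {a}" for b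
    using assms(2)[OF a(1) _ a(2)] that by blast
  have "sum f S = sum f {a}"
    using assms(1) a(1) z by (intro sum.mono_neutral_right) auto
  moreover have "(\<Sum>b\<in>S. (cmod (f b))\<^sup>2) = (\<Sum>b\<in>{a}. (cmod (f b))\<^sup>2)"
    using assms(1) a(1) z by (intro sum.mono_neutral_right) auto
  ultimately show ?thesis
    by simp
qed auto

context wavelet_setting begin

section \<open>Periodisation\<close>

definition shifted :: "nat \<Rightarrow> 'a set \<Rightarrow> 'a set" where
  "shifted k A = (\<lambda>x. x + \<gamma> k) ` A"

lemma in_shifted: "x \<in> shifted k A \<longleftrightarrow> x - \<gamma> k \<in> A"
proof
  assume "x - \<gamma> k \<in> A"
  then show "x \<in> shifted k A"
    unfolding shifted_def by (rule rev_image_eqI) simp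
qed (auto simp: shifted_def)

lemma translate_measurable:
  fixes A :: "'a set"
  shows "A \<in> sets borel \<Longrightarrow> {x. x + b \<in> A} \<in> sets borel"
  using measurable_sets[OF measurable_add, of A b] by (simp add: vimage_def)

lemma shifted_measurable:
  assumes "A \<in> sets borel"
  shows "shifted k A \<in> sets borel"
proof -
  have "shifted k A = {x. x + - \<gamma> k \<in> A}"
    by (auto simp: in_shifted)
  then show ?thesis
    using translate_measurable[OF assms, of "- \<gamma> k"] by (simp only:)
qed

lemma emeasure_translate:
  assumes "A \<in> sets borel"
  shows "emeasure \<mu> {x. x + b \<in> A} = emeasure \<mu> A"
proof -
  have "emeasure (distr \<mu> borel (\<lambda>x. x + b)) A = emeasure \<mu> {x. x + b \<in> A}"
    using assms by (subst emeasure_distr) (simp_all add: vimage_def)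
  then show ?thesis
    by (simp add: distr_translate)
qed

text \<open>
  These \<open>g i\<close> are the Fourier transforms of the wavelets, corrected on null sets: the modulus is
  an indicator at every point.
\<close>

definition has_spectrum :: "nat set \<Rightarrow> (nat \<Rightarrow> 'a \<Rightarrow> complex) \<Rightarrow> (nat \<Rightarrow> 'a set) \<Rightarrow> bool" where
  "has_spectrum I g W \<longleftrightarrow> finite I \<and>
     (\<forall>i\<in>I. g i \<in> L2 \<mu> \<and> W i \<in> sets borel \<and> (\<forall>x. cmod (g i x) = indicator (W i) x))"

definition separated :: "nat set \<Rightarrow> (nat \<Rightarrow> 'a set) \<Rightarrow> bool" where
  "separated I W \<longleftrightarrow> (\<forall>a\<in>UNIV \<times> I. \<forall>b\<in>UNIV \<times> I. a \<noteq> b \<longrightarrow>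
     shifted (fst a) (W (snd a)) \<inter> shifted (fst b) (W (snd b)) \<in> null_sets \<mu>)"

lemma separated_AE:
  assumes "finite I" "separated I W"
  shows "AE x in \<mu>. \<forall>a\<in>UNIV \<times> I. \<forall>b\<in>UNIV \<times> I.
    x \<in> shifted (fst a) (W (snd a)) \<and> x \<in> shifted (fst b) (W (snd b)) \<longrightarrow> a = b"
proof (rule AE_almost_disjoint)
  show "countable (UNIV \<times> I :: (nat \<times> nat) set)"
    using assms(1) by (simp add: countable_finite)
  show "shifted (fst a) (W (snd a)) \<inter> shifted (fst b) (W (snd b)) \<in> null_sets \<mu>"
    if "a \<in> UNIV \<times> I" "b \<in> UNIV \<times> I" "a \<noteq> b" for a b
    using assms(2) that unfolding separated_def by (metis (no_types))
qed

lemma integrable_chi_mult: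
  assumes "integrable \<mu> f"
  shows "integrable \<mu> (\<lambda>x. f x * chi (b * x))"
proof (rule Bochner_Integration.integrable_bound[OF assms])
  have "f \<in> borel_measurable \<mu>"
    using assms by auto
  then show "(\<lambda>x. f x * chi (b * x)) \<in> borel_measurable \<mu>"
    by measurable
qed (simp add: norm_mult char_unimodular)

text \<open>The ball \<open>\<pi>\<^sup>-\<^sup>N \<O>\<close> is the disjoint union of the cosets \<open>\<O> - u(l)\<close> with \<open>l < q\<^sup>N\<close>.\<close>

lemma integral_periodise:
  fixes f :: "'a \<Rightarrow> 'c::{banach, second_countable_topology}"
  assumes f: "integrable \<mu> f" and supp: "\<And>x. x \<notin> frac_ideal (- int N) \<Longrightarrow> f x = 0"
  shows "(\<integral>x. f x \<partial>\<mu>) = (\<Sum>l<q ^ N. \<integral>y. indicator (frac_ideal 0) y *\<^sub>R f (y - \<gamma> l) \<partial>\<mu>)"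
proof -
  have fm: "f \<in> borel_measurable borel"
    using borel_measurable_integrable[OF f] by (simp add: sets_haar cong: measurable_cong_sets)
  let ?G = "\<lambda>l y. indicator (frac_ideal 0) y *\<^sub>R f (y - \<gamma> l)"
  have Gm: "?G l \<in> borel_measurable borel" for l
    using measurable_compose[OF measurable_add[of "- \<gamma> l"] fm] by (intro borel_measurable_scaleR) auto
  have G: "integrable \<mu> (\<lambda>x. ?G l (x + \<gamma> l))" for l
  proof -
    have "{x. x + \<gamma> l \<in> frac_ideal 0} \<in> sets \<mu>"
      using translate_measurable[OF borel_frac_ideal] by (simp add: sets_haar)
    then have "integrable \<mu> (\<lambda>x. indicator {x. x + \<gamma> l \<in> frac_ideal 0} x *\<^sub>R f x)"
      using f by (rule integrable_mult_indicator)
    then show ?thesis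
      by (simp add: indicator_def)
  qed
  have "f x = (\<Sum>l<q ^ N. ?G l (x + \<gamma> l))" for x
  proof -
    have "- x - \<gamma> l \<in> frac_ideal 0 \<longleftrightarrow> x + \<gamma> l \<in> frac_ideal 0" for l
      using frac_ideal_minus_iff[of "x + \<gamma> l" 0] by simp
    then have "(\<Sum>l<q ^ N. indicator (frac_ideal 0) (x + \<gamma> l)) = (\<Sum>l<q ^ N. indicator (coset (\<gamma> l) 0) (- x) :: real)"
      by (simp add: indicator_def coset_def)
    also have "\<dots> = indicator (frac_ideal (- int N)) x"
      unfolding indicator_frac_ideal_u by (simp add: indicator_def)
    finally show ?thesis
      using supp[of x] by (auto simp: indicator_def simp flip: scaleR_sum_left)
  qed
  then have "(\<integral>x. f x \<partial>\<mu>) = (\<integral>x. (\<Sum>l<q ^ N. ?G l (x + \<gamma> l)) \<partial>\<mu>)"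
    by (intro Bochner_Integration.integral_cong refl)
  also have "\<dots> = (\<Sum>l<q ^ N. \<integral>x. ?G l (x + \<gamma> l) \<partial>\<mu>)"
    using G by (intro Bochner_Integration.integral_sum)
  also have "\<dots> = (\<Sum>l<q ^ N. \<integral>y. ?G l y \<partial>\<mu>)"
    using integral_translate[OF Gm] by (simp only:)
  finally show ?thesis .
qed

text \<open>
  One scale of the wavelet system. The coefficients are the Fourier coefficients on \<open>\<O>\<close> of the
  periodisation of \<open>\<Sum>i\<in>I. h i * cnj (g i)\<close>; when the translates of the \<open>W i\<close> do not overlap, at
  most one summand of the periodisation is nonzero at almost every point, so that squaring it
  produces no cross terms.
\<close>

lemma parseval_single_scale:
  assumes spec: "has_spectrum I g W" and sep: "separated I W"
    and h: "\<And>i. i \<in> I \<Longrightarrow> h i \<in> L2 \<mu>"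
    and supp: "\<And>i x. i \<in> I \<Longrightarrow> x \<notin> frac_ideal (- int N) \<Longrightarrow> h i x = 0"
  shows "((\<lambda>k. (cmod (\<Sum>i\<in>I. L2_inner \<mu> (h i) (modulate k (g i))))\<^sup>2) has_sum
    (\<Sum>i\<in>I. \<integral>x. indicator (W i) x * (cmod (h i x))\<^sup>2 \<partial>\<mu>)) UNIV"
proof -
  have fin: "finite I" and g: "\<And>i. i \<in> I \<Longrightarrow> g i \<in> L2 \<mu>"
    and modg: "\<And>i x. i \<in> I \<Longrightarrow> cmod (g i x) = indicator (W i) x"
    using spec by (auto simp: has_spectrum_def)
  define \<psi> where "\<psi> i x = h i x * cnj (g i x)" for i x
  have \<psi>L: "\<psi> i \<in> L2 \<mu>" if "i \<in> I" for i
    using L2_mult_bounded[OF h[OF that] L2_measurable[OF L2_cnj[OF g[OF that]]], of 1] modg[OF that]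
    by (simp add: \<psi>_def[abs_def] mult.commute indicator_def)
  have \<psi>int: "integrable \<mu> (\<psi> i)" if "i \<in> I" for i
    using L2_integrable_inner[OF h[OF that] g[OF that]] by (simp add: \<psi>_def[abs_def])
  have \<psi>supp: "\<psi> i x = 0" if "i \<in> I" "x \<notin> frac_ideal (- int N)" for i x
    using supp[OF that] by (simp add: \<psi>_def)
  define S where "S = {..<q ^ N} \<times> I"
  define P where "P y = indicator (frac_ideal 0) y * (\<Sum>a\<in>S. \<psi> (snd a) (y - \<gamma> (fst a)))" for y
  have finS: "finite S"
    using fin by (simp add: S_def)
  have PL: "P \<in> L2 \<mu>"
    unfolding P_def[abs_def]
  proof (intro L2_mult_indicator L2_sum_fun)
    fix a assume "a \<in> S"
    then show "(\<lambda>x. \<psi> (snd a) (x - \<gamma> (fst a))) \<in> L2 \<mu>"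
      using translation_L2[OF \<psi>L, of "snd a" "fst a"] by (auto simp: S_def translation_def[abs_def])
  qed simp
  have coeff: "(\<Sum>i\<in>I. L2_inner \<mu> (h i) (modulate k (g i))) = (\<integral>y. P y * chi (\<gamma> k * y) \<partial>\<mu>)" for k
  proof -
    let ?X = "\<lambda>i l y. indicator (frac_ideal 0) y *\<^sub>R (\<psi> i (y - \<gamma> l) * chi (\<gamma> k * (y - \<gamma> l)))"
    have int: "integrable \<mu> (\<lambda>x. \<psi> i x * chi (\<gamma> k * x))" if "i \<in> I" for i
      using \<psi>int[OF that] by (rule integrable_chi_mult)
    have intX: "integrable \<mu> (?X i l)" if "i \<in> I" for i l
    proof -
      have m: "(\<lambda>x. \<psi> i x * chi (\<gamma> k * x)) \<in> borel_measurable borel"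
        using L2_borel[OF \<psi>L[OF that]] by (intro borel_measurable_times measurable_chi_mult)
      have "integrable \<mu> (\<lambda>y. \<psi> i (y - \<gamma> l) * chi (\<gamma> k * (y - \<gamma> l)))"
        using integrable_translate[OF m, of "- \<gamma> l"] int[OF that] by simp
      then show ?thesis
        by (intro integrable_mult_indicator) (simp_all add: sets_haar)
    qed
    have "L2_inner \<mu> (h i) (modulate k (g i)) = (\<integral>x. \<psi> i x * chi (\<gamma> k * x) \<partial>\<mu>)" for i
      by (simp add: L2_inner_def modulate_def \<psi>_def mult_ac)
    also have "\<dots> i = (\<Sum>l<q ^ N. \<integral>y. ?X i l y \<partial>\<mu>)" if "i \<in> I" for i
      using integral_periodise[OF int[OF that]] \<psi>supp[OF that] by simp
    finally have "(\<Sum>i\<in>I. L2_inner \<mu> (h i) (modulate k (g i))) = (\<Sum>i\<in>I. \<Sum>l<q ^ N. \<integral>y. ?X i l y \<partial>\<mu>)"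
      by (rule sum.cong[OF refl])
    also have "\<dots> = (\<Sum>a\<in>S. \<integral>y. ?X (snd a) (fst a) y \<partial>\<mu>)"
      unfolding S_def by (subst sum.swap) (simp add: sum.cartesian_product case_prod_beta)
    also have "\<dots> = (\<integral>y. (\<Sum>a\<in>S. ?X (snd a) (fst a) y) \<partial>\<mu>)"
      using intX by (intro Bochner_Integration.integral_sum[symmetric]) (auto simp: S_def)
    also have "\<dots> = (\<integral>y. P y * chi (\<gamma> k * y) \<partial>\<mu>)"
    proof (rule Bochner_Integration.integral_cong[OF refl])
      fix y
      have "chi (\<gamma> k * (y - \<gamma> l)) = chi (\<gamma> k * y)" for l
        by (simp add: right_diff_distrib chi_diff char_u)
      then show "(\<Sum>a\<in>S. ?X (snd a) (fst a) y) = P y * chi (\<gamma> k * y)"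
        by (simp add: P_def sum_distrib_left sum_distrib_right scaleR_conv_of_real mult.assoc indicator_def)
    qed
    finally show ?thesis .
  qed
  have norm: "(L2_norm \<mu> P)\<^sup>2 = (\<Sum>i\<in>I. \<integral>x. indicator (W i) x * (cmod (h i x))\<^sup>2 \<partial>\<mu>)"
  proof -
    let ?Y = "\<lambda>i l y. indicator (frac_ideal 0) y *\<^sub>R (cmod (\<psi> i (y - \<gamma> l)))\<^sup>2"
    have intY: "integrable \<mu> (?Y i l)" if "i \<in> I" for i l
      using L2_integrable_sq[OF translation_L2[OF \<psi>L[OF that], of l]]
      by (intro integrable_mult_indicator) (simp_all add: sets_haar translation_def)
    have AE: "AE y in \<mu>. (cmod (P y))\<^sup>2 = (\<Sum>a\<in>S. ?Y (snd a) (fst a) y)"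
      using separated_AE[OF fin sep]
    proof eventually_elim
      fix y assume single: "\<forall>a\<in>UNIV \<times> I. \<forall>b\<in>UNIV \<times> I.
          y \<in> shifted (fst a) (W (snd a)) \<and> y \<in> shifted (fst b) (W (snd b)) \<longrightarrow> a = b"
      have inW: "y \<in> shifted (fst a) (W (snd a))" if "a \<in> S" "\<psi> (snd a) (y - \<gamma> (fst a)) \<noteq> 0" for a
      proof (rule ccontr)
        assume "\<not> ?thesis"
        moreover have "snd a \<in> I"
          using that(1) by (auto simp: S_def)
        ultimately have "cmod (g (snd a) (y - \<gamma> (fst a))) = 0"
          by (simp only: modg in_shifted) simp
        then show False
          using that(2) by (simp add: \<psi>_def)
      qed
      have "(cmod (\<Sum>a\<in>S. \<psi> (snd a) (y - \<gamma> (fst a))))\<^sup>2 = (\<Sum>a\<in>S. (cmod (\<psi> (snd a) (y - \<gamma> (fst a))))\<^sup>2)"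
      proof (rule cmod_sum_sq_single[OF finS])
        fix a b assume "a \<in> S" "b \<in> S" "\<psi> (snd a) (y - \<gamma> (fst a)) \<noteq> 0" "\<psi> (snd b) (y - \<gamma> (fst b)) \<noteq> 0"
        moreover from this have "y \<in> shifted (fst a) (W (snd a))" "y \<in> shifted (fst b) (W (snd b))"
          using inW by blast+
        ultimately show "a = b"
          using single by (auto simp: S_def)
      qed
      then show "(cmod (P y))\<^sup>2 = (\<Sum>a\<in>S. ?Y (snd a) (fst a) y)"
        by (simp add: P_def norm_mult power_mult_distrib indicator_def)
    qed
    have "(L2_norm \<mu> P)\<^sup>2 = (\<integral>y. (\<Sum>a\<in>S. ?Y (snd a) (fst a) y) \<partial>\<mu>)"
      unfolding L2_norm_sq
    proof (rule integral_cong_AE[OF _ _ AE])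
      show "(\<lambda>y. (cmod (P y))\<^sup>2) \<in> borel_measurable \<mu>"
        using L2_integrable_sq[OF PL] by auto
      show "(\<lambda>y. \<Sum>a\<in>S. ?Y (snd a) (fst a) y) \<in> borel_measurable \<mu>"
        using intY by (intro borel_measurable_sum borel_measurable_integrable) (auto simp: S_def)
    qed
    also have "\<dots> = (\<Sum>a\<in>S. \<integral>y. ?Y (snd a) (fst a) y \<partial>\<mu>)"
      using intY by (intro Bochner_Integration.integral_sum) (auto simp: S_def)
    also have "\<dots> = (\<Sum>i\<in>I. \<Sum>l<q ^ N. \<integral>y. ?Y i l y \<partial>\<mu>)"
      unfolding S_def by (subst sum.swap[of _ "{..<q ^ N}" I]) (simp add: sum.cartesian_product case_prod_beta)
    also have "\<dots> = (\<Sum>i\<in>I. \<integral>x. (cmod (\<psi> i x))\<^sup>2 \<partial>\<mu>)"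
      using \<psi>supp L2_integrable_sq[OF \<psi>L] by (intro sum.cong refl integral_periodise[symmetric]) auto
    also have "\<dots> = (\<Sum>i\<in>I. \<integral>x. indicator (W i) x * (cmod (h i x))\<^sup>2 \<partial>\<mu>)"
      by (intro sum.cong refl Bochner_Integration.integral_cong)
        (simp add: \<psi>_def norm_mult modg power_mult_distrib indicator_def)
    finally show ?thesis .
  qed
  have "((\<lambda>k. (cmod (\<integral>y. P y * chi (\<gamma> k * y) \<partial>\<mu>))\<^sup>2) has_sum (L2_norm \<mu> P)\<^sup>2) UNIV"
    by (rule parseval_integers[OF PL]) (simp add: P_def)
  then show ?thesis
    unfolding coeff norm .
qed

end

context wavelet_setting begin

section \<open>Tilings give Parseval systems\<close>

text \<open>The Fourier transforms of the functions \<open>D\<^sup>j T\<^sup>k \<eta>\<^sub>i\<close>; the dilation is reversed.\<close>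

abbreviation spectral_system :: "(nat \<Rightarrow> 'a \<Rightarrow> complex) \<Rightarrow> int \<times> nat \<Rightarrow> nat \<Rightarrow> 'a \<Rightarrow> complex" where
  "spectral_system g \<equiv> (\<lambda>(j, k) i. dil (- j) (modulate k (g i)))"

lemma spectral_coefficient:
  assumes "has_spectrum I g W" "H \<in> L2_family I \<mu>"
  shows "family_inner I \<mu> H (spectral_system g (j, k))
    = (\<Sum>i\<in>I. L2_inner \<mu> (dil j (H i)) (modulate k (g i)))"
  unfolding family_inner_def prod.case using assms
  by (intro sum.cong refl dilation_adjoint[symmetric] L2_borel modulate_L2) (auto simp: L2_family_def has_spectrum_def)

lemma has_spectrum_subset: "has_spectrum I g W \<Longrightarrow> J \<subseteq> I \<Longrightarrow> has_spectrum J g W"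
  by (auto simp: has_spectrum_def intro: finite_subset)

lemma has_spectrum_norm_sq:
  assumes "has_spectrum I g W" "i \<in> I"
  shows "integrable \<mu> (\<lambda>x. indicator (W i) x :: real)" "(L2_norm \<mu> (g i))\<^sup>2 = measure \<mu> (W i)"
proof -
  have g: "g i \<in> L2 \<mu>" and mod: "cmod (g i x) = indicator (W i) x" for x
    using assms by (auto simp: has_spectrum_def)
  have sq: "(cmod (g i x))\<^sup>2 = indicator (W i) x" for x
    unfolding mod by (simp add: indicator_def)
  show "integrable \<mu> (\<lambda>x. indicator (W i) x :: real)"
    using L2_integrable_sq[OF g] unfolding sq .
  show "(L2_norm \<mu> (g i))\<^sup>2 = measure \<mu> (W i)"
    unfolding L2_norm_sq sq by simp
qed

lemma schwartz_common_support:
  assumes "finite I" "\<And>i. i \<in> I \<Longrightarrow> f i \<in> schwartz"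
  shows "\<exists>N. \<forall>i\<in>I. \<forall>x. x \<notin> frac_ideal (- int N) \<longrightarrow> f i x = 0"
  using assms
proof (induction I)
  case (insert i I)
  obtain N where N: "\<forall>i\<in>I. \<forall>x. x \<notin> frac_ideal (- int N) \<longrightarrow> f i x = 0"
    using insert by auto
  obtain K m where "schwartz_at K m (f i)"
    using insert.prems[of i, simplified] by (rule schwartzE)
  note K = schwartz_atD(1)[OF this]
  define L where "L = max N (nat (- K))"
  have L: "- int L \<le> - int N" "- int L \<le> K"
    by (simp_all add: L_def)
  have "x \<notin> frac_ideal (- int N)" "x \<notin> frac_ideal K" if "x \<notin> frac_ideal (- int L)" for x
    using that frac_ideal_mono[OF L(1), of x] frac_ideal_mono[OF L(2), of x] by blast+
  then show ?case
    using N K by (intro exI[of _ L]) auto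
qed auto

lemma has_sum_finite_sum:
  fixes f :: "'i \<Rightarrow> 'b \<Rightarrow> real"
  assumes "\<And>i. i \<in> I \<Longrightarrow> (f i has_sum s i) J"
  shows "((\<lambda>j. \<Sum>i\<in>I. f i j) has_sum (\<Sum>i\<in>I. s i)) J"
  using assms by (induction I rule: infinite_finite_induct) (auto intro: has_sum_add)

lemma scaled_tiling_sum:
  assumes tile: "measurable_partition \<mu> (UNIV :: int set) (\<lambda>j. scaled j A) UNIV"
    and f: "integrable \<mu> f" "\<And>x. f x \<ge> (0 :: real)"
  shows "((\<lambda>j. \<integral>x. indicator (scaled (- j) A) x * f x \<partial>\<mu>) has_sum (\<integral>x. f x \<partial>\<mu>)) UNIV"
proof -
  let ?U = "\<Union>j. scaled (- j) A"
  have U: "?U = (\<Union>j. scaled j A)"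
    by (auto intro: exI[of _ "- _"]) (metis add.inverse_inverse)
  have m: "scaled j A \<in> sets \<mu>" for j
    using tile by (simp add: measurable_partition_def)
  have null: "UNIV - ?U \<in> null_sets \<mu>"
    using tile unfolding U by (simp add: measurable_partition_def)
  have "((\<lambda>j. \<integral>x. indicator (scaled (- j) A) x * f x \<partial>\<mu>) has_sum (\<integral>x. indicator ?U x * f x \<partial>\<mu>)) UNIV"
  proof (rule has_sum_integral_almost_disjoint)
    show "AE x in \<mu>. \<forall>i\<in>UNIV. \<forall>j\<in>UNIV. x \<in> scaled (- i) A \<and> x \<in> scaled (- j) A \<longrightarrow> i = j"
      using tile by (intro AE_almost_disjoint) (simp_all add: measurable_partition_def)
  qed (use m f in auto)
  also have "(\<integral>x. indicator ?U x * f x \<partial>\<mu>) = (\<integral>x. f x \<partial>\<mu>)"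
  proof (rule integral_cong_AE)
    have "?U \<in> sets \<mu>"
      using m by (intro sets.countable_UN) auto
    then show "(\<lambda>x. indicator ?U x * f x) \<in> borel_measurable \<mu>"
      using f(1) by (intro borel_measurable_times) auto
    show "AE x in \<mu>. indicator ?U x * f x = f x"
      using AE_not_in[OF null] by eventually_elim simp
  qed (use f in auto)
  finally show ?thesis .
qed

text \<open>
  At scale \<open>j\<close> the system captures the mass of \<open>H\<close> on \<open>\<pi>\<^sup>-\<^sup>j W\<close>; adding over \<open>j\<close> captures all of it.
\<close>

lemma tiling_imp_parseval:
  assumes spec: "has_spectrum I g W" and sep: "separated I W"
    and tile: "\<And>i. i \<in> I \<Longrightarrow> measurable_partition \<mu> (UNIV :: int set) (\<lambda>j. scaled j (W i)) UNIV"
    and H: "H \<in> L2_family I \<mu>"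
  shows "parseval_at I \<mu> (spectral_system g) H"
proof (rule parseval_schwartz_imp_all[OF _ _ _ H])
  have g: "\<And>i. i \<in> I \<Longrightarrow> g i \<in> L2 \<mu>" and W: "\<And>i. i \<in> I \<Longrightarrow> W i \<in> sets borel"
    using spec by (auto simp: has_spectrum_def)
  show fin: "finite I"
    using spec by (simp add: has_spectrum_def)
  show "spectral_system g a \<in> L2_family I \<mu>" for a
    using g by (auto simp: L2_family_def split: prod.split intro: dilation_L2 modulate_L2)
  fix F assume F: "\<And>i. i \<in> I \<Longrightarrow> F i \<in> schwartz"
  then have FL: "F \<in> L2_family I \<mu>"
    by (auto simp: L2_family_def intro: schwartz_L2)
  let ?b = "\<lambda>j. \<Sum>i\<in>I. \<integral>x. indicator (scaled (- j) (W i)) x * (cmod (F i x))\<^sup>2 \<partial>\<mu>"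
  have level: "((\<lambda>k. (cmod (family_inner I \<mu> F (spectral_system g (j, k))))\<^sup>2) has_sum ?b j) UNIV" for j
  proof -
    have D: "dil j (F i) \<in> schwartz" if "i \<in> I" for i
      using F[OF that] by (rule dilation_schwartz)
    obtain N where N: "\<forall>i\<in>I. \<forall>x. x \<notin> frac_ideal (- int N) \<longrightarrow> dil j (F i) x = 0"
      using schwartz_common_support[of I "\<lambda>i. dil j (F i)", OF fin D] by blast
    have "((\<lambda>k. (cmod (\<Sum>i\<in>I. L2_inner \<mu> (dil j (F i)) (modulate k (g i))))\<^sup>2) has_sum
        (\<Sum>i\<in>I. \<integral>x. indicator (W i) x * (cmod (dil j (F i) x))\<^sup>2 \<partial>\<mu>)) UNIV"
      using N D by (intro parseval_single_scale[OF spec sep, where N = N] schwartz_L2) auto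
    moreover have "(\<Sum>i\<in>I. \<integral>x. indicator (W i) x * (cmod (dil j (F i) x))\<^sup>2 \<partial>\<mu>) = ?b j"
      using F W by (intro sum.cong refl dilation_restricted_norm schwartz_L2)
    ultimately show ?thesis
      unfolding spectral_coefficient[OF spec FL] by simp
  qed
  have "(?b has_sum (\<Sum>i\<in>I. \<integral>x. (cmod (F i x))\<^sup>2 \<partial>\<mu>)) UNIV"
    using tile F by (intro has_sum_finite_sum scaled_tiling_sum L2_integrable_sq schwartz_L2) auto
  from has_sum_Sigma_nonneg[of "\<lambda>a. (cmod (family_inner I \<mu> F (spectral_system g a)))\<^sup>2", OF _ level this]
  show "parseval_at I \<mu> (spectral_system g) F"
    by (simp add: parseval_at_def family_norm_sq L2_norm_sq)
qed

section \<open>Parseval systems give tilings\<close>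

text \<open>
  Bessel's inequality at scale zero forbids overlaps. Let \<open>Z \<subseteq> \<O>\<close> lie in two different translates.
  Moving \<open>Z\<close> back into each of the two spectra gives two orthogonal families of squared norm
  \<open>\<mu>(Z)\<close> with the same coefficients, the Fourier coefficients of the indicator of \<open>Z\<close>. Their sum
  has squared norm \<open>2 \<mu>(Z)\<close>, but the squares of its coefficients add up to \<open>4 \<mu>(Z)\<close>.
\<close>

lemma overlap_in_integers_null:
  assumes spec: "has_spectrum I g W"
    and par: "\<forall>H\<in>L2_family I \<mu>. parseval_at I \<mu> (spectral_system g) H"
    and i: "i \<in> I" "i' \<in> I" "(k, i) \<noteq> (k', i')"
    and Z: "Z \<in> sets borel" "Z \<subseteq> frac_ideal 0" "Z \<subseteq> shifted k (W i)" "Z \<subseteq> shifted k' (W i')"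
  shows "Z \<in> null_sets \<mu>"
proof -
  have fin: "finite I" and g: "\<And>r. r \<in> I \<Longrightarrow> g r \<in> L2 \<mu>"
    and modg: "\<And>r x. r \<in> I \<Longrightarrow> cmod (g r x) = indicator (W r) x"
    using spec by (auto simp: has_spectrum_def)
  define h where "h l s x = indicator Z (x + \<gamma> l) * g s x" for l s x
  define H where "H l s r = (if r = s then h l s else (\<lambda>_. 0))" for l s r :: nat
  let ?z = "\<lambda>m. \<integral>y. indicator Z y * chi (\<gamma> m * y) \<partial>\<mu>"
  have unit: "g s x * cnj (g s x) = 1"
    if "s \<in> I" "Z \<subseteq> shifted l (W s)" "x + \<gamma> l \<in> Z" for l s x
  proof -
    have "x \<in> W s"
      using that(2,3) in_shifted[of "x + \<gamma> l" l "W s"] by auto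
    then show ?thesis
      unfolding complex_norm_square[symmetric] modg[OF that(1)] by simp
  qed
  have hL: "h l s \<in> L2 \<mu>" if "s \<in> I" for l s
  proof -
    have "(\<lambda>x. indicator Z (x + \<gamma> l) :: complex) \<in> borel_measurable borel"
      using measurable_compose[OF measurable_add[of "\<gamma> l"], of "indicator Z" borel] Z(1) by simp
    then show ?thesis
      unfolding h_def[abs_def] using g[OF that]
      by (intro L2_mult_bounded[where C = 1]) (auto simp: indicator_def sets_haar cong: measurable_cong_sets)
  qed
  then have HL: "H l s \<in> L2_family I \<mu>" if "s \<in> I" for l s
    using that by (auto simp: L2_family_def H_def L2_zero)
  have inner: "family_inner I \<mu> (H l s) X = L2_inner \<mu> (h l s) (X s)" if "s \<in> I" for l s X
  proof -
    have "L2_inner \<mu> (H l s r) (X r) = (if r = s then L2_inner \<mu> (h l s) (X s) else 0)" for r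
      by (simp add: H_def L2_inner_def)
    then show ?thesis
      using fin that by (simp add: family_inner_def)
  qed
  have dil0: "dil 0 f = f" for f :: "'a \<Rightarrow> complex"
    using Q_gt_1 by (auto simp: dilation_eq)
  have coeff: "family_inner I \<mu> (H l s) (spectral_system g (0, m)) = ?z m"
    if s: "s \<in> I" "Z \<subseteq> shifted l (W s)" for l s m
  proof -
    have "h l s x * cnj (modulate m (g s) x) = indicator Z (x + \<gamma> l) * chi (\<gamma> m * (x + \<gamma> l))" for x
      using unit[OF s, of x] by (simp add: h_def modulate_def indicator_def distrib_left char_add char_u mult_ac)
    then have "family_inner I \<mu> (H l s) (spectral_system g (0, m))
        = (\<integral>x. indicator Z (x + \<gamma> l) * chi (\<gamma> m * (x + \<gamma> l)) \<partial>\<mu>)"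
      by (simp add: inner s(1) dil0 L2_inner_def)
    also have "\<dots> = ?z m"
      using Z(1) by (intro integral_translate[of "\<lambda>y. indicator Z y * chi (\<gamma> m * y)"]
          borel_measurable_times measurable_chi_mult) simp
    finally show ?thesis .
  qed
  have norm: "(family_norm I \<mu> (H l s))\<^sup>2 = measure \<mu> Z" if s: "s \<in> I" "Z \<subseteq> shifted l (W s)" for l s
  proof -
    have "h l s x * cnj (h l s x) = complex_of_real (indicator Z (x + \<gamma> l))" for x
      using unit[OF s, of x] by (simp add: h_def indicator_def)
    then have "complex_of_real ((family_norm I \<mu> (H l s))\<^sup>2) = (\<integral>x. complex_of_real (indicator Z (x + \<gamma> l)) \<partial>\<mu>)"
      unfolding family_inner_self[symmetric] inner[OF s(1)] L2_inner_def by (simp add: H_def)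
    also have "\<dots> = of_real (\<integral>x. indicator Z (x + \<gamma> l) \<partial>\<mu>)"
      by (rule integral_complex_of_real)
    also have "(\<integral>x. indicator Z (x + \<gamma> l) \<partial>\<mu>) = measure \<mu> Z"
      using integral_translate[of "indicator Z :: 'a \<Rightarrow> real" "\<gamma> l"] Z(1) by simp
    finally show ?thesis
      unfolding of_real_eq_iff .
  qed
  have orth: "family_inner I \<mu> (H k i) (H k' i') = 0"
  proof -
    have "h k i x * cnj (H k' i' i x) = 0" for x
    proof (rule ccontr)
      assume "h k i x * cnj (H k' i' i x) \<noteq> 0"
      then have "i = i'" "x + \<gamma> k \<in> Z" "x + \<gamma> k' \<in> Z"
        by (auto simp: H_def h_def indicator_def split: if_splits)
      moreover from this have "(x + \<gamma> k) - (x + \<gamma> k') \<in> frac_ideal 0"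
        using Z(2) by (intro frac_ideal_diff) auto
      then have "k = k'"
        using u_inj by simp
      ultimately show False
        using i(3) by simp
    qed
    then show ?thesis
      unfolding inner[OF i(1)] L2_inner_def by (simp only: integral_zero)
  qed
  let ?G = "\<lambda>r x. - 1 * H k' i' r x"
  let ?F = "\<lambda>r x. H k i r x - ?G r x"
  have GL: "?G \<in> L2_family I \<mu>"
    using HL[OF i(2)] by (rule L2_family_scale)
  have FL: "?F \<in> L2_family I \<mu>"
    using HL[OF i(1)] GL by (rule L2_family_diff)
  have "family_inner I \<mu> (H k i) ?G = 0"
    using orth family_inner_scale_left[of I \<mu> "- 1" "H k' i'" "H k i"]
    by (subst family_inner_commute) (simp add: family_inner_commute[of I \<mu> "H k' i'" "H k i"])
  then have "(family_norm I \<mu> ?F)\<^sup>2 = 2 * measure \<mu> Z"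
    using family_norm_diff_sq[OF HL[OF i(1)] GL] family_norm_scale_sq[of I \<mu> "- 1" "H k' i'"]
      norm[OF i(1) Z(3)] norm[OF i(2) Z(4)] by simp
  then have total: "((\<lambda>a. (cmod (family_inner I \<mu> ?F (spectral_system g a)))\<^sup>2) has_sum 2 * measure \<mu> Z) UNIV"
    using bspec[OF par FL] unfolding parseval_at_def by (simp only:)
  have EL: "spectral_system g a \<in> L2_family I \<mu>" for a
    using g by (auto simp: L2_family_def split: prod.split intro: dilation_L2 modulate_L2)
  have "family_inner I \<mu> ?F (spectral_system g (0, m)) = 2 * ?z m" for m
    unfolding family_inner_diff_left[OF HL[OF i(1), of k] GL EL]
      family_inner_scale_left coeff[OF i(1) Z(3), of m] coeff[OF i(2) Z(4), of m] by simp
  moreover have "(cmod (2 * ?z m))\<^sup>2 = 4 * (cmod (?z m))\<^sup>2" for m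
    by (simp add: norm_mult power_mult_distrib)
  moreover have "((\<lambda>m. 4 * (cmod (?z m))\<^sup>2) has_sum 4 * (L2_norm \<mu> (indicator Z))\<^sup>2) UNIV"
  proof (intro has_sum_cmult_right parseval_integers)
    show "indicator Z \<in> L2 \<mu>"
      using Z by (intro bounded_support_L2[where C = 1 and N = 0]) (auto simp: indicator_def)
  qed (use Z(2) in \<open>auto simp: indicator_def\<close>)
  moreover have "(L2_norm \<mu> (indicator Z))\<^sup>2 = measure \<mu> Z"
  proof -
    have "(cmod (indicator Z y))\<^sup>2 = indicator Z y" for y
      by (simp add: indicator_def)
    then show ?thesis
      unfolding L2_norm_sq by simp
  qed
  ultimately have "((\<lambda>m. (cmod (family_inner I \<mu> ?F (spectral_system g (0, m))))\<^sup>2) has_sum 4 * measure \<mu> Z) UNIV"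
    by (simp only:)
  moreover have "inj_on (Pair (0 :: int)) (UNIV :: nat set)"
    by (auto simp: inj_on_def)
  ultimately have "((\<lambda>a. (cmod (family_inner I \<mu> ?F (spectral_system g a)))\<^sup>2) has_sum 4 * measure \<mu> Z) (range (Pair 0))"
    by (simp only: has_sum_reindex comp_def)
  from this total have "4 * measure \<mu> Z \<le> 2 * measure \<mu> Z"
    by (rule has_sum_mono2) auto
  then have "measure \<mu> Z = 0"
    using measure_nonneg[of \<mu> Z] by linarith
  moreover have "emeasure \<mu> Z < \<infinity>"
    using emeasure_mono[OF Z(2), of \<mu>] haar_frac_ideal_finite[of 0]
    by (simp add: sets_haar)
  ultimately show ?thesis
    using Z(1) by (simp add: null_sets_def sets_haar emeasure_eq_ennreal_measure)
qed

text \<open>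
  The cosets \<open>u(m) + \<O>\<close> are countably many and cover the field, and translation preserves null
  sets; so it suffices to look inside \<open>\<O>\<close>.
\<close>

lemma null_by_cosets:
  assumes X: "X \<in> sets borel" and null: "\<And>m. {x. x + \<gamma> m \<in> X} \<inter> frac_ideal 0 \<in> null_sets \<mu>"
  shows "X \<in> null_sets \<mu>"
proof -
  have "X \<inter> coset (\<gamma> m) 0 \<in> null_sets \<mu>" for m
  proof -
    have "{x. x + \<gamma> m \<in> X \<inter> coset (\<gamma> m) 0} = {x. x + \<gamma> m \<in> X} \<inter> frac_ideal 0"
      by (auto simp: coset_def)
    moreover have "X \<inter> coset (\<gamma> m) 0 \<in> sets borel"
      using X by simp
    ultimately have "emeasure \<mu> (X \<inter> coset (\<gamma> m) 0) = 0"
      using emeasure_translate[of "X \<inter> coset (\<gamma> m) 0" "\<gamma> m"] null[of m] by (simp add: null_setsD1)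
    then show ?thesis
      using X by (simp add: null_sets_def sets_haar)
  qed
  then have "(\<Union>m. X \<inter> coset (\<gamma> m) 0) \<in> null_sets \<mu>"
    by (rule null_sets_UN)
  moreover have "(\<Union>m. X \<inter> coset (\<gamma> m) 0) = X"
    using u_decompose by (auto simp: coset_def)
  ultimately show ?thesis
    by simp
qed

text \<open>
  Translating an overlap into \<open>\<O>\<close> permutes the translates of the spectra, because the \<open>u(k)\<close> form
  a group.
\<close>

lemma parseval_imp_separated:
  assumes spec: "has_spectrum I g W"
    and par: "\<forall>H\<in>L2_family I \<mu>. parseval_at I \<mu> (spectral_system g) H"
  shows "separated I W"
  unfolding separated_def
proof (intro ballI impI)
  fix a b :: "nat \<times> nat"
  assume ab: "a \<in> UNIV \<times> I" "b \<in> UNIV \<times> I" "a \<noteq> b"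
  obtain k i k' i' where a: "a = (k, i)" and b: "b = (k', i')"
    by (cases a, cases b) auto
  have i: "i \<in> I" "i' \<in> I"
    using ab a b by auto
  have W: "W i \<in> sets borel" "W i' \<in> sets borel"
    using spec i by (auto simp: has_spectrum_def)
  let ?X = "shifted k (W i) \<inter> shifted k' (W i')"
  have X: "?X \<in> sets borel"
    using W by (intro sets.Int shifted_measurable)
  have "?X \<in> null_sets \<mu>"
  proof (rule null_by_cosets[OF X])
    fix m
    obtain n n' where n: "\<gamma> k - \<gamma> m = \<gamma> n" "\<gamma> k' - \<gamma> m = \<gamma> n'"
      using u_diff by metis
    have "(n, i) \<noteq> (n', i')"
    proof
      assume "(n, i) = (n', i')"
      then have "\<gamma> k = \<gamma> k'" "i = i'"
        using n by (auto simp: diff_eq_eq)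
      then show False
        using u_inj[of k k'] ab a b by simp
    qed
    moreover have move: "x + \<gamma> m - \<gamma> k = x - \<gamma> n" "x + \<gamma> m - \<gamma> k' = x - \<gamma> n'" for x
      by (simp_all flip: n)
    have sub: "{x. x + \<gamma> m \<in> ?X} \<inter> frac_ideal 0 \<subseteq> shifted n (W i) \<inter> shifted n' (W i')"
      unfolding subset_iff Int_iff mem_Collect_eq in_shifted move by blast
    ultimately show "{x. x + \<gamma> m \<in> ?X} \<inter> frac_ideal 0 \<in> null_sets \<mu>"
      using translate_measurable[OF X] by (intro overlap_in_integers_null[OF spec par i]) auto
  qed
  then show "shifted (fst a) (W (snd a)) \<inter> shifted (fst b) (W (snd b)) \<in> null_sets \<mu>"
    by (simp add: a b)
qed

lemma null_by_balls:
  assumes "\<And>N. X \<inter> frac_ideal (- int N) \<in> null_sets \<mu>"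
  shows "X \<in> null_sets \<mu>"
proof -
  have "(\<Union>N. X \<inter> frac_ideal (- int N)) \<in> null_sets \<mu>"
    using assms by (rule null_sets_UN)
  moreover have "(\<Union>N. X \<inter> frac_ideal (- int N)) = X"
    using ex_nat_frac_ideal by auto
  ultimately show ?thesis
    by simp
qed

text \<open>
  Testing Parseval's identity on the indicator of a bounded set \<open>A\<close> shows that the dilates of the
  spectrum cut \<open>A\<close> into pieces whose measures add up to that of \<open>A\<close>.
\<close>

lemma parseval_scaled_measure:
  assumes spec: "has_spectrum {i} g W"
    and par: "\<forall>H\<in>L2_family {i} \<mu>. parseval_at {i} \<mu> (spectral_system g) H"
    and A: "A \<in> sets borel" "A \<subseteq> frac_ideal (- int N)"
  shows "((\<lambda>j. measure \<mu> (scaled (- j) (W i) \<inter> A)) has_sum measure \<mu> A) UNIV"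
proof -
  have g: "\<And>r. r \<in> {i} \<Longrightarrow> g r \<in> L2 \<mu>" and W: "W i \<in> sets borel"
    using spec by (auto simp: has_spectrum_def)
  let ?h = "\<lambda>x. indicator A x :: complex"
  have hL: "?h \<in> L2 \<mu>"
    using A by (intro bounded_support_L2[where C = 1 and N = "- int N"]) (auto simp: indicator_def)
  then have HL: "(\<lambda>_. ?h) \<in> L2_family {i} \<mu>"
    by (simp add: L2_family_def)
  have sq: "(cmod (?h x))\<^sup>2 = indicator A x" for x
    by (simp add: indicator_def)
  have level: "((\<lambda>k. (cmod (family_inner {i} \<mu> (\<lambda>_. ?h) (spectral_system g (j, k))))\<^sup>2) has_sum
      measure \<mu> (scaled (- j) (W i) \<inter> A)) UNIV" for j
  proof -
    define M where "M = nat (int N - j)"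
    have M: "- int M \<le> - int N - - j"
      by (simp add: M_def)
    have supp: "dil j ?h x = 0" if x: "x \<notin> frac_ideal (- int M)" for x
    proof -
      have "\<pi> powi (- j) * x \<notin> frac_ideal (- int N)"
        unfolding pi_powi_mult_iff using x frac_ideal_mono[OF M, of x] by blast
      then have "\<pi> powi (- j) * x \<notin> A"
        using A(2) by blast
      then show ?thesis
        by (simp add: dilation_eq)
    qed
    have "((\<lambda>k. (cmod (\<Sum>r\<in>{i}. L2_inner \<mu> (dil j ?h) (modulate k (g r))))\<^sup>2) has_sum
        (\<Sum>r\<in>{i}. \<integral>x. indicator (W r) x * (cmod (dil j ?h x))\<^sup>2 \<partial>\<mu>)) UNIV"
      using supp dilation_L2[OF hL]
      by (intro parseval_single_scale[OF spec parseval_imp_separated[OF spec par], where N = M])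
    moreover have "(\<integral>x. indicator (W i) x * (cmod (dil j ?h x))\<^sup>2 \<partial>\<mu>) = measure \<mu> (scaled (- j) (W i) \<inter> A)"
      unfolding dilation_restricted_norm[OF hL W] sq by (simp flip: indicator_inter_arith)
    ultimately show ?thesis
      unfolding spectral_coefficient[OF spec HL] by simp
  qed
  have "(family_norm {i} \<mu> (\<lambda>_. ?h))\<^sup>2 = measure \<mu> A"
    unfolding family_norm_sq L2_norm_sq sq by simp
  then have "((\<lambda>a. (cmod (family_inner {i} \<mu> (\<lambda>_. ?h) (spectral_system g a)))\<^sup>2) has_sum measure \<mu> A) (UNIV \<times> UNIV)"
    using bspec[OF par HL] by (simp add: parseval_at_def)
  then show ?thesis
    using level by (rule has_sum_SigmaD)
qed

text \<open>
  A bounded set inside two dilates of the spectrum would be counted twice in the previous sum, and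
  a bounded set missed by all dilates would not be counted at all.
\<close>

lemma parseval_imp_scaled_tiling:
  assumes spec: "has_spectrum {i} g W"
    and par: "\<forall>H\<in>L2_family {i} \<mu>. parseval_at {i} \<mu> (spectral_system g) H"
  shows "measurable_partition \<mu> (UNIV :: int set) (\<lambda>j. scaled j (W i)) UNIV"
proof -
  note msum = parseval_scaled_measure[OF spec par]
  have Wm: "W i \<in> sets borel"
    using spec by (simp add: has_spectrum_def)
  then have S: "scaled j (W i) \<in> sets borel" for j
    by (rule scaled_measurable)
  have null: "A \<in> null_sets \<mu>" if "A \<in> sets borel" "A \<subseteq> frac_ideal (- int N)" "measure \<mu> A \<le> 0" for A N
  proof -
    have "emeasure \<mu> A \<le> emeasure \<mu> (frac_ideal (- int N))"
      using that by (intro emeasure_mono) (auto simp: sets_haar)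
    then have "emeasure \<mu> A < \<infinity>"
      using haar_frac_ideal_finite[of "- int N"] by (rule order_le_less_trans)
    moreover have "measure \<mu> A = 0"
      using that(3) measure_nonneg[of \<mu> A] by linarith
    ultimately show ?thesis
      using that(1) by (simp add: null_sets_def sets_haar emeasure_eq_ennreal_measure)
  qed
  have disj: "scaled j (W i) \<inter> scaled j' (W i) \<in> null_sets \<mu>" if "j \<noteq> j'" for j j'
  proof (rule null_by_balls)
    fix N
    let ?A = "scaled j (W i) \<inter> scaled j' (W i) \<inter> frac_ideal (- int N)"
    have A: "?A \<in> sets borel" "?A \<subseteq> frac_ideal (- int N)"
      using S by auto
    have "(\<Sum>l\<in>{- j, - j'}. measure \<mu> (scaled (- l) (W i) \<inter> ?A)) \<le> measure \<mu> ?A"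
      using msum[OF A] by (rule finite_sum_le_has_sum) auto
    moreover have "scaled j (W i) \<inter> ?A = ?A" "scaled j' (W i) \<inter> ?A = ?A"
      by auto
    ultimately have "measure \<mu> ?A \<le> 0"
      using that by simp
    then show "?A \<in> null_sets \<mu>"
      using null[OF A] by simp
  qed
  have cover: "UNIV - (\<Union>j. scaled j (W i)) \<in> null_sets \<mu>"
  proof (rule null_by_balls)
    fix N
    let ?A = "(UNIV - (\<Union>j. scaled j (W i))) \<inter> frac_ideal (- int N)"
    have A: "?A \<in> sets borel" "?A \<subseteq> frac_ideal (- int N)"
      using S by (auto intro!: sets.Int sets.Diff sets.countable_UN)
    have "scaled (- j) (W i) \<inter> ?A = {}" for j
      by auto
    then have "((\<lambda>j :: int. 0) has_sum measure \<mu> ?A) UNIV"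
      using msum[OF A] by simp
    then have "measure \<mu> ?A = 0"
      using has_sum_unique[OF _ has_sum_0] by blast
    then show "?A \<in> null_sets \<mu>"
      using null[OF A] by simp
  qed
  show ?thesis
    using S disj cover by (simp add: measurable_partition_def sets_haar)
qed

section \<open>The translates cover exactly when the spectra have total measure one\<close>

text \<open>
  The pieces of \<open>W i\<close> in the various cosets of \<open>\<O>\<close> are moved into \<open>\<O>\<close> by the translations, and
  separation means that they do not overlap there.
\<close>

lemma separated_measure_in_integers:
  assumes spec: "has_spectrum I g W" and sep: "separated I W"
  shows "measure \<mu> ((\<Union>a\<in>UNIV \<times> I. shifted (fst a) (W (snd a))) \<inter> frac_ideal 0) = (\<Sum>i\<in>I. measure \<mu> (W i))"
proof -
  have fin: "finite I" and W: "\<And>i. i \<in> I \<Longrightarrow> W i \<in> sets borel"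
    using spec by (auto simp: has_spectrum_def)
  let ?S = "\<lambda>a. shifted (fst a) (W (snd a))"
  let ?O = "indicator (frac_ideal 0) :: 'a \<Rightarrow> real"
  have S: "?S a \<in> sets \<mu>" if "a \<in> UNIV \<times> I" for a
    using that W shifted_measurable by (auto simp: sets_haar)
  have O: "integrable \<mu> ?O"
    by (simp add: haar_frac_ideal)
  have "((\<lambda>a. \<integral>x. indicator (?S a) x * ?O x \<partial>\<mu>) has_sum
      (\<integral>x. indicator (\<Union>a\<in>UNIV \<times> I. ?S a) x * ?O x \<partial>\<mu>)) (UNIV \<times> I)"
    using fin S O separated_AE[OF fin sep]
    by (intro has_sum_integral_almost_disjoint) (auto simp: countable_finite)
  moreover have "((\<lambda>a. \<integral>x. indicator (?S a) x * ?O x \<partial>\<mu>) has_sum (\<Sum>i\<in>I. measure \<mu> (W i))) (UNIV \<times> I)"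
  proof -
    have row: "((\<lambda>k. \<integral>x. indicator (shifted k (W i)) x * ?O x \<partial>\<mu>) has_sum measure \<mu> (W i)) UNIV"
      if i: "i \<in> I" for i
    proof -
      have "((\<lambda>k. \<integral>x. indicator {x. x + \<gamma> k \<in> frac_ideal 0} x * (indicator (W i) x :: real) \<partial>\<mu>) has_sum
          (\<integral>x. indicator (\<Union>k. {x. x + \<gamma> k \<in> frac_ideal 0}) x * (indicator (W i) x :: real) \<partial>\<mu>)) UNIV"
      proof (rule has_sum_integral_almost_disjoint)
        show "integrable \<mu> (\<lambda>x. indicator (W i) x :: real)"
          using spec i by (rule has_spectrum_norm_sq)
        show "{x. x + \<gamma> k \<in> frac_ideal 0} \<in> sets \<mu>" for k
          using translate_measurable[OF borel_frac_ideal] by (simp add: sets_haar)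
        have "k = l" if "x + \<gamma> k \<in> frac_ideal 0" "x + \<gamma> l \<in> frac_ideal 0" for x k l
          using frac_ideal_diff[OF that] u_inj[of k l] by simp
        then show "AE x in \<mu>. \<forall>k\<in>UNIV. \<forall>l\<in>UNIV.
            x \<in> {x. x + \<gamma> k \<in> frac_ideal 0} \<and> x \<in> {x. x + \<gamma> l \<in> frac_ideal 0} \<longrightarrow> k = l"
          by auto
      qed auto
      moreover have "(\<Union>k. {x. x + \<gamma> k \<in> frac_ideal 0}) = UNIV"
      proof -
        have "\<exists>k. x + \<gamma> k \<in> frac_ideal 0" for x
        proof -
          obtain k where "- x - \<gamma> k \<in> frac_ideal 0"
            using u_decompose by blast
          then show ?thesis
            using frac_ideal_minus_iff[of "x + \<gamma> k" 0] by (intro exI[of _ k]) simp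
        qed
        then show ?thesis
          by auto
      qed
      moreover have "(\<integral>x. indicator (shifted k (W i)) x * ?O x \<partial>\<mu>)
          = (\<integral>x. indicator {x. x + \<gamma> k \<in> frac_ideal 0} x * (indicator (W i) x :: real) \<partial>\<mu>)" for k
      proof -
        have "(\<lambda>x. indicator (shifted k (W i)) x * ?O x) \<in> borel_measurable borel"
          using shifted_measurable[OF W[OF i]] by (intro borel_measurable_times) auto
        from integral_translate[OF this, of "\<gamma> k"] show ?thesis
          by (simp add: indicator_def in_shifted mult.commute)
      qed
      ultimately show ?thesis
        by simp
    qed
    have fin_sum: "((\<lambda>i. measure \<mu> (W i)) has_sum (\<Sum>i\<in>I. measure \<mu> (W i))) I"
      using fin by (rule has_sum_finite)
    let ?f = "\<lambda>a. \<integral>x. indicator (shifted (snd a) (W (fst a))) x * ?O x \<partial>\<mu>"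
    have "(?f has_sum (\<Sum>i\<in>I. measure \<mu> (W i))) (I \<times> UNIV)"
    proof (rule has_sum_Sigma_nonneg[OF _ _ fin_sum])
      show "?f a \<ge> 0" for a
        by (intro integral_nonneg_AE) auto
      show "((\<lambda>k. ?f (i, k)) has_sum measure \<mu> (W i)) UNIV" if "i \<in> I" for i
        using row[OF that] by simp
    qed
    then show ?thesis
      by (subst (asm) has_sum_swap) (simp add: case_prod_unfold)
  qed
  ultimately have "(\<integral>x. indicator (\<Union>a\<in>UNIV \<times> I. ?S a) x * ?O x \<partial>\<mu>) = (\<Sum>i\<in>I. measure \<mu> (W i))"
    by (rule has_sum_unique)
  then show ?thesis
    by (simp flip: indicator_inter_arith)
qed

text \<open>
  The union of the translates is invariant under the group of all \<open>u(k)\<close>, so it fills the field as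
  soon as it fills \<open>\<O>\<close>, which has measure one.
\<close>

lemma translation_tiling_iff:
  assumes spec: "has_spectrum I g W" and sep: "separated I W"
  shows "UNIV - (\<Union>a\<in>UNIV \<times> I. shifted (fst a) (W (snd a))) \<in> null_sets \<mu>
    \<longleftrightarrow> (\<Sum>i\<in>I. measure \<mu> (W i)) = 1"
proof -
  have fin: "finite I" and W: "\<And>i. i \<in> I \<Longrightarrow> W i \<in> sets borel"
    using spec by (auto simp: has_spectrum_def)
  let ?U = "\<Union>a\<in>UNIV \<times> I. shifted (fst a) (W (snd a))"
  have U: "?U \<in> sets borel"
    using W shifted_measurable fin by (intro sets.countable_UN') (auto simp: countable_finite)
  have meas: "measure \<mu> (?U \<inter> frac_ideal 0) = (\<Sum>i\<in>I. measure \<mu> (W i))"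
    using spec sep by (rule separated_measure_in_integers)
  have O: "measure \<mu> (frac_ideal 0) = 1" "emeasure \<mu> (frac_ideal 0) = 1"
    by (simp_all add: measure_def haar_frac_ideal)
  have split: "measure \<mu> (frac_ideal 0 - ?U) = 1 - measure \<mu> (?U \<inter> frac_ideal 0)"
  proof -
    have "frac_ideal 0 - ?U = frac_ideal 0 - (?U \<inter> frac_ideal 0)"
      by blast
    also have "measure \<mu> \<dots> = measure \<mu> (frac_ideal 0) - measure \<mu> (?U \<inter> frac_ideal 0)"
      using U O(2) by (intro measure_Diff) (auto simp: sets_haar)
    finally show ?thesis
      by (simp add: O)
  qed
  show ?thesis
  proof
    assume "UNIV - ?U \<in> null_sets \<mu>"
    then have "frac_ideal 0 - ?U \<in> null_sets \<mu>"
      by (rule null_sets_subset) (use U in \<open>auto simp: sets_haar\<close>)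
    then have "measure \<mu> (frac_ideal 0 - ?U) = 0"
      by (simp add: measure_def null_setsD1)
    then show "(\<Sum>i\<in>I. measure \<mu> (W i)) = 1"
      using split meas by simp
  next
    assume "(\<Sum>i\<in>I. measure \<mu> (W i)) = 1"
    then have "measure \<mu> (frac_ideal 0 - ?U) = 0"
      using split meas by simp
    moreover have "emeasure \<mu> (frac_ideal 0 - ?U) \<le> emeasure \<mu> (frac_ideal 0)"
      by (intro emeasure_mono) (auto simp: sets_haar)
    then have "emeasure \<mu> (frac_ideal 0 - ?U) \<noteq> \<infinity>"
      by (auto simp: O top_unique)
    ultimately have null: "frac_ideal 0 - ?U \<in> null_sets \<mu>"
      using U by (simp add: null_sets_def sets_haar emeasure_eq_ennreal_measure)
    show "UNIV - ?U \<in> null_sets \<mu>"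
    proof (rule null_by_cosets)
      show "UNIV - ?U \<in> sets borel"
        using U by auto
      fix m
      have inv: "x + \<gamma> m \<in> ?U" if "x \<in> ?U" for x
      proof -
        obtain k i where k: "i \<in> I" "x - \<gamma> k \<in> W i"
          using \<open>x \<in> ?U\<close> by (auto simp: in_shifted)
        obtain z where z: "\<gamma> 0 - \<gamma> m = \<gamma> z"
          using u_diff by blast
        obtain l where l: "\<gamma> k - \<gamma> z = \<gamma> l"
          using u_diff by blast
        have "x + \<gamma> m - \<gamma> l = x - \<gamma> k"
          using z by (simp add: l[symmetric] z[symmetric])
        then have "x + \<gamma> m \<in> shifted l (W i)"
          using k(2) by (simp only: in_shifted)
        then show ?thesis
          using k(1) by (intro UN_I[of "(l, i)"]) simp_all
      qed
      have "{x. x + \<gamma> m \<in> UNIV - ?U} \<inter> frac_ideal 0 \<subseteq> frac_ideal 0 - ?U"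
        using inv by blast
      moreover have "{x. x + \<gamma> m \<in> UNIV - ?U} \<inter> frac_ideal 0 \<in> sets \<mu>"
        using translate_measurable[of "UNIV - ?U"] U by (simp add: sets_haar)
      ultimately show "{x. x + \<gamma> m \<in> UNIV - ?U} \<inter> frac_ideal 0 \<in> null_sets \<mu>"
        using null null_sets_subset by blast
    qed
  qed
qed

end

context wavelet_setting begin

section \<open>Super-wavelets\<close>

lemma parseval_frame_wavelet_iff:
  assumes "\<eta> i \<in> L2 \<mu>"
  shows "parseval_frame_wavelet p c \<pi> \<epsilon> \<mu> (\<eta> i)
    \<longleftrightarrow> (\<forall>F\<in>L2_family {i} \<mu>. parseval_at {i} \<mu> (\<lambda>(j, k) i. dil j (trn k (\<eta> i))) F)"
proof -
  let ?P = "\<lambda>f. ((\<lambda>(j, k). (cmod (L2_inner \<mu> f (dil j (trn k (\<eta> i)))))\<^sup>2) has_sum (L2_norm \<mu> f)\<^sup>2) UNIV"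
  have eq: "parseval_at {i} \<mu> (\<lambda>(j, k) i. dil j (trn k (\<eta> i))) F \<longleftrightarrow> ?P (F i)" for F
    by (simp add: parseval_at_def family_inner_def family_norm_sq case_prod_unfold)
  have "(\<forall>F\<in>L2_family {i} \<mu>. ?P (F i)) \<longleftrightarrow> (\<forall>f\<in>L2 \<mu>. ?P f)"
  proof
    assume *: "\<forall>F\<in>L2_family {i} \<mu>. ?P (F i)"
    show "\<forall>f\<in>L2 \<mu>. ?P f"
    proof
      fix f assume "f \<in> L2 \<mu>"
      then have "(\<lambda>_. f) \<in> L2_family {i} \<mu>"
        by (simp add: L2_family_def)
      from bspec[OF * this] show "?P f" .
    qed
  qed (simp add: L2_family_def)
  then show ?thesis
    unfolding eq parseval_frame_wavelet_def using assms by blast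
qed

text \<open>
  An orthonormal basis of the direct sum is a Parseval system of unit vectors. All vectors of the
  system have the same squared norm, which the Fourier transform identifies with the total measure
  of the spectra.
\<close>

lemma super_wavelet_iff:
  assumes fourier: "\<And>i. i \<in> {1..n} \<Longrightarrow> is_fourier_L2 \<mu> chi (\<eta> i) (g i)"
    and spec: "has_spectrum {1..n} g W"
  shows "super_wavelet p c \<pi> \<epsilon> \<mu> n \<eta> \<longleftrightarrow>
    (\<forall>i\<in>{1..n}. \<forall>H\<in>L2_family {i} \<mu>. parseval_at {i} \<mu> (spectral_system g) H) \<and>
    (\<forall>H\<in>L2_family {1..n} \<mu>. parseval_at {1..n} \<mu> (spectral_system g) H) \<and>
    (\<Sum>i\<in>{1..n}. measure \<mu> (W i)) = 1"
proof -
  let ?I = "{1..n}"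
  let ?B = "\<lambda>(j, k) i. dil j (trn k (\<eta> i))"
  have L: "\<eta> i \<in> L2 \<mu>" if "i \<in> ?I" for i
    using fourier[OF that] by (simp add: is_fourier_L2_def)
  have B: "?B a \<in> L2_family ?I \<mu>" for a
    unfolding L2_family_def by (cases a) (simp del: One_nat_def add: dilation_L2 translation_L2 L)
  have norm: "(family_norm ?I \<mu> (?B a))\<^sup>2 = (\<Sum>i\<in>?I. measure \<mu> (W i))" for a
  proof -
    obtain j k where a: "a = (j, k)"
      by fastforce
    have "L2_norm \<mu> (dil j (trn k (\<eta> i))) = L2_norm \<mu> (g i)" if "i \<in> ?I" for i
      using dilation_norm[OF translation_L2[OF L[OF that]]] translation_norm[OF L[OF that]]
        is_fourier_norm[OF fourier[OF that]] by simp
    then show ?thesis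
      unfolding a family_norm_sq prod.case
      by (intro sum.cong refl) (simp add: has_spectrum_norm_sq[OF spec])
  qed
  have "family_norm ?I \<mu> (?B a) = 1 \<longleftrightarrow> (\<Sum>i\<in>?I. measure \<mu> (W i)) = 1" for a
    unfolding norm[of a, symmetric] power2_eq_1_iff
    using family_norm_nonneg[of ?I \<mu> "?B a"] by linarith
  then have ortho: "orthonormal_basis_L2_sum \<mu> n ?B \<longleftrightarrow>
      (\<Sum>i\<in>?I. measure \<mu> (W i)) = 1 \<and> (\<forall>F\<in>L2_family ?I \<mu>. parseval_at ?I \<mu> ?B F)"
    unfolding orthonormal_basis_iff_parseval[OF B] by simp
  have single: "parseval_frame_wavelet p c \<pi> \<epsilon> \<mu> (\<eta> i)
      \<longleftrightarrow> (\<forall>H\<in>L2_family {i} \<mu>. parseval_at {i} \<mu> (spectral_system g) H)" if "i \<in> ?I" for i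
    unfolding parseval_frame_wavelet_iff[of \<eta>, OF L[OF that]]
    using fourier[OF that] by (intro parseval_transfer) auto
  have "(\<forall>F\<in>L2_family ?I \<mu>. parseval_at ?I \<mu> ?B F)
      \<longleftrightarrow> (\<forall>H\<in>L2_family ?I \<mu>. parseval_at ?I \<mu> (spectral_system g) H)"
    using fourier by (intro parseval_transfer) auto
  then show ?thesis
    unfolding super_wavelet_def using ortho single by blast
qed

lemma separated_partition_iff:
  assumes "has_spectrum I g W"
  shows "separated I W \<longleftrightarrow> (\<exists>E. measurable_partition \<mu> (UNIV \<times> I) (\<lambda>(k, i). shifted k (W i)) E)"
    and "measurable_partition \<mu> (UNIV \<times> I) (\<lambda>(k, i). shifted k (W i)) UNIV
      \<longleftrightarrow> separated I W \<and> (\<Sum>i\<in>I. measure \<mu> (W i)) = 1"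
proof -
  have fin: "finite I" and W: "\<And>i. i \<in> I \<Longrightarrow> W i \<in> sets borel"
    using assms by (auto simp: has_spectrum_def)
  have c: "countable (UNIV \<times> I :: (nat \<times> nat) set)"
    using fin by (simp add: countable_finite)
  have S: "\<forall>a\<in>UNIV \<times> I. (case a of (k, i) \<Rightarrow> shifted k (W i)) \<in> sets \<mu>"
    using W shifted_measurable by (auto simp: sets_haar)
  have U: "(\<Union>a\<in>UNIV \<times> I. case a of (k, i) \<Rightarrow> shifted k (W i)) \<in> sets \<mu>"
    using c S by (intro sets.countable_UN') auto
  have mp: "measurable_partition \<mu> (UNIV \<times> I) (\<lambda>(k, i). shifted k (W i)) E \<longleftrightarrow>
      E \<in> sets \<mu> \<and> separated I W \<and>
      ((\<Union>a\<in>UNIV \<times> I. shifted (fst a) (W (snd a))) - E) \<union>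
      (E - (\<Union>a\<in>UNIV \<times> I. shifted (fst a) (W (snd a)))) \<in> null_sets \<mu>" for E
    unfolding measurable_partition_def separated_def using c S by (simp add: case_prod_unfold)
  show "separated I W \<longleftrightarrow> (\<exists>E. measurable_partition \<mu> (UNIV \<times> I) (\<lambda>(k, i). shifted k (W i)) E)"
    unfolding mp using U
    by (auto intro!: exI[of _ "\<Union>a\<in>UNIV \<times> I. shifted (fst a) (W (snd a))"] simp: case_prod_unfold)
  show "measurable_partition \<mu> (UNIV \<times> I) (\<lambda>(k, i). shifted k (W i)) UNIV
      \<longleftrightarrow> separated I W \<and> (\<Sum>i\<in>I. measure \<mu> (W i)) = 1"
    unfolding mp using translation_tiling_iff[OF assms] by (auto simp: sets_haar)
qed

lemma separated_singleton_iff: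
  assumes "has_spectrum {i} g W"
  shows "separated {i} W \<longleftrightarrow> (\<exists>E. measurable_partition \<mu> (UNIV :: nat set) (\<lambda>k. shifted k (W i)) E)"
proof -
  have "measurable_partition \<mu> (UNIV \<times> {i}) (\<lambda>(k, i). shifted k (W i)) E
      \<longleftrightarrow> measurable_partition \<mu> (UNIV :: nat set) (\<lambda>k. shifted k (W i)) E" for E
  proof -
    have "(\<Union>a\<in>UNIV \<times> {i}. case a of (k, i) \<Rightarrow> shifted k (W i)) = (\<Union>k. shifted k (W i))"
      by auto
    then show ?thesis
      unfolding measurable_partition_def by (auto simp: countable_finite)
  qed
  then show ?thesis
    using separated_partition_iff(1)[OF assms] by simp
qed

lemma super_wavelet_characterisation:
  assumes fourier: "\<And>i. i \<in> {1..n} \<Longrightarrow> is_fourier_L2 \<mu> chi (\<eta> i) (g i)"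
    and spec: "has_spectrum {1..n} g W"
  shows "super_wavelet p c \<pi> \<epsilon> \<mu> n \<eta> \<longleftrightarrow>
    (\<forall>i\<in>{1..n}. measurable_partition \<mu> (UNIV :: int set) (\<lambda>j. scaled j (W i)) UNIV) \<and>
    (\<forall>i\<in>{1..n}. \<exists>E. measurable_partition \<mu> (UNIV :: nat set) (\<lambda>k. shifted k (W i)) E) \<and>
    measurable_partition \<mu> (UNIV \<times> {1..n}) (\<lambda>(k, i). shifted k (W i)) UNIV"
proof -
  let ?I = "{1..n}"
  have spec1: "has_spectrum {i} g W" if "i \<in> ?I" for i
    using spec by (rule has_spectrum_subset) (use that in auto)
  have single: "(\<forall>H\<in>L2_family {i} \<mu>. parseval_at {i} \<mu> (spectral_system g) H) \<longleftrightarrow>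
      measurable_partition \<mu> (UNIV :: int set) (\<lambda>j. scaled j (W i)) UNIV \<and> separated {i} W"
    if "i \<in> ?I" for i
    using parseval_imp_scaled_tiling[OF spec1[OF that]] parseval_imp_separated[OF spec1[OF that]]
      tiling_imp_parseval[OF spec1[OF that]] by blast
  have sw: "super_wavelet p c \<pi> \<epsilon> \<mu> n \<eta> \<longleftrightarrow>
      (\<forall>i\<in>?I. \<forall>H\<in>L2_family {i} \<mu>. parseval_at {i} \<mu> (spectral_system g) H) \<and>
      (\<forall>H\<in>L2_family ?I \<mu>. parseval_at ?I \<mu> (spectral_system g) H) \<and>
      (\<Sum>i\<in>?I. measure \<mu> (W i)) = 1"
    using fourier spec by (rule super_wavelet_iff)
  show ?thesis
    unfolding sw separated_partition_iff(2)[OF spec]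
  proof (intro iffI conjI ballI)
    assume *: "(\<forall>i\<in>?I. \<forall>H\<in>L2_family {i} \<mu>. parseval_at {i} \<mu> (spectral_system g) H) \<and>
        (\<forall>H\<in>L2_family ?I \<mu>. parseval_at ?I \<mu> (spectral_system g) H) \<and> (\<Sum>i\<in>?I. measure \<mu> (W i)) = 1"
    then show "separated ?I W"
      using parseval_imp_separated[OF spec] by blast
    show "(\<Sum>i\<in>?I. measure \<mu> (W i)) = 1"
      using * by blast
    fix i assume i: "i \<in> ?I"
    then have t: "measurable_partition \<mu> (UNIV :: int set) (\<lambda>j. scaled j (W i)) UNIV \<and> separated {i} W"
      using * single[OF i] by blast
    show "measurable_partition \<mu> (UNIV :: int set) (\<lambda>j. scaled j (W i)) UNIV"
      using t by blast
    show "\<exists>E. measurable_partition \<mu> (UNIV :: nat set) (\<lambda>k. shifted k (W i)) E"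
      using t separated_singleton_iff[OF spec1[OF i]] by blast
  next
    assume *: "(\<forall>i\<in>?I. measurable_partition \<mu> (UNIV :: int set) (\<lambda>j. scaled j (W i)) UNIV) \<and>
        (\<forall>i\<in>?I. \<exists>E. measurable_partition \<mu> (UNIV :: nat set) (\<lambda>k. shifted k (W i)) E) \<and>
        separated ?I W \<and> (\<Sum>i\<in>?I. measure \<mu> (W i)) = 1"
    then show "(\<Sum>i\<in>?I. measure \<mu> (W i)) = 1"
      by blast
    have sep: "separated ?I W"
      using * by blast
    show "parseval_at {i} \<mu> (spectral_system g) H" if "i \<in> ?I" "H \<in> L2_family {i} \<mu>" for i H
      using single[OF that(1)] * separated_singleton_iff[OF spec1[OF that(1)]] that by blast
    show "parseval_at ?I \<mu> (spectral_system g) H" if "H \<in> L2_family ?I \<mu>" for H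
      using * by (intro tiling_imp_parseval[OF spec sep _ that]) blast
  qed
qed

lemma is_fourier_cong_AE:
  assumes "is_fourier_L2 \<mu> chi \<eta> g" "g' \<in> borel_measurable \<mu>" "AE \<xi> in \<mu>. g \<xi> = g' \<xi>"
  shows "is_fourier_L2 \<mu> chi \<eta> g'"
proof -
  obtain F where L: "\<eta> \<in> L2 \<mu>" "g \<in> L2 \<mu>"
    and F: "\<forall>m. integrable \<mu> (F m) \<and> F m \<in> L2 \<mu> \<and> ft (F m) \<in> L2 \<mu>"
      "(\<lambda>m. L2_norm \<mu> (\<lambda>x. F m x - \<eta> x)) \<longlonglongrightarrow> 0"
      "(\<lambda>m. L2_norm \<mu> (\<lambda>\<xi>. ft (F m) \<xi> - g \<xi>)) \<longlonglongrightarrow> 0"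
    using assms(1) unfolding is_fourier_L2_def by blast
  have gm: "g \<in> borel_measurable \<mu>"
    using L(2) by (rule L2_measurable)
  have "integrable \<mu> (\<lambda>\<xi>. (cmod (g' \<xi>))\<^sup>2)"
  proof (rule integrable_cong_AE_imp[OF L2_integrable_sq[OF L(2)]])
    show "(\<lambda>\<xi>. (cmod (g' \<xi>))\<^sup>2) \<in> borel_measurable \<mu>"
      using assms(2) by (rule borel_cmod_sq)
    show "AE \<xi> in \<mu>. (cmod (g \<xi>))\<^sup>2 = (cmod (g' \<xi>))\<^sup>2"
      using assms(3) by eventually_elim simp
  qed
  then have g': "g' \<in> L2 \<mu>"
    using assms(2) by (simp add: L2_def)
  have "L2_norm \<mu> (\<lambda>\<xi>. ft (F m) \<xi> - g \<xi>) = L2_norm \<mu> (\<lambda>\<xi>. ft (F m) \<xi> - g' \<xi>)" for m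
    unfolding L2_norm_def
  proof (intro arg_cong[where f = sqrt] integral_cong_AE)
    have "ft (F m) \<in> L2 \<mu>"
      using F(1) by blast
    then show "(\<lambda>\<xi>. (cmod (ft (F m) \<xi> - g \<xi>))\<^sup>2) \<in> borel_measurable \<mu>"
        "(\<lambda>\<xi>. (cmod (ft (F m) \<xi> - g' \<xi>))\<^sup>2) \<in> borel_measurable \<mu>"
      using L(2) g' by (auto intro!: borel_cmod_sq L2_measurable L2_diff)
    show "AE \<xi> in \<mu>. (cmod (ft (F m) \<xi> - g \<xi>))\<^sup>2 = (cmod (ft (F m) \<xi> - g' \<xi>))\<^sup>2"
      using assms(3) by eventually_elim simp
  qed
  then show ?thesis
    unfolding is_fourier_L2_def using L(1) g' F by (intro conjI exI[of _ F]) simp_all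
qed

end

theorem theorem4p3:
  fixes absv :: "'a::{field, metric_space} \<Rightarrow> real"
    and p c n :: nat and \<pi> :: 'a and \<epsilon> :: "nat \<Rightarrow> 'a"
    and \<mu> :: "'a measure" and chi :: "'a \<Rightarrow> complex"
    and \<eta> \<eta>hat :: "nat \<Rightarrow> 'a \<Rightarrow> complex" and W :: "nat \<Rightarrow> 'a set"
  assumes "wavelet_setting absv p c \<pi> \<epsilon> \<mu> chi"
    and "n \<ge> 1"
    and "\<And>i. i \<in> {1..n} \<Longrightarrow> \<eta> i \<in> L2 \<mu>"
    and "\<And>i. i \<in> {1..n} \<Longrightarrow> W i \<in> sets \<mu>"
    and "\<And>i. i \<in> {1..n} \<Longrightarrow> is_fourier_L2 \<mu> chi (\<eta> i) (\<eta>hat i)"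
    and "\<And>i. i \<in> {1..n} \<Longrightarrow> AE \<xi> in \<mu>. cmod (\<eta>hat i \<xi>) = indicator (W i) \<xi>"
  shows "super_wavelet p c \<pi> \<epsilon> \<mu> n \<eta> \<longleftrightarrow>
     (\<forall>i\<in>{1..n}. measurable_partition \<mu> (UNIV :: int set)
        (\<lambda>j. (\<lambda>x. \<pi> powi j * x) ` W i) UNIV) \<and>
     (\<forall>i\<in>{1..n}. \<exists>E. measurable_partition \<mu> (UNIV :: nat set)
        (\<lambda>k. (\<lambda>x. x + u p c \<pi> \<epsilon> k) ` W i) E) \<and>
     measurable_partition \<mu> ((UNIV :: nat set) \<times> {1..n})
        (\<lambda>(k, i). (\<lambda>x. x + u p c \<pi> \<epsilon> k) ` W i) UNIV"
proof -
  interpret wavelet_setting absv p c \<pi> \<epsilon> \<mu> chi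
    by fact
  \<comment> \<open>correct the transforms on a null set, so that their modulus is an indicator everywhere\<close>
  define g where "g i \<xi> = (if cmod (\<eta>hat i \<xi>) = indicator (W i) \<xi> then \<eta>hat i \<xi>
      else indicator (W i) \<xi>)" for i \<xi>
  have gm: "g i \<in> borel_measurable \<mu>" if i: "i \<in> {1..n}" for i
  proof -
    have "\<eta>hat i \<in> L2 \<mu>"
      using assms(5)[OF i] by (simp add: is_fourier_L2_def)
    then have [measurable]: "\<eta>hat i \<in> borel_measurable \<mu>"
      by (rule L2_measurable)
    have [measurable]: "W i \<in> sets \<mu>"
      using assms(4)[OF i] .
    show ?thesis
      unfolding g_def[abs_def] by measurable
  qed
  have fourier: "is_fourier_L2 \<mu> chi (\<eta> i) (g i)" if i: "i \<in> {1..n}" for i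
  proof (rule is_fourier_cong_AE[OF assms(5)[OF i] gm[OF i]])
    show "AE \<xi> in \<mu>. \<eta>hat i \<xi> = g i \<xi>"
      using assms(6)[OF i] by eventually_elim (simp add: g_def)
  qed
  have spec: "has_spectrum {1..n} g W"
    unfolding has_spectrum_def
  proof (intro conjI ballI allI)
    fix i x assume i: "i \<in> {1..n}"
    show "g i \<in> L2 \<mu>"
      using fourier[OF i] by (simp add: is_fourier_L2_def)
    show "W i \<in> sets borel"
      using assms(4)[OF i] by (simp add: sets_haar)
    show "cmod (g i x) = indicator (W i) x"
      by (simp add: g_def indicator_def)
  qed simp
  show ?thesis
    using super_wavelet_characterisation[OF fourier spec] unfolding scaled_def shifted_def .
qed

end
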